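(* Let $n\ge 3$ and let $l_1,\ldots,l_L$ be positive integers. For every state $p=p_L\otimes\cdots\otimes p_1\in B_{l_L}\otimes\cdots\otimes B_{l_1}$, $$\mathcal E^\ast_{v^\ast_a}(p)=\rho^\ast_{v^\ast_a}(p)\qquad(1\le a\le n-2).$$
   Context: **Crystals (as sets).** $n\ge3$. For $l\ge1$, $B_l=\{\zeta=(\zeta_1,\ldots,\zeta_n,\overline\zeta_n,\ldots,\overline\zeta_1)\in\mathbb Z_{\ge0}^{2n}\mid \sum_{i=1}^n(\zeta_i+\overline\zeta_i)=l,\ \zeta_n\overline\zeta_n=0\}$ (the crystal of the $l$-fold symmetric tensor representation of $U_q(D_n^{(1)})$). $u^\ast_l=(0,\ldots,0,l)\in B_l$ (i.e. $\overline\zeta_1=l$). $B_l$ is identified with $B'_l=\{x=(x_1,\ldots,x_n,\overline x_{n-1},\ldots,\overline x_1)\in\mathbb Z^{2n-1}\mid x_i,\overline x_i\ge0\ (1\le i\le n-1),\ x_n\ge-\min(x_{n-1},\overline x_{n-1}),\ \sum_{i=1}^{n-1}(x_i+\overline x_i)+x_n=l\}$ by $x_i=\zeta_i,\ \overline x_i=\overline\zeta_i$ $(i\le n-2)$, $x_{n-1}=\zeta_{n-1}+\overline\zeta_n$, $x_n=\zeta_n-\overline\zeta_n$, $\overline x_{n-1}=\overline\zeta_{n-1}+\overline\zeta_n$ (inverse: $\zeta_n=\max(0,x_n)$, $\overline\zeta_n=\max(0,-x_n)$, $\zeta_{n-1}=x_{n-1}+\min(0,x_n)$, $\overline\zeta_{n-1}=\overline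 x_{n-1}+\min(0,x_n)$). Write $\ell(x)=\ell(\zeta)=l$. Elements of tensor products are tuples, written with $\otimes$. **Piecewise linear functions.** Involutions on a single element: $\sigma_1$ swaps $x_1\leftrightarrow\overline x_1$; $\ast$ swaps $x_i\leftrightarrow\overline x_i$ for $1\le i\le n-1$; other coordinates are unchanged. On pairs, $(x,y)^{\sigma_1}=(x^{\sigma_1},y^{\sigma_1})$ and $(x,y)^\ast=(y^\ast,x^\ast)$; for a function $f(x,y)$ put $f^{\sigma_1}(x,y)=f((x,y)^{\sigma_1})$, $f^\ast(x,y)=f((x,y)^\ast)$. For $x\in B'_l,\ y\in B'_m$, $0\le i\le n-1$: $V_i=\max(\{\theta_{i,j},\theta'_{i,j}\mid1\le j\le n-2\}\cup\{\eta_{i,j},\eta'_{i,j}\mid1\le j\le n\})$, with - $\theta_{i,j}=\ell(x)+\sum_{k=j+1}^i(\overline y_k-\overline x_k)$ for $1\le j\le i$; $\theta_{i,j}=\ell(y)+\sum_{k=i+1}^j(\overline x_k-\overline y_k)$ for $i+1\le j\le n-2$; - $\theta'_{i,j}=\ell(x)+\sum_{k=1}^i(\overline y_k-\overline x_k)+\sum_{k=1}^j(y_k-x_k)$ for $1\le j\le n-2$; - $\eta_{i,j}=\ell(x)+\sum_{k=j+1}^i(\overline y_k-\overline x_k)+\overline y_j-x_j$ for $1\le j\le i$; $\eta_{i,j}=\ell(y)+\sum_{k=i+1}^j(\overline x_k-\overline y_k)+\overline y_j-x_j$ for $i+1\le j\le n-1$; $\eta_{i,n}=\ell(y)+\sum_{k=i+1}^{n-1}(\overline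 x_k-\overline y_k)+x_n$; - $\eta'_{i,j}=\ell(x)+\sum_{k=1}^i(\overline y_k-\overline x_k)+\sum_{k=1}^j(y_k-x_k)+x_j-\overline y_j$ for $1\le j\le n-1$; $\eta'_{i,n}=\ell(x)+\delta_{i,n-1}(\ell(x)-\ell(y))+\sum_{k=1}^i(\overline y_k-\overline x_k)+\sum_{k=1}^{n-1}(y_k-x_k)-x_n$. $W_0=2V_0$, $W_1=V_0+V_0^{\sigma_1}$, $W_{n-1}=V_{n-1}+V_{n-1}^\ast$, and $W_i=\max(V_i+V_{i-1}^\ast-y_i,\ V_{i-1}+V_i^\ast-\overline x_i)+\min(x_i,\overline y_i)$ for $2\le i\le n-2$. **Combinatorial $R$.** $R:B_l\otimes B_m\to B_m\otimes B_l$ is the unique isomorphism of $U_q(D_n^{(1)})$-crystals; explicitly (known result) $R(x\otimes y)=y'\otimes x'$ with, for $1\le i\le n-1$, $x'_i=x_i+V_{i-1}^\ast-V_i^\ast$, $\overline x'_i=\overline x_i+V^\ast_{i-1}+W_i-V^\ast_i-W_{i-1}$, $y'_i=y_i+V_{i-1}+W_i-V_i-W_{i-1}$, $\overline y'_i=\overline y_i+V_{i-1}-V_i$, and $x'_n=x_n+V^\ast_{n-1}-V_{n-1}$, $y'_n=y_n+V_{n-1}-V^\ast_{n-1}$. It satisfies the Yang–Baxter equation and commutes with $\ast$. $\simeq$ denotes correspondence under compositions of $R$'s acting on adjacent factors. **Generalized local energy.** For $\xi\in B_l,\zeta\in B_m$ corresponding to $x,y$: $v_a^\ast(\xi\otimes\zeta)=l+m-V_a^\ast(x,y)$.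 **$\ast$-transformed generalized energy.** $\mathcal E^\ast_{v^\ast_a}(p_L\otimes\cdots\otimes p_1)$ is computed as follows. Start from $p_L\otimes\cdots\otimes p_1\otimes u^\ast_l$ with $l$ sufficiently large (written $u^\ast_\infty$; the result stabilizes). For $j=1,2,\ldots,L$ in turn, move the factor $p_j$ to the right end through all the $j$ factors presently on its right, by successively applying $R$ to adjacent pairs. (So step 1 applies $R$ to $p_1\otimes u^\ast_l$; step 2 moves $p_2$ first through the factor in $B_l$, then through the factor in $B_{l_1}$; etc. At the end one has an element of $B_l\otimes B_{l_1}\otimes\cdots\otimes B_{l_L}$.) $\mathcal E^\ast_{v^\ast_a}$ is the sum of the values $v_a^\ast(b\otimes c)$ over all the $L(L+1)/2$ pairs $b\otimes c$ to which $R$ is applied. **$\ast$-transformed cellular automaton and counting function.** $T^\ast_l$ acts on $B_{l_L}\otimes\cdots\otimes B_{l_1}$ by $p_L\otimes\cdots\otimes p_1\otimes u_l^\ast\simeq\xi\otimes T_l^\ast(p_L\otimes\cdots\otimes p_1)$ with $\xi\in B_l$ (carrying the right factor to the left by $R$); it stabilizes for large $l$ to $T^\ast_\infty$. If $p_j=u^\ast_{l_j}$ for $1\le j\le k$, then the factors of $T^\ast_\infty(p)$ satisfy $p'_j=u^\ast_{l_j}$ for $1\le j\le k+1$. Write $(T^\ast_\infty)^t(p)=p_L^t\otimes\cdots\otimes p_1^t$. For $\zeta\in B_l$ set $\mathfrak a^\ast(\zeta)=2\zeta_1+\zeta_2+\cdots+\zeta_n+\overline\zeta_n+\cdots+\overline\zeta_2$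 and $\gamma^\ast_{v^\ast_a}(\zeta)=\zeta_1+\zeta_{a+1}+\cdots+\zeta_n+\overline\zeta_n+\cdots+\overline\zeta_2$ $(1\le a\le n-2)$. Then $\rho^\ast_{v^\ast_a}(p)=\sum_{j=1}^L\gamma^\ast_{v^\ast_a}(p_j)+\sum_{t\ge1}\sum_{j=1}^L\mathfrak a^\ast(p^t_j)$ (a finite sum). *)

theory Defs
  imports Complex_Main
begin

text \<open>
  A \<open>2n\<close>-tuple (\<open>z\<^sub>1, \<dots>, z\<^sub>n, zbar\<^sub>n, \<dots>, zbar\<^sub>1\<close>) is a pair of functions: \<open>fst z i\<close> is the
  \<open>i\<close>-th unbarred and \<open>snd z i\<close> the \<open>i\<close>-th barred coordinate. Elements of the crystals \<open>B n l\<close>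
  vanish outside the index range \<open>{1..n}\<close>, so that equality of pairs is equality of tuples.
  The same type is used for the coordinates \<open>x\<close> with \<open>2n-1\<close> entries; there
  \<open>snd x n\<close> is not a coordinate.
\<close>

type_synonym coords = "(nat \<Rightarrow> int) \<times> (nat \<Rightarrow> int)"

definition B :: "nat \<Rightarrow> nat \<Rightarrow> coords set" where
  "B n l = {z. (\<forall>i\<in>{1..n}. fst z i \<ge> 0 \<and> snd z i \<ge> 0)
             \<and> (\<forall>i. i \<notin> {1..n} \<longrightarrow> fst z i = 0 \<and> snd z i = 0)
             \<and> (\<Sum>i=1..n. fst z i + snd z i) = int l
             \<and> fst z n * snd z n = 0}"

definition ustar :: "nat \<Rightarrow> coords" where
  "ustar l = (\<lambda>i. 0, \<lambda>i. if i = 1 then int l else 0)"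

definition to_x :: "nat \<Rightarrow> coords \<Rightarrow> coords" where
  "to_x n z =
    (\<lambda>i. if i = n then fst z n - snd z n
         else if i = n - 1 then fst z (n - 1) + snd z n
         else fst z i,
     \<lambda>i. if i = n then 0
         else if i = n - 1 then snd z (n - 1) + snd z n
         else snd z i)"

definition from_x :: "nat \<Rightarrow> coords \<Rightarrow> coords" where
  "from_x n x =
    (\<lambda>i. if i = n then max 0 (fst x n)
         else if i = n - 1 then fst x (n - 1) + min 0 (fst x n)
         else if 1 \<le> i \<and> i \<le> n - 2 then fst x i else 0,
     \<lambda>i. if i = n then max 0 (- fst x n)
         else if i = n - 1 then snd x (n - 1) + min 0 (fst x n)
         else if 1 \<le> i \<and> i \<le> n - 2 then snd x i else 0)"

definition ell :: "nat \<Rightarrow> coords \<Rightarrow> int" where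
  "ell n x = (\<Sum>i=1..n-1. fst x i + snd x i) + fst x n"


subsection \<open>Piecewise linear functions\<close>

definition sigma1 :: "coords \<Rightarrow> coords" where
  "sigma1 x = (\<lambda>i. if i = 1 then snd x 1 else fst x i,
               \<lambda>i. if i = 1 then fst x 1 else snd x i)"

definition star :: "nat \<Rightarrow> coords \<Rightarrow> coords" where
  "star n x = (\<lambda>i. if 1 \<le> i \<and> i \<le> n - 1 then snd x i else fst x i,
               \<lambda>i. if 1 \<le> i \<and> i \<le> n - 1 then fst x i else snd x i)"

definition theta :: "nat \<Rightarrow> nat \<Rightarrow> nat \<Rightarrow> coords \<Rightarrow> coords \<Rightarrow> int" where
  "theta n i j x y =
    (if j \<le> i then ell n x + (\<Sum>k=j+1..i. snd y k - snd x k)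
     else ell n y + (\<Sum>k=i+1..j. snd x k - snd y k))"

definition theta' :: "nat \<Rightarrow> nat \<Rightarrow> nat \<Rightarrow> coords \<Rightarrow> coords \<Rightarrow> int" where
  "theta' n i j x y =
    ell n x + (\<Sum>k=1..i. snd y k - snd x k) + (\<Sum>k=1..j. fst y k - fst x k)"

definition eta :: "nat \<Rightarrow> nat \<Rightarrow> nat \<Rightarrow> coords \<Rightarrow> coords \<Rightarrow> int" where
  "eta n i j x y =
    (if j \<le> i then ell n x + (\<Sum>k=j+1..i. snd y k - snd x k) + snd y j - fst x j
     else if j \<le> n - 1 then ell n y + (\<Sum>k=i+1..j. snd x k - snd y k) + snd y j - fst x j
     else ell n y + (\<Sum>k=i+1..n-1. snd x k - snd y k) + fst x n)"

definition eta' :: "nat \<Rightarrow> nat \<Rightarrow> nat \<Rightarrow> coords \<Rightarrow> coords \<Rightarrow> int" where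
  "eta' n i j x y =
    (if j \<le> n - 1 then
       ell n x + (\<Sum>k=1..i. snd y k - snd x k) + (\<Sum>k=1..j. fst y k - fst x k)
         + fst x j - snd y j
     else
       ell n x + (if i = n - 1 then ell n x - ell n y else 0)
         + (\<Sum>k=1..i. snd y k - snd x k) + (\<Sum>k=1..n-1. fst y k - fst x k) - fst x n)"

definition V :: "nat \<Rightarrow> nat \<Rightarrow> coords \<Rightarrow> coords \<Rightarrow> int" where
  "V n i x y =
    Max ((\<lambda>j. theta n i j x y) ` {1..n-2} \<union> (\<lambda>j. theta' n i j x y) ` {1..n-2}
       \<union> (\<lambda>j. eta n i j x y) ` {1..n} \<union> (\<lambda>j. eta' n i j x y) ` {1..n})"

definition Vsigma1 :: "nat \<Rightarrow> nat \<Rightarrow> coords \<Rightarrow> coords \<Rightarrow> int" where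
  "Vsigma1 n i x y = V n i (sigma1 x) (sigma1 y)"

definition Vstar :: "nat \<Rightarrow> nat \<Rightarrow> coords \<Rightarrow> coords \<Rightarrow> int" where
  "Vstar n i x y = V n i (star n y) (star n x)"

definition W :: "nat \<Rightarrow> nat \<Rightarrow> coords \<Rightarrow> coords \<Rightarrow> int" where
  "W n i x y =
    (if i = 0 then 2 * V n 0 x y
     else if i = 1 then V n 0 x y + Vsigma1 n 0 x y
     else if i = n - 1 then V n (n - 1) x y + Vstar n (n - 1) x y
     else max (V n i x y + Vstar n (i - 1) x y - fst y i)
              (V n (i - 1) x y + Vstar n i x y - snd x i)
          + min (fst x i) (snd y i))"


subsection \<open>The combinatorial \<open>R\<close> and the generalized local energy\<close>

definition Rx' :: "nat \<Rightarrow> coords \<Rightarrow> coords \<Rightarrow> coords" where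
  "Rx' n x y =
    (\<lambda>i. if i = n then fst x n + Vstar n (n - 1) x y - V n (n - 1) x y
         else if 1 \<le> i \<and> i \<le> n - 1 then fst x i + Vstar n (i - 1) x y - Vstar n i x y
         else 0,
     \<lambda>i. if 1 \<le> i \<and> i \<le> n - 1
         then snd x i + Vstar n (i - 1) x y + W n i x y - Vstar n i x y - W n (i - 1) x y
         else 0)"

definition Ry' :: "nat \<Rightarrow> coords \<Rightarrow> coords \<Rightarrow> coords" where
  "Ry' n x y =
    (\<lambda>i. if i = n then fst y n + V n (n - 1) x y - Vstar n (n - 1) x y
         else if 1 \<le> i \<and> i \<le> n - 1
         then fst y i + V n (i - 1) x y + W n i x y - V n i x y - W n (i - 1) x y
         else 0,
     \<lambda>i. if 1 \<le> i \<and> i \<le> n - 1 then snd y i + V n (i - 1) x y - V n i x y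
         else 0)"

text \<open>\<open>R n b c = (c', b')\<close> stands for \<open>R(b \<otimes> c) = c' \<otimes> b'\<close>: an element of the crystal of \<open>c\<close>
  comes first.\<close>

definition R :: "nat \<Rightarrow> coords \<Rightarrow> coords \<Rightarrow> coords \<times> coords" where
  "R n b c = (let x = to_x n b; y = to_x n c
              in (from_x n (Ry' n x y), from_x n (Rx' n x y)))"

definition vstar :: "nat \<Rightarrow> nat \<Rightarrow> coords \<Rightarrow> coords \<Rightarrow> int" where
  "vstar n a b c = (let x = to_x n b; y = to_x n c
                    in ell n x + ell n y - Vstar n a x y)"


subsection \<open>Energy and counting function\<close>

text \<open>A state \<open>p\<^sub>L \<otimes> \<dots> \<otimes> p\<^sub>1\<close> is the list \<open>[p\<^sub>1, \<dots>, p\<^sub>L]\<close>, i.e. tensor factors are listed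
  from right to left.\<close>

definition states :: "nat \<Rightarrow> nat list \<Rightarrow> coords list set" where
  "states n ls = {p. list_all2 (\<lambda>b l. b \<in> B n l) p ls}"

text \<open>The value at which a sequence that is eventually constant stabilizes.\<close>

definition stable_value :: "(nat \<Rightarrow> 'a) \<Rightarrow> 'a" where
  "stable_value f = (THE v. \<forall>\<^sub>F l in sequentially. f l = v)"

text \<open>In the next three functions, \<open>cs\<close> lists the tensor factors to the right of a given one
  in the order in which they are written, from left to right. The first one gives the result of moving
  \<open>b\<close> to the right end of \<open>b \<otimes> cs\<close>, the second one the energy collected on the way, and
  the third one the total energy for moving \<open>p\<^sub>1, p\<^sub>2, \<dots>\<close> in turn.\<close>

fun move_right :: "nat \<Rightarrow> coords \<Rightarrow> coords list \<Rightarrow> coords list" where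
  "move_right n b [] = [b]"
| "move_right n b (c # cs) = (let (c', b') = R n b c in c' # move_right n b' cs)"

fun move_energy :: "nat \<Rightarrow> nat \<Rightarrow> coords \<Rightarrow> coords list \<Rightarrow> int" where
  "move_energy n a b [] = 0"
| "move_energy n a b (c # cs) =
    (let (c', b') = R n b c in vstar n a b c + move_energy n a b' cs)"

fun total_energy :: "nat \<Rightarrow> nat \<Rightarrow> coords list \<Rightarrow> coords list \<Rightarrow> int" where
  "total_energy n a [] cs = 0"
| "total_energy n a (b # p) cs =
    move_energy n a b cs + total_energy n a p (move_right n b cs)"

definition Estar :: "nat \<Rightarrow> nat \<Rightarrow> coords list \<Rightarrow> int" where
  "Estar n a p = stable_value (\<lambda>l. total_energy n a p [ustar l])"

text \<open>\<open>carry n c p\<close> moves \<open>c\<close> from the right end of \<open>p \<otimes> c\<close> to the left end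
  and discards it there.\<close>

fun carry :: "nat \<Rightarrow> coords \<Rightarrow> coords list \<Rightarrow> coords list" where
  "carry n c [] = []"
| "carry n c (b # p) = (let (c', b') = R n b c in b' # carry n c' p)"

definition Tstar :: "nat \<Rightarrow> nat \<Rightarrow> coords list \<Rightarrow> coords list" where
  "Tstar n l p = carry n (ustar l) p"

definition Tstar_inf :: "nat \<Rightarrow> coords list \<Rightarrow> coords list" where
  "Tstar_inf n p = stable_value (\<lambda>l. Tstar n l p)"

definition astar :: "nat \<Rightarrow> coords \<Rightarrow> int" where
  "astar n z = 2 * fst z 1 + (\<Sum>i=2..n. fst z i) + (\<Sum>i=2..n. snd z i)"

definition gammastar :: "nat \<Rightarrow> nat \<Rightarrow> coords \<Rightarrow> int" where
  "gammastar n a z = fst z 1 + (\<Sum>i=a+1..n. fst z i) + (\<Sum>i=2..n. snd z i)"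

text \<open>The type \<open>int\<close> carries the discrete topology, so the series over \<open>t\<close> converges iff it has
  only finitely many nonzero terms. It starts with one application of \<open>Tstar_inf\<close>.\<close>

definition rhostar :: "nat \<Rightarrow> nat \<Rightarrow> coords list \<Rightarrow> int" where
  "rhostar n a p =
    (\<Sum>j<length p. gammastar n a (p ! j))
    + (\<Sum>t. \<Sum>j<length p. astar n ((Tstar_inf n ^^ Suc t) p ! j))"

end

theory Submission
  imports Defs
begin

text \<open>
  In the coordinates of \<open>B'\<^sub>l\<close> the map \<open>R\<close> is the tropical limit, \<open>f = lim ln (F t) / ln t\<close>, of a rational
  map on positive reals. With \<open>d = l(x) - l(y)\<close> its functions \<open>V\<^sub>i\<close> satisfy the first order recursion
  \<open>V\<^sub>i = (Y\<^sub>i / X\<^sub>i) V\<^sub>i\<^sub>-\<^sub>1 + d (1 + Y\<^sub>i / x\<^sub>i)\<close>, where capitals are the barred coordinates, and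
  \<open>W\<^sub>i = V\<^sub>i V\<^sup>*\<^sub>i + d (V\<^sub>i - V\<^sup>*\<^sub>i)\<close>. This turns the commutation of \<open>R\<close> with the geometric crystal
  operators \<open>e\<^sub>i\<^sup>c\<close> (\<open>1 \<le> i \<le> n - 1\<close>) and with the diagram automorphisms at both ends into identities of
  rational functions. Triple tensor products are connected under these maps, so \<open>R\<close> preserves the
  crystals and satisfies the Yang-Baxter equation because it does so on
  \<open>u\<^sup>* \<otimes> u\<^sup>* \<otimes> u\<^sup>*\<close>; in the same way the sum of the energies \<open>v\<^sup>*\<^sub>0\<close> on one of the three lines is the
  same on both sides.

  The difference \<open>v\<^sup>*\<^sub>a - v\<^sup>*\<^sub>0\<close> is a difference of weights before and after applying \<open>R\<close>, and a factor
  moved to the right through \<open>u\<^sup>*\<^sub>l\<close> ends as a vacuum, which reduces the claim to \<open>a = 0\<close>. Moving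
  the carrier to the left before the other factors costs \<open>v\<^sup>*\<^sub>0(b \<otimes> carrier) = astar b\<close> for each factor
  \<open>b\<close> and leaves the energy of \<open>T\<^sup>*(p)\<close> without carrier. By the Yang-Baxter equation each of its factors
  arrives at the right end as a vacuum, so that a carrier there adds no energy and the remaining
  energy is that of \<open>T\<^sup>*(p)\<close> with carrier. Each step creates a further vacuum on the right, so the
  recursion ends.
\<close>

subsection \<open>The geometric lift of the piecewise linear functions\<close>

text \<open>\<open>R\<close> is available only through its explicit formulas, so every property of
  the crystal isomorphism has to be derived from them. Case distinctions on the maxima would
  explode; positive rational functions admit field arithmetic instead.

  Commutation is local. e_i alters only the entries i and i + 1, and V_j, V^*_j, W_j with j \<noteq>
  i turn out to be unchanged. The image therefore changes only in its entries i and i + 1, through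
  the three functions of index i, whose ratios must be the factors by which e_i acts on the image.

  Nodes 0 and n are reached by conjugating nodes 1 and n - 1 with the involutions that exchange
  them. V_0 is not invariant under the involution at the left end: it changes by a weight difference
  of the left factor of the crossing. Along the path of one factor these differences telescope,
  which is why energies are compared along one line only.

  Stabilization is a consequence of piecewise linearity: along a linearly growing carrier every
  coordinate is eventually affine, so a bounded one is eventually constant.\<close>

type_synonym gcoords = "(nat \<Rightarrow> real) \<times> (nat \<Rightarrow> real)"

definition gpos :: "gcoords \<Rightarrow> bool" where
  "gpos x \<longleftrightarrow> (\<forall>i. fst x i > 0 \<and> snd x i > 0)"

definition gell :: "nat \<Rightarrow> gcoords \<Rightarrow> real" where
  "gell n x = (\<Prod>i=1..n-1. fst x i * snd x i) * fst x n"

definition gsigma1 :: "gcoords \<Rightarrow> gcoords" where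
  "gsigma1 x = (\<lambda>i. if i = 1 then snd x 1 else fst x i,
                \<lambda>i. if i = 1 then fst x 1 else snd x i)"

definition gstar :: "nat \<Rightarrow> gcoords \<Rightarrow> gcoords" where
  "gstar n x = (\<lambda>i. if 1 \<le> i \<and> i \<le> n - 1 then snd x i else fst x i,
                \<lambda>i. if 1 \<le> i \<and> i \<le> n - 1 then fst x i else snd x i)"

definition gtheta :: "nat \<Rightarrow> nat \<Rightarrow> nat \<Rightarrow> gcoords \<Rightarrow> gcoords \<Rightarrow> real" where
  "gtheta n i j x y =
    (if j \<le> i then gell n x * (\<Prod>k=j+1..i. snd y k / snd x k)
     else gell n y * (\<Prod>k=i+1..j. snd x k / snd y k))"

definition gtheta' :: "nat \<Rightarrow> nat \<Rightarrow> nat \<Rightarrow> gcoords \<Rightarrow> gcoords \<Rightarrow> real" where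
  "gtheta' n i j x y =
    gell n x * (\<Prod>k=1..i. snd y k / snd x k) * (\<Prod>k=1..j. fst y k / fst x k)"

definition geta :: "nat \<Rightarrow> nat \<Rightarrow> nat \<Rightarrow> gcoords \<Rightarrow> gcoords \<Rightarrow> real" where
  "geta n i j x y =
    (if j \<le> n - 1 then gtheta n i j x y * (snd y j / fst x j)
     else gell n y * (\<Prod>k=i+1..n-1. snd x k / snd y k) * fst x n)"

definition geta' :: "nat \<Rightarrow> nat \<Rightarrow> nat \<Rightarrow> gcoords \<Rightarrow> gcoords \<Rightarrow> real" where
  "geta' n i j x y =
    (if j \<le> n - 1 then gtheta' n i j x y * (fst x j / snd y j)
     else (if i = n - 1 then gell n x / gell n y else 1) * gtheta' n i (n - 1) x y / fst x n)"

definition gV :: "nat \<Rightarrow> nat \<Rightarrow> gcoords \<Rightarrow> gcoords \<Rightarrow> real" where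
  "gV n i x y = (\<Sum>j=1..n-2. gtheta n i j x y + gtheta' n i j x y)
              + (\<Sum>j=1..n. geta n i j x y + geta' n i j x y)"

definition gVstar :: "nat \<Rightarrow> nat \<Rightarrow> gcoords \<Rightarrow> gcoords \<Rightarrow> real" where
  "gVstar n i x y = gV n i (gstar n y) (gstar n x)"

lemma gpos_gsigma1 [simp]: "gpos x \<Longrightarrow> gpos (gsigma1 x)"
  and gpos_gstar [simp]: "gpos x \<Longrightarrow> gpos (gstar n x)"
  by (auto simp: gpos_def gsigma1_def gstar_def)

lemma gpos_fst [simp]: "gpos x \<Longrightarrow> fst x i > 0" "gpos x \<Longrightarrow> fst x i \<noteq> 0"
  and gpos_snd [simp]: "gpos x \<Longrightarrow> snd x i > 0" "gpos x \<Longrightarrow> snd x i \<noteq> 0"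
  by (auto simp: gpos_def less_imp_neq[symmetric])

lemma gell_pos [simp]: "gpos x \<Longrightarrow> gell n x > 0" "gpos x \<Longrightarrow> gell n x \<noteq> 0"
  proof -
  show "gpos x \<Longrightarrow> gell n x > 0"
    by (auto simp: gell_def intro!: prod_pos mult_pos_pos)
  then show "gpos x \<Longrightarrow> gell n x \<noteq> 0" by force
qed

lemma gtheta_pos: "gpos x \<Longrightarrow> gpos y \<Longrightarrow> gtheta n i j x y > 0"
  and gtheta'_pos: "gpos x \<Longrightarrow> gpos y \<Longrightarrow> gtheta' n i j x y > 0"
  by (auto simp: gtheta_def gtheta'_def intro!: prod_pos mult_pos_pos)

lemma geta_pos: "gpos x \<Longrightarrow> gpos y \<Longrightarrow> geta n i j x y > 0"
  and geta'_pos: "gpos x \<Longrightarrow> gpos y \<Longrightarrow> geta' n i j x y > 0"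
  by (auto simp: geta_def geta'_def intro!: prod_pos mult_pos_pos divide_pos_pos gtheta_pos gtheta'_pos)

lemma gV_pos:
  assumes "n \<ge> 3" "gpos x" "gpos y"
  shows "gV n i x y > 0"
proof -
  have "(\<Sum>j=1..n. geta n i j x y + geta' n i j x y) > 0"
    using assms by (intro sum_pos) (auto intro!: add_pos_pos geta_pos geta'_pos)
  moreover have "(\<Sum>j=1..n-2. gtheta n i j x y + gtheta' n i j x y) > 0"
    using assms by (intro sum_pos) (auto intro!: add_pos_pos gtheta_pos gtheta'_pos)
  ultimately show ?thesis by (simp add: gV_def)
qed

text \<open>Raising i multiplies every term by the same ratio. The term j = Suc m moreover passes
  from the case with prefactor l(y) to the one with prefactor l(x), which leaves the inhomogeneous
  part.\<close>

lemma gtheta_rec: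
  assumes "gpos x" "gpos y"
  shows "gtheta n (Suc m) j x y = snd y (Suc m) / snd x (Suc m) * gtheta n m j x y
           + (if j = Suc m then gell n x - gell n y else 0)"
proof -
  consider "j \<le> m" | "j = Suc m" | "j > Suc m" by linarith
  then show ?thesis
  proof cases
    case 1
    then show ?thesis using assms by (simp add: gtheta_def prod.cl_ivl_Suc)
  next
    case 2
    then show ?thesis using assms by (simp add: gtheta_def)
  next
    case 3
    then have "(\<Prod>k = Suc m..j. snd x k / snd y k)
      = snd x (Suc m) / snd y (Suc m) * (\<Prod>k = Suc (Suc m)..j. snd x k / snd y k)"
      by (subst prod.atLeast_Suc_atMost) auto
    with 3 show ?thesis using assms by (simp add: gtheta_def)
  qed
qed

lemma gtheta'_rec: "gtheta' n (Suc m) j x y = snd y (Suc m) / snd x (Suc m) * gtheta' n m j x y"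
  by (simp add: gtheta'_def prod.cl_ivl_Suc)

lemma geta_rec:
  assumes "gpos x" "gpos y" "Suc m \<le> n - 1"
  shows "geta n (Suc m) j x y = snd y (Suc m) / snd x (Suc m) * geta n m j x y
           + (if j = Suc m then (gell n x - gell n y) * (snd y j / fst x j) else 0)"
proof (cases "j \<le> n - 1")
  case True
  then show ?thesis using assms by (simp add: geta_def gtheta_rec algebra_simps)
next
  case False
  have "(\<Prod>k = Suc m..n-1. snd x k / snd y k)
      = snd x (Suc m) / snd y (Suc m) * (\<Prod>k = Suc (Suc m)..n-1. snd x k / snd y k)"
    using assms by (subst prod.atLeast_Suc_atMost) auto
  then show ?thesis using assms False by (simp add: geta_def)
qed

text \<open>The bound stays below i = n - 1, where the term j = n acquires the extra factor l(x) /
  l(y).\<close>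

lemma geta'_rec:
  assumes "gpos x" "gpos y" "Suc m \<le> n - 2"
  shows "geta' n (Suc m) j x y = snd y (Suc m) / snd x (Suc m) * geta' n m j x y"
proof -
  have "Suc m \<noteq> n - 1" "m \<noteq> n - 1" using assms by auto
  then show ?thesis using assms(1,2) by (simp add: geta'_def gtheta'_rec mult_ac)
qed

lemma sum_mult_add_delta:
  fixes f g :: "nat \<Rightarrow> real"
  assumes "\<And>j. j \<in> S \<Longrightarrow> f j = c * g j + (if j = i then d else 0)" "finite S"
  shows "sum f S = c * sum g S + (if i \<in> S then d else 0)"
proof -
  have "sum f S = (\<Sum>j\<in>S. c * g j + (if j = i then d else 0))" using assms by (intro sum.cong) auto
  also have "\<dots> = c * sum g S + (if i \<in> S then d else 0)"
    using assms by (simp add: sum.distrib sum_distrib_left)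
  finally show ?thesis .
qed

lemma gV_rec:
  assumes "gpos x" "gpos y" "Suc m \<le> n - 2"
  shows "gV n (Suc m) x y = snd y (Suc m) / snd x (Suc m) * gV n m x y
           + (gell n x - gell n y) * (1 + snd y (Suc m) / fst x (Suc m))"
proof -
  let ?c = "snd y (Suc m) / snd x (Suc m)" and ?d = "gell n x - gell n y"
  have 1: "(\<Sum>j=1..n-2. gtheta n (Suc m) j x y + gtheta' n (Suc m) j x y)
    = ?c * (\<Sum>j=1..n-2. gtheta n m j x y + gtheta' n m j x y) + (if Suc m \<in> {1..n-2} then ?d else 0)"
    using assms by (intro sum_mult_add_delta) (simp_all add: gtheta_rec gtheta'_rec distrib_left)
  have 2: "(\<Sum>j=1..n. geta n (Suc m) j x y + geta' n (Suc m) j x y)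
    = ?c * (\<Sum>j=1..n. geta n m j x y + geta' n m j x y)
      + (if Suc m \<in> {1..n} then ?d * (snd y (Suc m) / fst x (Suc m)) else 0)"
    using assms by (intro sum_mult_add_delta) (simp_all add: geta_rec geta'_rec distrib_left)
  have "Suc m \<in> {1..n-2}" "Suc m \<in> {1..n}" using assms by auto
  then show ?thesis unfolding gV_def 1 2 by (simp only: if_True distrib_left mult_1_right add_ac)
qed

lemma prod_ratio_y:
  assumes "gpos x" "gpos y" "n \<ge> 1"
  shows "gell n x * (\<Prod>k=1..n-1. snd y k / snd x k) * (\<Prod>k=1..n-1. fst y k / fst x k) * fst y n
       = gell n y * fst x n"
  using assms by (simp add: gell_def prod_dividef prod.distrib prod_zero_iff)

text \<open>Compared with \<open>gV_rec\<close> the summand 1 is lost, because the theta terms stop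
  at j = n - 2, and 1 / y_n is gained from the extra factor l(x) / l(y) in the primed eta term with
  j = n.\<close>

lemma gV_rec_last:
  assumes "gpos x" "gpos y" "m \<ge> 1" "n = Suc (Suc m)"
  shows "gV n (Suc m) x y = snd y (Suc m) / snd x (Suc m) * gV n m x y
           + (gell n x - gell n y) * (snd y (Suc m) / fst x (Suc m) + 1 / fst y n)"
proof -
  let ?c = "snd y (Suc m) / snd x (Suc m)" and ?d = "gell n x - gell n y"
  have n: "n - 1 = Suc m" "n - 2 = m" using assms by auto
  have 1: "(\<Sum>j=1..m. gtheta n (Suc m) j x y + gtheta' n (Suc m) j x y)
    = ?c * (\<Sum>j=1..m. gtheta n m j x y + gtheta' n m j x y) + (if Suc m \<in> {1..m} then ?d else 0)"
    using assms(1,2) by (intro sum_mult_add_delta) (simp_all add: gtheta_rec gtheta'_rec distrib_left)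
  have 2: "(\<Sum>j=1..n. geta n (Suc m) j x y)
    = ?c * (\<Sum>j=1..n. geta n m j x y)
      + (if Suc m \<in> {1..n} then ?d * (snd y (Suc m) / fst x (Suc m)) else 0)"
    using geta_rec[OF assms(1,2), of m n] n by (intro sum_mult_add_delta) simp_all
  have "gtheta' n (n-1) (n-1) x y * fst y n = gell n y * fst x n"
    unfolding gtheta'_def by (rule prod_ratio_y) (use assms in auto)
  then have t: "gtheta' n (Suc m) (n-1) x y = gell n y * fst x n / fst y n"
    using assms(2) unfolding n(1) by (simp add: eq_divide_eq)
  have "geta' n (Suc m) n x y = ?c * geta' n m n x y + ?d / fst y n"
  proof -
    have "?c * geta' n m n x y = gtheta' n (Suc m) (n-1) x y / fst x n"
      by (simp add: geta'_def gtheta'_rec n assms(4))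
    moreover have "geta' n (Suc m) n x y = gell n x / gell n y * gtheta' n (Suc m) (n-1) x y / fst x n"
      by (simp add: geta'_def n assms(4))
    ultimately show ?thesis unfolding t using assms(1,2) by (simp add: field_simps)
  qed
  moreover have "geta' n (Suc m) j x y = ?c * geta' n m j x y" if "j \<le> n - 1" for j
    using that by (simp add: geta'_def gtheta'_rec)
  ultimately have 3: "(\<Sum>j=1..n. geta' n (Suc m) j x y)
    = ?c * (\<Sum>j=1..n. geta' n m j x y) + (if n \<in> {1..n} then ?d / fst y n else 0)"
    by (intro sum_mult_add_delta) auto
  have "Suc m \<notin> {1..m}" "Suc m \<in> {1..n}" "n \<in> {1..n}" using assms(4) by auto
  then show ?thesis unfolding gV_def n sum.distrib[of _ _ "{1..n}"] 1 2 3
    by (simp only: if_True if_False distrib_left) simp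
qed

text \<open>In the last branch the minimum, as the negative of a maximum of negatives, lifts to the
  reciprocal of a sum of reciprocals.\<close>

definition gW :: "nat \<Rightarrow> nat \<Rightarrow> gcoords \<Rightarrow> gcoords \<Rightarrow> real" where
  "gW n i x y =
    (if i = 0 then gV n 0 x y * gV n 0 x y
     else if i = 1 then gV n 0 x y * gV n 0 (gsigma1 x) (gsigma1 y)
     else if i = n - 1 then gV n (n - 1) x y * gVstar n (n - 1) x y
     else (gV n i x y * gVstar n (i - 1) x y / fst y i
            + gV n (i - 1) x y * gVstar n i x y / snd x i)
          / (1 / fst x i + 1 / snd y i))"

lemma gstar_gstar [simp]: "gstar n (gstar n x) = x"
  by (auto simp: gstar_def prod_eq_iff)

lemma gstar_nth [simp]:
  "1 \<le> i \<Longrightarrow> i \<le> n - 1 \<Longrightarrow> fst (gstar n x) i = snd x i"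
  "1 \<le> i \<Longrightarrow> i \<le> n - 1 \<Longrightarrow> snd (gstar n x) i = fst x i"
  by (auto simp: gstar_def)

lemma gstar_last [simp]: "n \<ge> 1 \<Longrightarrow> fst (gstar n x) n = fst x n"
  by (cases n) (auto simp: gstar_def)

lemma gell_gstar [simp]: "n \<ge> 1 \<Longrightarrow> gell n (gstar n x) = gell n x"
  unfolding gell_def by (auto simp: mult.commute intro!: arg_cong2[where f="(*)"] prod.cong)

lemma gell_gsigma1 [simp]: "n \<ge> 2 \<Longrightarrow> gell n (gsigma1 x) = gell n x"
proof -
  assume n: "n \<ge> 2"
  have "(\<Prod>i=1..n-1. fst (gsigma1 x) i * snd (gsigma1 x) i) = (\<Prod>i=1..n-1. fst x i * snd x i)"
    by (intro prod.cong refl) (simp add: gsigma1_def)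
  then show ?thesis using n by (simp add: gell_def) (simp add: gsigma1_def)
qed

lemma gVstar_pos:
  "n \<ge> 3 \<Longrightarrow> gpos x \<Longrightarrow> gpos y \<Longrightarrow> gVstar n i x y > 0"
  unfolding gVstar_def by (intro gV_pos) auto

lemma prod_ratio_0:
  assumes "gpos x" "gpos y"
  shows "gell n x * (\<Prod>k=1..n-1. fst y k / fst x k) * fst y n
       = gell n y * (\<Prod>k=1..n-1. snd x k / snd y k) * fst x n"
  using assms by (simp add: gell_def prod_dividef prod.distrib prod_zero_iff)

text \<open>At i = 0 the star exchanges primed and unprimed terms for each j < n, while
  \<open>prod_ratio_0\<close> makes each of the two terms with j = n invariant.\<close>

lemma gV_0_star:
  assumes "gpos x" "gpos y" "n \<ge> 3"
  shows "gVstar n 0 x y = gV n 0 x y"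
proof -
  let ?x = "gstar n y" and ?y = "gstar n x"
  have th: "gtheta n 0 j ?x ?y = gtheta' n 0 j x y" "gtheta' n 0 j ?x ?y = gtheta n 0 j x y"
    if "1 \<le> j" "j \<le> n - 1" for j
    using that assms(3)
    by (auto simp: gtheta_def gtheta'_def intro!: arg_cong2[where f="(*)"] prod.cong)
  have "geta n 0 j ?x ?y + geta' n 0 j ?x ?y = geta n 0 j x y + geta' n 0 j x y"
    if j: "j \<in> {1..n}" for j
  proof (cases "j = n")
    case False
    then have "1 \<le> j" "j \<le> n - 1" using j by auto
    then show ?thesis using assms(3) by (simp add: geta_def geta'_def th)
  next
    case True
    have n: "1 \<le> n - 1" "n - 1 \<noteq> 0" "\<not> n \<le> n - 1" using assms(3) by auto
    have th0: "gtheta n 0 (n-1) x y = gell n y * (\<Prod>k=1..n-1. snd x k / snd y k)"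
      using n by (simp add: gtheta_def)
    have th1: "gtheta' n 0 (n-1) x y = gell n x * (\<Prod>k=1..n-1. fst y k / fst x k)"
      by (simp add: gtheta'_def)
    have e: "geta n 0 n x y = gtheta n 0 (n-1) x y * fst x n"
      using n by (simp add: geta_def gtheta_def)
    have e2: "geta n 0 n ?x ?y = gtheta n 0 (n-1) ?x ?y * fst y n"
      using n assms(3) by (simp add: geta_def gtheta_def)
    have e': "geta' n 0 n x y = gtheta' n 0 (n-1) x y / fst x n"
      using n by (simp add: geta'_def)
    have e2': "geta' n 0 n ?x ?y = gtheta' n 0 (n-1) ?x ?y / fst y n"
      using n assms(3) by (simp add: geta'_def)
    have r: "gtheta' n 0 (n-1) x y * fst y n = gtheta n 0 (n-1) x y * fst x n"
      using prod_ratio_0[OF assms(1,2)] unfolding th0 th1 by simp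
    then have r': "gtheta' n 0 (n-1) x y = gtheta n 0 (n-1) x y * fst x n / fst y n"
      using assms(2) by (simp add: eq_divide_eq)
    show ?thesis unfolding \<open>j = n\<close> e e' e2 e2' th[OF n(1) order_refl] r'
      using assms(1,2) by simp
  qed
  then have 2: "(\<Sum>j=1..n. geta n 0 j ?x ?y + geta' n 0 j ?x ?y) = (\<Sum>j=1..n. geta n 0 j x y + geta' n 0 j x y)"
    by (intro sum.cong) auto
  have 1: "(\<Sum>j=1..n-2. gtheta n 0 j ?x ?y + gtheta' n 0 j ?x ?y) = (\<Sum>j=1..n-2. gtheta n 0 j x y + gtheta' n 0 j x y)"
    by (intro sum.cong) (auto simp: th)
  show ?thesis unfolding gVstar_def gV_def 1 2 ..
qed

lemma gVstar_rec:
  assumes "gpos x" "gpos y" "Suc m \<le> n - 2"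
  shows "gVstar n (Suc m) x y = fst x (Suc m) / fst y (Suc m) * gVstar n m x y
           - (gell n x - gell n y) * (1 + fst x (Suc m) / snd y (Suc m))"
proof -
  have i: "1 \<le> Suc m" "Suc m \<le> n - 1" "n \<ge> 1" using assms by auto
  show ?thesis
    using gV_rec[of "gstar n y" "gstar n x" m n] assms
    by (simp only: gVstar_def gstar_nth[OF i(1,2)] gell_gstar[OF i(3)] gpos_gstar)
       (simp add: algebra_simps diff_divide_distrib)
qed

lemma gVstar_rec_last:
  assumes "gpos x" "gpos y" "m \<ge> 1" "n = Suc (Suc m)"
  shows "gVstar n (Suc m) x y = fst x (Suc m) / fst y (Suc m) * gVstar n m x y
           - (gell n x - gell n y) * (fst x (Suc m) / snd y (Suc m) + 1 / fst x n)"
proof -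
  have i: "1 \<le> Suc m" "Suc m \<le> n - 1" "n \<ge> 1" using assms by auto
  show ?thesis
    using gV_rec_last[OF gpos_gstar[OF assms(2)] gpos_gstar[OF assms(1)] assms(3,4), of n n]
    unfolding gVstar_def gstar_nth[OF i(1,2)] gstar_last[OF i(3)] gell_gstar[OF i(3)]
    by (simp add: algebra_simps diff_divide_distrib)
qed

text \<open>For i \<ge> 1 the unprimed theta products start at k = 2 or later, and the primed ones
  contain both ratios with k = 1, which are merely interchanged. The two eta terms with j = 1 are
  exchanged with each other.\<close>

lemma gV_sigma1:
  assumes "gpos x" "gpos y" "n \<ge> 3" "1 \<le> i" "i \<le> n - 1"
  shows "gV n i (gsigma1 x) (gsigma1 y) = gV n i x y"
proof -
  let ?x = "gsigma1 x" and ?y = "gsigma1 y"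
  have th: "gtheta n i j ?x ?y = gtheta n i j x y" if "1 \<le> j" for j
  proof -
    have "(\<Prod>k=j+1..i. snd ?y k / snd ?x k) = (\<Prod>k=j+1..i. snd y k / snd x k)"
         "(\<Prod>k=i+1..j. snd ?x k / snd ?y k) = (\<Prod>k=i+1..j. snd x k / snd y k)"
      using that assms(4) by (auto simp: gsigma1_def intro!: prod.cong)
    then show ?thesis using assms(3) by (simp add: gtheta_def)
  qed
  have pr: "(\<Prod>k=1..j. f k) = f 1 * (\<Prod>k=2..j. f k)" if "1 \<le> j" for j and f :: "nat \<Rightarrow> real"
    using that by (subst prod.atLeast_Suc_atMost) (auto simp: numeral_2_eq_2)
  have th': "gtheta' n i j ?x ?y = gtheta' n i j x y" if j: "1 \<le> j" for j
  proof -
    have "(\<Prod>k=2..i. snd ?y k / snd ?x k) = (\<Prod>k=2..i. snd y k / snd x k)"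
         "(\<Prod>k=2..j. fst ?y k / fst ?x k) = (\<Prod>k=2..j. fst y k / fst x k)"
      by (auto simp: gsigma1_def intro!: prod.cong)
    then have "gtheta' n i j ?x ?y = gell n x * (fst y 1 / fst x 1 * (\<Prod>k=2..i. snd y k / snd x k)) *
          (snd y 1 / snd x 1 * (\<Prod>k=2..j. fst y k / fst x k))"
      unfolding gtheta'_def pr[OF j] pr[OF assms(4)] using assms(3) by (simp only: gell_gsigma1)
        (simp add: gsigma1_def)
    then show ?thesis unfolding gtheta'_def pr[OF j] pr[OF assms(4)] by (simp only: mult_ac)
  qed
  have "geta n i j ?x ?y + geta' n i j ?x ?y = geta n i j x y + geta' n i j x y"
    if j: "j \<in> {1..n}" for j
  proof (cases "j = 1")
    case False
    have "(\<Prod>k=i+1..n-1. snd ?x k / snd ?y k) = (\<Prod>k=i+1..n-1. snd x k / snd y k)"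
      using assms(4) by (auto simp: gsigma1_def intro!: prod.cong)
    moreover have "fst ?x j = fst x j" "snd ?x j = snd x j" "fst ?y j = fst y j" "snd ?y j = snd y j"
       "fst ?x n = fst x n" "fst ?y n = fst y n" using False assms(3) by (auto simp: gsigma1_def)
    ultimately show ?thesis using j assms(3)
      unfolding geta_def geta'_def by (simp add: th th')
  next
    case True
    have 1: "1 \<le> n - 1" using assms(3) by auto
    have "gtheta n i 1 x y = gell n x * (\<Prod>k=2..i. snd y k / snd x k)"
      using assms(4) by (simp add: gtheta_def numeral_2_eq_2)
    moreover have "gtheta' n i 1 x y
       = gell n x * (\<Prod>k=2..i. snd y k / snd x k) * (snd y 1 / snd x 1 * (fst y 1 / fst x 1))"
      unfolding gtheta'_def pr[OF assms(4)] by simp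
    ultimately show ?thesis using assms(1,2) unfolding True geta_def geta'_def
      by (simp add: 1[simplified] th th') (simp add: gsigma1_def field_simps)
  qed
  then have 2: "(\<Sum>j=1..n. geta n i j ?x ?y + geta' n i j ?x ?y) = (\<Sum>j=1..n. geta n i j x y + geta' n i j x y)"
    by (intro sum.cong) auto
  have 1: "(\<Sum>j=1..n-2. gtheta n i j ?x ?y + gtheta' n i j ?x ?y) = (\<Sum>j=1..n-2. gtheta n i j x y + gtheta' n i j x y)"
    by (intro sum.cong) (auto simp: th th')
  show ?thesis unfolding gV_def 1 2 ..
qed

text \<open>After multiplication by y_n and x_n the unprimed terms on one side match the primed ones
  on the other, because the full products are fixed by the two lengths. Only the terms with j = n
  are left over, and they give the right-hand side.\<close>

lemma gV_last:
  assumes "gpos x" "gpos y" "n \<ge> 3"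
  shows "fst y n * gV n (n-1) x y - fst x n * gVstar n (n-1) x y
       = (gell n x - gell n y) * (1 - fst x n * fst y n)"
proof -
  have n1: "1 \<le> n" "1 \<le> n - 1" using assms(3) by auto
  have th: "fst y n * gtheta n (n-1) j x y = fst x n * gtheta' n (n-1) j (gstar n y) (gstar n x)"
    if j: "1 \<le> j" "j \<le> n - 1" and "gpos x" "gpos y" for j and x y :: gcoords
  proof -
    let ?P = "\<Prod>k=1..n-1. snd x k / snd y k" and ?Q = "\<Prod>k=j+1..n-1. snd y k / snd x k"
    have "(\<Prod>k=1..n-1. snd x k / snd y k) = (\<Prod>k=1..j. snd x k / snd y k) * (\<Prod>k=j+1..n-1. snd x k / snd y k)"
      using j prod.ub_add_nat[of 1 j "\<lambda>k. snd x k / snd y k" "n - 1 - j"] by simp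
    also have "(\<Prod>k=j+1..n-1. snd x k / snd y k) = inverse (\<Prod>k=j+1..n-1. snd y k / snd x k)"
      by (simp add: prod_inversef[symmetric])
    finally have e: "(\<Prod>k=1..j. snd x k / snd y k) = ?P * ?Q"
      using that(3,4) by (simp add: field_simps prod_zero_iff prod_dividef)
    have inv: "gell n y * (\<Prod>k=1..n-1. snd x k / snd y k) * (\<Prod>k=1..n-1. fst x k / fst y k) * fst x n
       = gell n x * fst y n"
      using prod_ratio_y[OF that(4,3) n1(1)] .
    have "gtheta' n (n-1) j (gstar n y) (gstar n x) =
        gell n y * (\<Prod>k=1..n-1. fst x k / fst y k) * (\<Prod>k=1..j. snd x k / snd y k)"
      using j n1(1) unfolding gtheta'_def gell_gstar[OF n1(1)]
      by (auto intro!: arg_cong2[where f="(*)"] prod.cong)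
    also have "fst x n * \<dots> = (gell n y * (\<Prod>k=1..n-1. snd x k / snd y k) * (\<Prod>k=1..n-1. fst x k / fst y k) * fst x n) * ?Q"
      unfolding e by (simp add: mult_ac)
    also have "\<dots> = gell n x * fst y n * ?Q"
      using inv by (simp add: mult_ac)
    finally show ?thesis using j by (simp add: gtheta_def mult_ac)
  qed
  have ths: "fst x n * gtheta n (n-1) j (gstar n y) (gstar n x) = fst y n * gtheta' n (n-1) j x y"
    if j: "1 \<le> j" "j \<le> n - 1" for j
    using th[of j "gstar n y" "gstar n x"] that assms by simp
  have e: "fst y n * geta n (n-1) j x y = fst x n * geta' n (n-1) j (gstar n y) (gstar n x)"
    if j: "1 \<le> j" "j \<le> n - 1" for j
  proof -
    have "fst y n * (gtheta n (n-1) j x y * (snd y j / fst x j))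
       = (fst y n * gtheta n (n-1) j x y) * (snd y j / fst x j)" by simp
    then show ?thesis unfolding th[OF j assms(1,2)] geta_def geta'_def gstar_nth[OF j] if_P[OF j(2)]
      by simp
  qed
  have es: "fst x n * geta n (n-1) j (gstar n y) (gstar n x) = fst y n * geta' n (n-1) j x y"
    if j: "1 \<le> j" "j \<le> n - 1" for j
  proof -
    have "fst x n * (gtheta n (n-1) j (gstar n y) (gstar n x) * (fst x j / snd y j))
       = (fst x n * gtheta n (n-1) j (gstar n y) (gstar n x)) * (fst x j / snd y j)" by simp
    then show ?thesis unfolding ths[OF j] geta_def geta'_def gstar_nth[OF j] if_P[OF j(2)]
      by simp
  qed
  have tn: "gtheta' n (n-1) (n-1) x y = gell n y * fst x n / fst y n" if "gpos x" "gpos y" for x y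
    using prod_ratio_y[OF that n1(1)] that unfolding gtheta'_def by (simp add: eq_divide_eq)
  have en: "geta n (n-1) n x y = gell n y * fst x n"
       "geta' n (n-1) n x y = gell n x / fst y n" if "gpos x" "gpos y" for x y
  proof -
    have "\<not> n \<le> n - 1" using n1 by auto
    then show "geta n (n-1) n x y = gell n y * fst x n" "geta' n (n-1) n x y = gell n x / fst y n"
      unfolding geta_def geta'_def tn[OF that] using n1 that by auto
  qed
  let ?x = "gstar n y" and ?y = "gstar n x"
  have A: "fst y n * (\<Sum>j=1..n-2. gtheta n (n-1) j x y + gtheta' n (n-1) j x y)
     = fst x n * (\<Sum>j=1..n-2. gtheta n (n-1) j ?x ?y + gtheta' n (n-1) j ?x ?y)"
    unfolding sum_distrib_left distrib_left
  proof (intro sum.cong refl)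
    fix j assume "j \<in> {1..n-2}"
    then have j: "1 \<le> j" "j \<le> n - 1" by auto
    show "fst y n * gtheta n (n-1) j x y + fst y n * gtheta' n (n-1) j x y
      = fst x n * gtheta n (n-1) j ?x ?y + fst x n * gtheta' n (n-1) j ?x ?y"
      unfolding th[OF j assms(1,2)] ths[OF j] by (rule add.commute)
  qed
  have B: "fst y n * (\<Sum>j=1..n-1. geta n (n-1) j x y + geta' n (n-1) j x y)
     = fst x n * (\<Sum>j=1..n-1. geta n (n-1) j ?x ?y + geta' n (n-1) j ?x ?y)"
    unfolding sum_distrib_left distrib_left
  proof (intro sum.cong refl)
    fix j assume "j \<in> {1..n-1}"
    then have j: "1 \<le> j" "j \<le> n - 1" by auto
    show "fst y n * geta n (n-1) j x y + fst y n * geta' n (n-1) j x y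
      = fst x n * geta n (n-1) j ?x ?y + fst x n * geta' n (n-1) j ?x ?y"
      unfolding e[OF j] es[OF j] by (rule add.commute)
  qed
  have s: "sum f {1..n} = sum f {1..n-1} + f n" for f :: "nat \<Rightarrow> real"
    using n1 by (cases n) auto
  have p: "gpos ?x" "gpos ?y" using assms by auto
  have nn: "fst ?x n = fst y n" "fst ?y n = fst x n" "gell n ?x = gell n y" "gell n ?y = gell n x"
    using n1 by auto
  show ?thesis
    unfolding gVstar_def gV_def s en[OF assms(1,2)] en[OF p] nn distrib_left A B
    using assms by (simp add: algebra_simps)
qed

text \<open>Solving the two recursions for \<open>K\<close> and \<open>Ks\<close> makes 1 / x + 1 /
  Y a factor of the numerator. The result is also (V - d) (Vs + d) + d^2, the form exploited
  later.\<close>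

lemma gW_algebra:
  fixes x X y Y K Ks V Vs d :: real
  assumes "x > 0" "X > 0" "y > 0" "Y > 0"
    and V: "V = Y / X * K + d * (1 + Y / x)" and Vs: "Vs = x / y * Ks - d * (1 + x / Y)"
  shows "(V * Ks / y + K * Vs / X) / (1 / x + 1 / Y) = V * Vs + d * (V - Vs)"
proof -
  have K: "K = (V - d * (1 + Y / x)) * X / Y" and Ks: "Ks = (Vs + d * (1 + x / Y)) * y / x"
    using assms by (simp_all add: V Vs)
  have "V * Ks / y + K * Vs / X = (V * Vs + d * (V - Vs)) * (1 / x + 1 / Y)"
    unfolding K Ks using assms(1-4) by (simp add: field_simps)
  then show ?thesis using assms(1-4) by (simp add: add_pos_pos less_imp_neq[symmetric])
qed

text \<open>One formula covers three branches of \<open>gW\<close>. At i = 0 it is V^*_0 = V_0; at i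
  = 1 the invariance of V_1 under sigma1 lets the recursion be solved backwards for the transformed
  V_0; otherwise it is \<open>gW_algebra\<close>.\<close>

lemma gW_eq:
  assumes "gpos x" "gpos y" "n \<ge> 3" "i \<le> n - 2"
  shows "gW n i x y = gV n i x y * gVstar n i x y
           + (gell n x - gell n y) * (gV n i x y - gVstar n i x y)"
proof -
  have n2: "n \<ge> 2" using assms(3) by simp
  consider "i = 0" | "i = 1" | m where "i = Suc m" "m \<ge> 1" by (cases i) (auto, metis One_nat_def Suc_leI gr0I)
  then show ?thesis
  proof cases
    case 1
    then show ?thesis using gV_0_star[OF assms(1-3)] by (simp add: gW_def)
  next
    case 2
    let ?S = "gV n 0 (gsigma1 x) (gsigma1 y)" and ?d = "gell n x - gell n y"
    have l: "Suc 0 \<le> n - 2" using assms(3) by simp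
    have a: "gV n 1 x y = snd y 1 / snd x 1 * gV n 0 x y + ?d * (1 + snd y 1 / fst x 1)"
      using gV_rec[OF assms(1,2) l] by simp
    have "gV n 1 (gsigma1 x) (gsigma1 y) = fst y 1 / fst x 1 * ?S + ?d * (1 + fst y 1 / snd x 1)"
      using gV_rec[OF gpos_gsigma1[OF assms(1)] gpos_gsigma1[OF assms(2)] l]
      unfolding gell_gsigma1[OF n2] by (simp add: gsigma1_def)
    moreover have "gV n 1 (gsigma1 x) (gsigma1 y) = gV n 1 x y"
      using assms by (intro gV_sigma1) auto
    ultimately have "gV n 1 x y - ?d * (1 + fst y 1 / snd x 1) = fst y 1 / fst x 1 * ?S" by simp
    then have s: "?S = (gV n 1 x y - ?d * (1 + fst y 1 / snd x 1)) * fst x 1 / fst y 1"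
      using assms(1,2) by simp
    have b: "gVstar n 1 x y = fst x 1 / fst y 1 * gV n 0 x y - ?d * (1 + fst x 1 / snd y 1)"
      using gVstar_rec[OF assms(1,2) l] gV_0_star[OF assms(1-3)] by simp
    have w: "gW n i x y = gV n 0 x y * ?S" using 2 by (simp add: gW_def)
    show ?thesis unfolding w s unfolding 2 a b
      using assms(1,2) by (simp add: field_simps)
  next
    case 3
    then have i: "i \<noteq> 0" "i \<noteq> 1" "i \<noteq> n - 1" "i - 1 = m" "Suc m \<le> n - 2" using assms(3,4) by auto
    show ?thesis unfolding gW_def if_not_P[OF i(1)] if_not_P[OF i(2)] if_not_P[OF i(3)] i(4)
      unfolding \<open>i = Suc m\<close>
      by (rule gW_algebra[OF _ _ _ _ gV_rec[OF assms(1,2) i(5)] gVstar_rec[OF assms(1,2) i(5)]])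
        (use assms(1,2) in auto)
  qed
qed

lemma gW_pos:
  assumes "gpos x" "gpos y" "n \<ge> 3"
  shows "gW n i x y > 0"
  using assms unfolding gW_def
  by (auto intro!: mult_pos_pos divide_pos_pos add_pos_pos gV_pos gVstar_pos)

text \<open>Expressed through the functions of index m, W has the same form at the last index,
  although its definition differs there: the right-hand side of \<open>gV_last\<close> compensates
  for it. So a node i with i + 1 = n - 1 needs no separate treatment.\<close>

lemma gW_next:
  assumes "gpos x" "gpos y" "n \<ge> 3" "Suc m \<le> n - 1"
  shows "gW n (Suc m) x y * (snd x (Suc m) * fst y (Suc m) / (snd y (Suc m) * fst x (Suc m)))
     = gV n m x y * gVstar n m x y + (gell n x - gell n y) *
        (gVstar n m x y * snd x (Suc m) / fst x (Suc m) - gV n m x y * fst y (Suc m) / snd y (Suc m))"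
proof (cases "Suc m = n - 1")
  case False
  then have m: "Suc m \<le> n - 2" using assms by auto
  show ?thesis unfolding gW_eq[OF assms(1-3) m] gV_rec[OF assms(1,2) m] gVstar_rec[OF assms(1,2) m]
    using assms(1,2) by (simp add: field_simps)
next
  case True
  have n: "n = Suc (Suc m)" "m \<ge> 1" using True assms(3) by auto
  define x2 X2 y2 Y2 where v: "x2 = fst x (Suc m)" "X2 = snd x (Suc m)" "y2 = fst y (Suc m)" "Y2 = snd y (Suc m)"
  define p q where pq: "p = fst x n" "q = fst y n"
  define a b d where ab: "a = gV n m x y" "b = gVstar n m x y" "d = gell n x - gell n y"
  have pos: "x2 > 0" "X2 > 0" "y2 > 0" "Y2 > 0" "p > 0" "q > 0" using assms(1,2) by (auto simp: v pq)
  have A: "gV n (n-1) x y = Y2 / X2 * a + d * (Y2 / x2 + 1 / q)"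
    unfolding True[symmetric] v pq ab by (rule gV_rec_last[OF assms(1,2) n(2,1)])
  have B: "gVstar n (n-1) x y = x2 / y2 * b - d * (x2 / Y2 + 1 / p)"
    unfolding True[symmetric] v pq ab by (rule gVstar_rec_last[OF assms(1,2) n(2,1)])
  have C: "q * (Y2 / X2 * a + d * (Y2 / x2 + 1 / q)) - p * (x2 / y2 * b - d * (x2 / Y2 + 1 / p)) = d * (1 - p * q)"
    using gV_last[OF assms(1-3)] unfolding A B unfolding pq ab .
  have W: "gW n (Suc m) x y = gV n (n-1) x y * gVstar n (n-1) x y"
    using n by (simp add: gW_def)
  \<comment> \<open>The difference of the two sides is a multiple of the relation \<open>C\<close>,
    which is therefore kept as one expression.\<close>
  have "(Y2 / X2 * a + d * (Y2 / x2 + 1 / q)) * (x2 / y2 * b - d * (x2 / Y2 + 1 / p)) * (X2 * y2 / (Y2 * x2))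
       - (a * b + d * (b * X2 / x2 - a * y2 / Y2)) =
     - d * X2 * y2 / (Y2 * x2 * p * q) *
      ((q * (Y2 / X2 * a + d * (Y2 / x2 + 1 / q)) - p * (x2 / y2 * b - d * (x2 / Y2 + 1 / p)))- d * (1 - p * q))"
    using pos by (simp add: field_simps)
  then show ?thesis unfolding W A B C unfolding v[symmetric] ab[symmetric] by simp
qed

subsection \<open>Commutation with the geometric crystal operators\<close>

text \<open>\<open>ge n i c\<close> is \<open>e\<^sub>i\<^sup>c\<close> in the coordinates \<open>x\<close>. On a pair it acts as \<open>ge n i c1\<close> on the left
  factor, with \<open>c1 = gleft n i c x y\<close>, and as \<open>ge n i (c / c1)\<close> on the right one.\<close>

definition gphi :: "nat \<Rightarrow> nat \<Rightarrow> gcoords \<Rightarrow> real" where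
  "gphi n i x = (if i = n - 1 then fst x i else fst x i * (1 + snd x (i+1) / fst x (i+1)))"

definition geps :: "nat \<Rightarrow> nat \<Rightarrow> gcoords \<Rightarrow> real" where
  "geps n i x = (if i = n - 1 then snd x i * fst x n else snd x i * (1 + fst x (i+1) / snd x (i+1)))"

text \<open>The part of e_i^c that falls on the barred coordinates; the remaining factor c / xi acts
  on the unbarred ones, just as \<open>gleft\<close> divides c between two tensor factors.\<close>

definition gxi :: "nat \<Rightarrow> real \<Rightarrow> gcoords \<Rightarrow> real" where
  "gxi i c x = (c * snd x (i+1) + fst x (i+1)) / (snd x (i+1) + fst x (i+1))"

definition ge :: "nat \<Rightarrow> nat \<Rightarrow> real \<Rightarrow> gcoords \<Rightarrow> gcoords" where
  "ge n i c x =
    (if i = n - 1 then ((fst x)(i := fst x i * c, n := fst x n / c), snd x)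
     else ((fst x)(i := fst x i * (c / gxi i c x), i+1 := fst x (i+1) / (c / gxi i c x)),
           (snd x)(i := snd x i / gxi i c x, i+1 := snd x (i+1) * gxi i c x)))"

definition gleft :: "nat \<Rightarrow> nat \<Rightarrow> real \<Rightarrow> gcoords \<Rightarrow> gcoords \<Rightarrow> real" where
  "gleft n i c x y = (c * gphi n i x + geps n i y) / (gphi n i x + geps n i y)"

definition gRx :: "nat \<Rightarrow> gcoords \<Rightarrow> gcoords \<Rightarrow> gcoords" where
  "gRx n x y =
    (\<lambda>i. if i = n then fst x n * gVstar n (n - 1) x y / gV n (n - 1) x y
         else if 1 \<le> i \<and> i \<le> n - 1 then fst x i * gVstar n (i - 1) x y / gVstar n i x y
         else 1,
     \<lambda>i. if 1 \<le> i \<and> i \<le> n - 1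
         then snd x i * gVstar n (i - 1) x y * gW n i x y / gVstar n i x y / gW n (i - 1) x y
         else 1)"

definition gRy :: "nat \<Rightarrow> gcoords \<Rightarrow> gcoords \<Rightarrow> gcoords" where
  "gRy n x y =
    (\<lambda>i. if i = n then fst y n * gV n (n - 1) x y / gVstar n (n - 1) x y
         else if 1 \<le> i \<and> i \<le> n - 1
         then fst y i * gV n (i - 1) x y * gW n i x y / gV n i x y / gW n (i - 1) x y
         else 1,
     \<lambda>i. if 1 \<le> i \<and> i \<le> n - 1 then snd y i * gV n (i - 1) x y / gV n i x y
         else 1)"

lemma gphi_pos: "gpos x \<Longrightarrow> gphi n i x > 0"
  and geps_pos: "gpos x \<Longrightarrow> geps n i x > 0"
  by (auto simp: gphi_def geps_def intro!: mult_pos_pos add_pos_pos divide_pos_pos)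

lemma gxi_pos: "gpos x \<Longrightarrow> c > 0 \<Longrightarrow> gxi i c x > 0"
  by (auto simp: gxi_def intro!: mult_pos_pos add_pos_pos divide_pos_pos)

lemma gleft_pos: "gpos x \<Longrightarrow> gpos y \<Longrightarrow> c > 0 \<Longrightarrow> gleft n i c x y > 0"
  unfolding gleft_def by (auto intro!: mult_pos_pos add_pos_pos divide_pos_pos gphi_pos geps_pos)

lemma gpos_ge:
  assumes "gpos x" "c > 0"
  shows "gpos (ge n i c x)"
  using gxi_pos[OF assms, of i] assms unfolding ge_def gpos_def by auto

lemma gpos_gR:
  assumes "gpos x" "gpos y" "n \<ge> 3"
  shows "gpos (gRx n x y)" "gpos (gRy n x y)"
  using gV_pos[OF assms(3,1,2)] gVstar_pos[OF assms(3,1,2)] gW_pos[OF assms] assms(1,2)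
  unfolding gpos_def gRx_def gRy_def by auto

text \<open>In terms of the parameter \<open>t = (c - 1) / (phi x + eps y)\<close> the action of \<open>e\<^sub>i\<close> on a pair becomes
  polynomial. The letters stand for \<open>x\<^sub>i\<close>, \<open>Y\<^sub>i\<close>, \<open>p = X\<^sub>i\<^sub>+\<^sub>1 / x\<^sub>i\<^sub>+\<^sub>1\<close>, \<open>q = y\<^sub>i\<^sub>+\<^sub>1 / Y\<^sub>i\<^sub>+\<^sub>1\<close>.\<close>

locale pair_action =
  fixes x1 Y1 p q t xi c1 D c :: real
  assumes pos: "x1 > 0" "Y1 > 0" "p > 0" "q > 0"
    and defs: "xi = 1 + t * x1 * p" "c1 = xi + t * x1" "D = c1 + t * Y1" "c = D + t * Y1 * q"
    and cpos: "xi > 0" "c1 > 0" "D > 0" "c > 0"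
begin

text \<open>Here c = 1 + t (x1 p + x1 + Y1 + Y1 q), and \<open>xi\<close>, \<open>c1\<close>,
  \<open>D\<close>, \<open>c\<close> are the partial sums of this expression. The successive ratios
  xi, c1 / xi, D / c1, c / D are the factors by which e_i acts on the barred and unbarred entries of
  x and then of y. The sum on the right is the coefficient of \<open>gr\<close> at i in V_0; it is
  only rescaled.\<close>

lemma F_inv: "1 + Y1 / ((D / c1) * (c1 / xi) * x1) + p * c1 = xi / (D / c1) * (1 + Y1 / x1 + p)"
proof -
  have "x1 * D + Y1 * xi + p * c1 * x1 * D = xi * c1 * (x1 + Y1 + p * x1)"
    unfolding defs by algebra
  then have "(x1 * D + Y1 * xi + p * c1 * x1 * D) / (D * x1) = xi * c1 * (x1 + Y1 + p * x1) / (D * x1)"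
    by simp
  then show ?thesis using pos cpos by (simp add: field_simps)
qed

lemma G_inv: "1 + x1 * (c1 / xi) * (D / c1) / Y1 + q / (c / c1) = (c1 / xi) / (c / D) * (1 + x1 / Y1 + q)"
proof -
  have "xi * Y1 * c + x1 * D * c + q * c1 * xi * Y1 = c1 * D * (Y1 + x1 + q * Y1)"
    unfolding defs by algebra
  then have "(xi * Y1 * c + x1 * D * c + q * c1 * xi * Y1) / (xi * Y1 * c) = c1 * D * (Y1 + x1 + q * Y1) / (xi * Y1 * c)"
    by simp
  then show ?thesis using pos cpos by (simp add: field_simps)
qed

context
  fixes a b a' b' d Ka Kb :: real
  assumes a: "a = Ka + d * (1 + Y1 / x1)"
    and a': "a' = xi / (D / c1) * Ka + d * (1 + Y1 / ((D / c1) * (c1 / xi) * x1))"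
    and b: "b = Kb - d * (1 + x1 / Y1)"
    and b': "b' = (c1 / xi) / (c / D) * Kb - d * (1 + x1 * (c1 / xi) * (D / c1) / Y1)"
begin

lemma a'_eq: "D / c1 * a' = a + t * p * (x1 * (a - d) - d * Y1)"
proof -
  have "D / c1 * a' = xi * Ka + d * D / c1 + d * Y1 * xi / (c1 * x1)"
    unfolding a' using pos cpos by (simp add: field_simps)
  also have "\<dots> = xi * Ka + d * (D * x1 + Y1 * xi) / (c1 * x1)"
    using pos cpos by (simp add: field_simps)
  also have "D * x1 + Y1 * xi = c1 * (x1 + Y1)" unfolding defs by algebra
  also have "xi * Ka + d * (c1 * (x1 + Y1)) / (c1 * x1) = xi * Ka + d * (1 + Y1 / x1)"
    using pos cpos by (simp add: field_simps)
  also have "\<dots> = a + t * p * (x1 * (a - d) - d * Y1)"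
    unfolding a defs(1) using pos by (simp add: field_simps)
  finally show ?thesis .
qed

lemma b'_eq: "b' * c * xi = D * (c1 * (b + d) - t * d * x1 * (1 + q)) - d * c * xi"
proof -
  have e: "(c - c1) / Y1 = t * (1 + q)" using pos unfolding defs by (simp add: field_simps)
  have "b' * c * xi = c1 * D * Kb - d * c * xi - d * x1 * D * c / Y1"
    unfolding b' using pos cpos by (simp add: field_simps)
  also have "\<dots> = c1 * D * (b + d) - d * c * xi - d * x1 * D * ((c - c1) / Y1)"
    unfolding b using pos cpos by (simp add: field_simps)
  finally show ?thesis unfolding e by (simp add: algebra_simps)
qed

text \<open>In the form (V - d) (Vs + d) + d^2 the two brackets have the factorized transforms
  \<open>A\<close> and \<open>B\<close>, in whose product D and xi cancel.\<close>

lemma W'_eq: "(a' * b' + d * (a' - b')) * c / c1 = a * b + d * (a - b) + t *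
   ((x1 * (a - d) - d * Y1) * ((1 + p) * (b + d) - (1 + q) * d))"
proof -
  have A: "(a' - d) * D = xi * (c1 * (a - d) - t * d * (1 + p) * Y1)"
  proof -
    have "a' * D = c1 * (a + t * p * (x1 * (a - d) - d * Y1))"
      using a'_eq cpos by (simp add: field_simps)
    then show ?thesis unfolding defs by algebra
  qed
  have B: "(b' + d) * c * xi = D * (c1 * (b + d) - t * d * x1 * (1 + q))"
    using b'_eq by algebra
  have "(a' - d) * (b' + d) * c * (D * xi) =
     (c1 * (a - d) - t * d * (1 + p) * Y1) * (c1 * (b + d) - t * d * x1 * (1 + q)) * (D * xi)"
    using A B by algebra
  then have AB: "(a' - d) * (b' + d) * c =
     (c1 * (a - d) - t * d * (1 + p) * Y1) * (c1 * (b + d) - t * d * x1 * (1 + q))"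
    using cpos by simp
  have "(a' * b' + d * (a' - b')) * c = (a' - d) * (b' + d) * c + d * d * c" by algebra
  also have "\<dots> = c1 * (a * b + d * (a - b) + t *
   ((x1 * (a - d) - d * Y1) * ((1 + p) * (b + d) - (1 + q) * d)))"
    unfolding AB unfolding defs by algebra
  finally show ?thesis using cpos by simp
qed

text \<open>The bracket next to b on the right is the transformed W_i up to the factor c / c1, and
  \<open>w\<close> is proportional to W_{i+1}; in this shape \<open>b'_xi\<close> can read off the
  factor with which e_i acts on the image.\<close>

lemma b'_eq2:
  assumes w: "w = a * b + d * (b * p - a * q)"
  shows "b' * c * (a * b + d * (a - b)) = (c1 / xi) *
   (b * (a * b + d * (a - b) + t * ((x1 * (a - d) - d * Y1) * ((1 + p) * (b + d) - (1 + q) * d)))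
     + t * (Y1 * (b + d) + d * x1) * w)"
proof -
  note b'_eq
  moreover have "(D * (c1 * (b + d) - t * d * x1 * (1 + q)) - d * c * xi) * (a * b + d * (a - b))
    = c1 * (b * (a * b + d * (a - b) + t * ((x1 * (a - d) - d * Y1) * ((1 + p) * (b + d) - (1 + q) * d)))
     + t * (Y1 * (b + d) + d * x1) * w)"
    unfolding w defs by algebra
  ultimately have "b' * c * xi * (a * b + d * (a - b)) = c1 * (b * (a * b + d * (a - b) + t * ((x1 * (a - d) - d * Y1) * ((1 + p) * (b + d) - (1 + q) * d)))
     + t * (Y1 * (b + d) + d * x1) * w)" by simp
  then show ?thesis using cpos by (simp add: field_simps)
qed

end
end

section \<open>The nodes 1 \<le> i \<le> n - 2\<close>

lemma prod_two_change:
  fixes f g :: "nat \<Rightarrow> real"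
  assumes "finite S" "i \<in> S" "k \<in> S" "i \<noteq> k" "f i * f k = g i * g k"
    and "\<And>j. j \<in> S \<Longrightarrow> j \<noteq> i \<Longrightarrow> j \<noteq> k \<Longrightarrow> f j = g j"
  shows "prod f S = prod g S"
proof -
  have *: "prod h S = h i * h k * prod h (S - {i} - {k})" for h :: "nat \<Rightarrow> real"
    using assms(1-4) prod.remove[of S i h] prod.remove[of "S - {i}" k h] by (simp add: mult_ac)
  have "prod f (S - {i} - {k}) = prod g (S - {i} - {k})" using assms(6) by (intro prod.cong) auto
  then show ?thesis unfolding * assms(5) by simp
qed

lemma sum_two_change:
  fixes f g :: "nat \<Rightarrow> real"
  assumes "finite S" "i \<in> S" "k \<in> S" "i \<noteq> k" "f i + f k = g i + g k"
    and "\<And>j. j \<in> S \<Longrightarrow> j \<noteq> i \<Longrightarrow> j \<noteq> k \<Longrightarrow> f j = g j"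
  shows "sum f S = sum g S"
proof -
  have *: "sum h S = h i + h k + sum h (S - {i} - {k})" for h :: "nat \<Rightarrow> real"
    using assms(1-4) sum.remove[of S i h] sum.remove[of "S - {i}" k h] by (simp add: add_ac)
  have "sum f (S - {i} - {k}) = sum g (S - {i} - {k})" using assms(6) by (intro sum.cong) auto
  then show ?thesis unfolding * assms(5) by simp
qed

definition gr :: "nat \<Rightarrow> gcoords \<Rightarrow> gcoords \<Rightarrow> real" where
  "gr j x y = (\<Prod>k=1..j. snd x k / snd y k)"

definition gs :: "nat \<Rightarrow> gcoords \<Rightarrow> gcoords \<Rightarrow> real" where
  "gs j x y = (\<Prod>k=1..j. fst y k / fst x k)"

text \<open>All terms of V_0 with the same index j < n; the indicator is there because the theta
  terms stop at n - 2.\<close>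

definition gh :: "nat \<Rightarrow> nat \<Rightarrow> gcoords \<Rightarrow> gcoords \<Rightarrow> real" where
  "gh n j x y = gell n y * gr j x y * (of_bool (j \<le> n - 2) + snd y j / fst x j)
              + gell n x * gs j x y * (of_bool (j \<le> n - 2) + fst x j / snd y j)"

lemma gr_Suc: "gr (Suc j) x y = gr j x y * (snd x (Suc j) / snd y (Suc j))"
  and gs_Suc: "gs (Suc j) x y = gs j x y * (fst y (Suc j) / fst x (Suc j))"
  by (simp_all add: gr_def gs_def prod.cl_ivl_Suc)

lemma gV_0_eq:
  assumes "n \<ge> 3"
  shows "gV n 0 x y = (\<Sum>j=1..n-1. gh n j x y)
     + (gell n y * gr (n-1) x y * fst x n + gell n x * gs (n-1) x y / fst x n)"
proof -
  have s: "sum f {1..n} = sum f {1..n-1} + f n" for f :: "nat \<Rightarrow> real"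
    using assms by (cases n) auto
  have s2: "sum f {1..n-2} = (\<Sum>j=1..n-1. of_bool (j \<le> n - 2) * f j)" for f :: "nat \<Rightarrow> real"
    by (rule sum.mono_neutral_cong_left) auto
  have th: "gtheta n 0 j x y = gell n y * gr j x y" "gtheta' n 0 j x y = gell n x * gs j x y"
    if "1 \<le> j" for j using that by (simp_all add: gtheta_def gtheta'_def gr_def gs_def)
  have n: "\<not> n \<le> n - 1" "0 \<noteq> n - 1" "1 \<le> n - 1" using assms by auto
  have en: "geta n 0 n x y = gell n y * gr (n-1) x y * fst x n"
           "geta' n 0 n x y = gell n x * gs (n-1) x y / fst x n"
    unfolding geta_def geta'_def if_not_P[OF n(1)] if_not_P[OF n(2)] th[OF n(3)]
    by (simp_all add: gr_def)
  show ?thesis unfolding gV_def s s2 en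
    unfolding add.assoc[symmetric] sum.distrib[symmetric]
    by (intro arg_cong2[where f="(+)"] sum.cong refl)
       (auto simp: gh_def geta_def geta'_def th of_bool_def algebra_simps)
qed

lemma gxi_eq:
  assumes "gpos x"
  shows "gxi i c x = 1 + (c - 1) / (1 + fst x (i+1) / snd x (i+1))"
proof -
  have "snd x (i+1) + fst x (i+1) \<noteq> 0" using gpos_fst(1)[OF assms, of "i+1"] gpos_snd(1)[OF assms, of "i+1"] by linarith
  then show ?thesis using assms by (simp add: gxi_def field_simps)
qed

lemma ring_factor:
  fixes k :: real
  shows "k * A + d * (k * F) = k * (A + d * F)" "k * A - d * (k * F) = k * (A - d * F)"
  by (simp_all add: algebra_simps)

locale pair_e =
  fixes n i :: nat and c :: real and x y :: gcoords
  assumes n3: "n \<ge> 3" and i: "1 \<le> i" "i \<le> n - 2" and px: "gpos x" and py: "gpos y" and c0: "c > 0"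
begin

abbreviation "x1 \<equiv> fst x i"
abbreviation "X1 \<equiv> snd x i"
abbreviation "x2 \<equiv> fst x (i+1)"
abbreviation "X2 \<equiv> snd x (i+1)"
abbreviation "y1 \<equiv> fst y i"
abbreviation "Y1 \<equiv> snd y i"
abbreviation "y2 \<equiv> fst y (i+1)"
abbreviation "Y2 \<equiv> snd y (i+1)"

definition "c1 = gleft n i c x y"
definition "t = (c - 1) / (gphi n i x + geps n i y)"
definition "xi = gxi i c1 x"
definition "D = c1 + t * Y1"

definition "tx = ge n i c1 x"
definition "ty = ge n i (c / c1) y"

lemma ni: "i \<noteq> n - 1" "i \<noteq> n" "i + 1 \<noteq> n" "n \<ge> 1" "n \<ge> 2" "i + 1 \<le> n - 1" using n3 i by auto

lemma posv: "x1 > 0" "X1 > 0" "y1 > 0" "Y1 > 0" "x2 > 0" "X2 > 0" "y2 > 0" "Y2 > 0"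
  using px py by auto

lemma phi_x: "gphi n i x = x1 * (1 + X2 / x2)"
  and eps_y: "geps n i y = Y1 * (1 + y2 / Y2)"
  unfolding gphi_def geps_def if_not_P[OF ni(1)] by rule+

lemma N0: "gphi n i x + geps n i y > 0"
  by (intro add_pos_pos gphi_pos geps_pos px py)

lemma c1_pos: "c1 > 0" unfolding c1_def by (rule gleft_pos[OF px py c0])

lemma c_t: "c = 1 + t * (gphi n i x + geps n i y)"
  using N0 by (simp add: t_def)

lemma c1_t: "c1 = 1 + t * gphi n i x"
proof -
  have "c1 * (gphi n i x + geps n i y) = c * gphi n i x + geps n i y"
    unfolding c1_def gleft_def using N0 by simp
  also have "\<dots> = (1 + t * gphi n i x) * (gphi n i x + geps n i y)"
    using c_t by algebra
  finally show ?thesis using N0 by simp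
qed

lemma xi_t: "xi = 1 + t * x1 * (X2 / x2)"
proof -
  have "1 + X2 / x2 = (X2 / x2) * (1 + x2 / X2)" "1 + x2 / X2 > 0" using posv by (simp_all add: field_simps)
  then show ?thesis unfolding xi_def gxi_eq[OF px] c1_t phi_x by simp
qed

lemma c1_xi: "c1 = xi + t * x1"
  unfolding xi_t c1_t phi_x by (simp add: algebra_simps)

lemma c_D: "c = D + t * Y1 * (y2 / Y2)"
proof -
  have "t * (gphi n i x + geps n i y) = t * gphi n i x + t * Y1 + t * Y1 * (y2 / Y2)"
    unfolding eps_y by (simp add: algebra_simps)
  then show ?thesis using c_t c1_t unfolding D_def by linarith
qed

text \<open>The parameter t may have either sign, but as a partial sum D lies between c1 and c,
  which are positive.\<close>

lemma D_pos: "D > 0"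
proof (cases "t \<ge> 0")
  case True
  then have "t * Y1 \<ge> 0" using posv(4) by simp
  then show ?thesis using c1_pos unfolding D_def by linarith
next
  case False
  then have "t * Y1 * (y2 / Y2) < 0"
    using mult_neg_pos[OF mult_neg_pos[of t Y1] divide_pos_pos[OF posv(7,8)]] posv(4) by linarith
  then show ?thesis using c_D c0 by linarith
qed

sublocale pa: pair_action x1 Y1 "X2 / x2" "y2 / Y2" t xi c1 D c
proof
  show "xi > 0" unfolding xi_def by (rule gxi_pos[OF px c1_pos])
qed (use posv xi_t c1_xi c_D D_def c1_pos D_pos c0 in auto)

lemma xi_y: "gxi i (c / c1) y = D / c1"
proof -
  have "c / c1 - 1 = t * Y1 * (1 + y2 / Y2) / c1"
  proof -
    have "c - c1 = t * Y1 * (1 + y2 / Y2)" using c_D unfolding D_def by algebra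
    moreover have "c / c1 - 1 = (c - c1) / c1" using c1_pos by (simp add: diff_divide_distrib)
    ultimately show ?thesis by simp
  qed
  moreover have "1 + y2 / Y2 \<noteq> 0" using pa.pos by linarith
  ultimately have "gxi i (c / c1) y = 1 + t * Y1 / c1" unfolding gxi_eq[OF py] by simp
  then show ?thesis using c1_pos by (simp add: D_def add_divide_distrib)
qed

lemma tx_nth: "fst tx i = x1 * (c1 / xi)" "fst tx (i+1) = x2 / (c1 / xi)"
    "snd tx i = X1 / xi" "snd tx (i+1) = X2 * xi"
    "j \<noteq> i \<Longrightarrow> j \<noteq> i + 1 \<Longrightarrow> fst tx j = fst x j" "j \<noteq> i \<Longrightarrow> j \<noteq> i + 1 \<Longrightarrow> snd tx j = snd x j"
  unfolding tx_def ge_def if_not_P[OF ni(1)] xi_def[symmetric] by auto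

lemma ty_nth: "fst ty i = y1 * (c / D)" "fst ty (i+1) = y2 / (c / D)"
    "snd ty i = Y1 / (D / c1)" "snd ty (i+1) = Y2 * (D / c1)"
    "j \<noteq> i \<Longrightarrow> j \<noteq> i + 1 \<Longrightarrow> fst ty j = fst y j" "j \<noteq> i \<Longrightarrow> j \<noteq> i + 1 \<Longrightarrow> snd ty j = snd y j"
  unfolding ty_def ge_def if_not_P[OF ni(1)] xi_y using c1_pos by auto

lemma ptx: "gpos tx" unfolding tx_def by (rule gpos_ge[OF px c1_pos])
lemma pty: "gpos ty" unfolding ty_def using c0 c1_pos by (intro gpos_ge[OF py]) auto

lemma ell_tx: "gell n tx = gell n x" and ell_ty: "gell n ty = gell n y"
proof -
  have I: "i \<in> {1..n-1}" "i + 1 \<in> {1..n-1}" using i by auto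
  have "(\<Prod>i=1..n-1. fst tx i * snd tx i) = (\<Prod>i=1..n-1. fst x i * snd x i)"
    by (rule prod_two_change[OF _ I]) (use pa.cpos in \<open>auto simp: tx_nth simp del: One_nat_def add_Suc_right\<close>)
  moreover have "(\<Prod>i=1..n-1. fst ty i * snd ty i) = (\<Prod>i=1..n-1. fst y i * snd y i)"
    by (rule prod_two_change[OF _ I]) (use pa.cpos in \<open>auto simp: ty_nth simp del: One_nat_def add_Suc_right\<close>)
  ultimately show "gell n tx = gell n x" "gell n ty = gell n y"
    unfolding gell_def using ni by (simp_all add: tx_nth ty_nth)
qed

text \<open>The factors at i and i + 1 change by reciprocal amounts, so among the cumulative
  products only the one ending at i is affected.\<close>

lemma gr_t: "j \<noteq> i \<Longrightarrow> gr j tx ty = gr j x y"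
  and gs_t: "j \<noteq> i \<Longrightarrow> gs j tx ty = gs j x y"
proof -
  assume j: "j \<noteq> i"
  have *: "gr j tx ty = gr j x y \<and> gs j tx ty = gs j x y"
  proof (cases "j < i")
    case True
    then show ?thesis unfolding gr_def gs_def
      by (auto intro!: prod.cong simp: tx_nth ty_nth)
  next
    case False
    then have I: "i \<in> {1..j}" "i + 1 \<in> {1..j}" using i j by auto
    show ?thesis unfolding gr_def gs_def
      by (intro conjI; rule prod_two_change[OF _ I]) (use pa.cpos in \<open>auto simp: tx_nth ty_nth simp del: One_nat_def add_Suc_right\<close>)
  qed
  then show "gr j tx ty = gr j x y" "gs j tx ty = gs j x y" by auto
qed

lemma gr_i: "gr i tx ty = gr i x y * ((D / c1) / xi)"
  and gs_i: "gs i tx ty = gs i x y * ((c / D) / (c1 / xi))"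
proof -
  obtain m where m: "i = Suc m" using i by (cases i) auto
  have "gr m tx ty = gr m x y" "gs m tx ty = gs m x y" by (rule gr_t gs_t, simp add: m)+
  then show "gr i tx ty = gr i x y * ((D / c1) / xi)" "gs i tx ty = gs i x y * ((c / D) / (c1 / xi))"
    using gr_Suc[of m tx ty] gr_Suc[of m x y] gs_Suc[of m tx ty] gs_Suc[of m x y]
    unfolding m[symmetric] tx_nth ty_nth by (simp_all add: mult_ac)
qed

lemma F_t: "1 + snd ty i / fst tx i + snd tx (i+1) / fst tx (i+1) = xi / (D / c1) * (1 + Y1 / x1 + X2 / x2)"
  using pa.F_inv pa.cpos(1,2) unfolding tx_nth ty_nth by (simp add: mult_ac)

lemma G_t: "1 + fst tx i / snd ty i + fst ty (i+1) / snd ty (i+1) = (c1 / xi) / (c / D) * (1 + x1 / Y1 + y2 / Y2)"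
  using pa.G_inv pa.cpos unfolding tx_nth ty_nth by (simp add: mult_ac)

lemma gh_sum:
  assumes "gpos u" "gpos v"
  shows "gh n i u v + gh n (i+1) u v =
    gell n v * gr i u v * (1 + snd v i / fst u i + snd u (i+1) / fst u (i+1)) + gell n v * gr (i+1) u v * of_bool (i+1 \<le> n-2)
   + (gell n u * gs i u v * (1 + fst u i / snd v i + fst v (i+1) / snd v (i+1)) + gell n u * gs (i+1) u v * of_bool (i+1 \<le> n-2))"
  using gr_Suc[of i u v] gs_Suc[of i u v] i assms
  by (simp add: gh_def algebra_simps)

text \<open>In \<open>gh_sum\<close> the factors of \<open>gr\<close> and \<open>gs\<close> at i are
  reciprocal to those of the brackets beside them, by \<open>F_t\<close> and
  \<open>G_t\<close>.\<close>

lemma V0_t: "gV n 0 tx ty = gV n 0 x y"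
proof -
  have I: "i \<in> {1..n-1}" "i + 1 \<in> {1..n-1}" using i by auto
  have "(\<Sum>j=1..n-1. gh n j tx ty) = (\<Sum>j=1..n-1. gh n j x y)"
  proof (rule sum_two_change[OF _ I])
    have "gr (i+1) tx ty = gr (i+1) x y" "gs (i+1) tx ty = gs (i+1) x y"
      by (rule gr_t gs_t, simp)+
    then show "gh n i tx ty + gh n (i+1) tx ty = gh n i x y + gh n (i+1) x y"
      unfolding gh_sum[OF px py] gh_sum[OF ptx pty] ell_tx ell_ty F_t G_t gr_i gs_i
      using pa.cpos by simp
  next
    fix j assume "j \<noteq> i" "j \<noteq> i + 1"
    then show "gh n j tx ty = gh n j x y"
      by (simp add: gh_def ell_tx ell_ty gr_t gs_t tx_nth ty_nth)
  qed auto
  moreover have "gr (n-1) tx ty = gr (n-1) x y" "gs (n-1) tx ty = gs (n-1) x y"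
    by (rule gr_t gs_t, use ni in simp)+
  ultimately show ?thesis unfolding gV_0_eq[OF n3] using ni by (simp add: ell_tx ell_ty tx_nth)
qed

lemma V0s: "gVstar n 0 u v = gV n 0 u v" if "gpos u" "gpos v"
  using gV_0_star[OF that n3] .

lemma V_lt: "j < i \<Longrightarrow> gV n j tx ty = gV n j x y \<and> gVstar n j tx ty = gVstar n j x y"
proof (induction j)
  case 0
  then show ?case using V0_t V0s px py ptx pty by auto
next
  case (Suc m)
  then have m: "Suc m \<le> n - 2" using i by auto
  show ?case unfolding gV_rec[OF px py m] gVstar_rec[OF px py m] gV_rec[OF ptx pty m] gVstar_rec[OF ptx pty m]
    using Suc by (simp add: ell_tx ell_ty tx_nth ty_nth)
qed

abbreviation "d \<equiv> gell n x - gell n y"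
abbreviation "a \<equiv> gV n i x y"
abbreviation "b \<equiv> gVstar n i x y"
abbreviation "a' \<equiv> gV n i tx ty"
abbreviation "b' \<equiv> gVstar n i tx ty"
definition "Ka = Y1 / X1 * gV n (i-1) x y"
definition "Kb = x1 / y1 * gVstar n (i-1) x y"

lemma recs: "a = Ka + d * (1 + Y1 / x1)"
    "a' = xi / (D / c1) * Ka + d * (1 + Y1 / ((D / c1) * (c1 / xi) * x1))"
    "b = Kb - d * (1 + x1 / Y1)"
    "b' = (c1 / xi) / (c / D) * Kb - d * (1 + x1 * (c1 / xi) * (D / c1) / Y1)"
proof -
  obtain m where m: "i = Suc m" using i by (cases i) auto
  have l: "Suc m \<le> n - 2" "i - 1 = m" using i m by auto
  have e: "gV n m tx ty = gV n m x y" "gVstar n m tx ty = gVstar n m x y"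
    using V_lt[of m] m by auto
  show "a = Ka + d * (1 + Y1 / x1)" "b = Kb - d * (1 + x1 / Y1)"
    using gV_rec[OF px py l(1)] gVstar_rec[OF px py l(1)] unfolding Ka_def Kb_def l(2) m[symmetric] by auto
  show "a' = xi / (D / c1) * Ka + d * (1 + Y1 / ((D / c1) * (c1 / xi) * x1))"
  proof -
    have "Y1 / (D / c1) / (x1 * (c1 / xi)) = Y1 / ((D / c1) * (c1 / xi) * x1)" by (simp add: mult_ac)
    moreover have "Y1 / (D / c1) / (X1 / xi) = xi / (D / c1) * (Y1 / X1)" by simp
    ultimately show ?thesis
      using gV_rec[OF ptx pty l(1)] unfolding Ka_def l(2) m[symmetric] e ell_tx ell_ty tx_nth ty_nth
      by (simp only: mult.assoc)
  qed
  show "b' = (c1 / xi) / (c / D) * Kb - d * (1 + x1 * (c1 / xi) * (D / c1) / Y1)"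
    using gVstar_rec[OF ptx pty l(1)] unfolding Kb_def l(2) m[symmetric] e ell_tx ell_ty tx_nth ty_nth
    by (simp add: mult_ac)
qed

text \<open>V_i itself changes, but the part of the inhomogeneous term of V_{i+1} shown here
  completes it to \<open>Ka\<close> plus d times the bracket of \<open>F_t\<close>. The whole is
  rescaled by one factor, which the ratio of the entries i + 1 cancels. The part left out, d or d /
  y_n, is unaffected by the action.\<close>

lemma next_inv:
  "snd ty (i+1) / snd tx (i+1) * a' + d * (snd ty (i+1) / fst tx (i+1)) = Y2 / X2 * a + d * (Y2 / x2)"
  "fst tx (i+1) / fst ty (i+1) * b' - d * (fst tx (i+1) / snd ty (i+1)) = x2 / y2 * b - d * (x2 / Y2)"
proof -
  have "snd ty (i+1) / snd tx (i+1) * a' + d * (snd ty (i+1) / fst tx (i+1)) =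
    snd ty (i+1) / snd tx (i+1) * (a' + d * (snd tx (i+1) / fst tx (i+1)))"
    using ptx by (simp add: field_simps)
  also have "a' + d * (snd tx (i+1) / fst tx (i+1)) = xi / (D / c1) * Ka +
     d * (1 + snd ty i / fst tx i + snd tx (i+1) / fst tx (i+1))"
  proof -
    have "Y1 / (D / c1) / (x1 * (c1 / xi)) = Y1 / ((D / c1) * (c1 / xi) * x1)" by (simp add: mult_ac)
    then show ?thesis unfolding recs(2) ty_nth(3) tx_nth(1) by (simp only: distrib_left add.assoc)
  qed
  also have "\<dots> = xi / (D / c1) * (Ka + d * (1 + Y1 / x1 + X2 / x2))"
    unfolding F_t by (rule ring_factor)
  also have "snd ty (i+1) / snd tx (i+1) * (xi / (D / c1) * (Ka + d * (1 + Y1 / x1 + X2 / x2)))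
    = Y2 / X2 * (Ka + d * (1 + Y1 / x1 + X2 / x2))"
    unfolding ty_nth tx_nth using pa.cpos by simp
  also have "\<dots> = Y2 / X2 * a + d * (Y2 / x2)"
    unfolding recs(1) using posv by (simp add: field_simps)
  finally show "snd ty (i+1) / snd tx (i+1) * a' + d * (snd ty (i+1) / fst tx (i+1)) = Y2 / X2 * a + d * (Y2 / x2)" .
  have "fst tx (i+1) / fst ty (i+1) * b' - d * (fst tx (i+1) / snd ty (i+1)) =
    fst tx (i+1) / fst ty (i+1) * (b' - d * (fst ty (i+1) / snd ty (i+1)))"
    using pty by (simp add: field_simps)
  also have "b' - d * (fst ty (i+1) / snd ty (i+1)) = (c1 / xi) / (c / D) * Kb -
     d * (1 + fst tx i / snd ty i + fst ty (i+1) / snd ty (i+1))"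
  proof -
    have "x1 * (c1 / xi) / (Y1 / (D / c1)) = x1 * (c1 / xi) * (D / c1) / Y1" by simp
    then show ?thesis unfolding recs(4) ty_nth(3) tx_nth(1) by (simp only: distrib_left diff_diff_eq)
  qed
  also have "\<dots> = (c1 / xi) / (c / D) * (Kb - d * (1 + x1 / Y1 + y2 / Y2))"
    unfolding G_t by (rule ring_factor)
  also have "fst tx (i+1) / fst ty (i+1) * ((c1 / xi) / (c / D) * (Kb - d * (1 + x1 / Y1 + y2 / Y2)))
    = x2 / y2 * (Kb - d * (1 + x1 / Y1 + y2 / Y2))"
    unfolding ty_nth tx_nth using pa.cpos by simp
  also have "\<dots> = x2 / y2 * b - d * (x2 / Y2)"
    unfolding recs(3) using posv by (simp add: field_simps)
  finally show "fst tx (i+1) / fst ty (i+1) * b' - d * (fst tx (i+1) / snd ty (i+1)) = x2 / y2 * b - d * (x2 / Y2)" .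
qed

lemma V_gt: "i + k + 1 \<le> n - 1 \<Longrightarrow> gV n (i+k+1) tx ty = gV n (i+k+1) x y \<and> gVstar n (i+k+1) tx ty = gVstar n (i+k+1) x y"
proof (induction k)
  case 0
  show ?case
  proof (cases "Suc i = n - 1")
    case True
    then have l: "n = Suc (Suc i)" using n3 by auto
    have nn: "fst tx n = fst x n" "fst ty n = fst y n" using ni by (auto simp: tx_nth ty_nth)
    show ?thesis
      using gV_rec_last[OF px py i(1) l] gVstar_rec_last[OF px py i(1) l]
         gV_rec_last[OF ptx pty i(1) l] gVstar_rec_last[OF ptx pty i(1) l] next_inv
      by (simp add: ell_tx ell_ty nn algebra_simps)
  next
    case False
    then have l: "Suc i \<le> n - 2" using 0 by auto
    show ?thesis
      using gV_rec[OF px py l] gVstar_rec[OF px py l] gV_rec[OF ptx pty l] gVstar_rec[OF ptx pty l] next_inv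
      by (simp add: ell_tx ell_ty algebra_simps)
  qed
next
  case (Suc k)
  let ?m = "i + k + 1"
  have IH: "gV n ?m tx ty = gV n ?m x y" "gVstar n ?m tx ty = gVstar n ?m x y" using Suc by auto
  have m: "Suc ?m \<noteq> i" "Suc ?m \<noteq> i + 1" by auto
  show ?case
  proof (cases "Suc ?m = n - 1")
    case True
    then have l: "n = Suc (Suc ?m)" using n3 by auto
    have m1: "1 \<le> ?m" by simp
    have nn: "fst tx n = fst x n" "fst ty n = fst y n" using ni by (auto simp: tx_nth ty_nth)
    show ?thesis
      using gV_rec_last[OF px py m1 l] gVstar_rec_last[OF px py m1 l]
         gV_rec_last[OF ptx pty m1 l] gVstar_rec_last[OF ptx pty m1 l]
      unfolding IH ell_tx ell_ty nn tx_nth(5,6)[OF m] ty_nth(5,6)[OF m] by simp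
  next
    case False
    then have l: "Suc ?m \<le> n - 2" using Suc by auto
    show ?thesis
      using gV_rec[OF px py l] gVstar_rec[OF px py l] gV_rec[OF ptx pty l] gVstar_rec[OF ptx pty l]
      unfolding IH ell_tx ell_ty tx_nth(5,6)[OF m] ty_nth(5,6)[OF m] by simp
  qed
qed

lemma V_inv: "j \<le> n - 1 \<Longrightarrow> j \<noteq> i \<Longrightarrow> gV n j tx ty = gV n j x y"
  and Vstar_inv: "j \<le> n - 1 \<Longrightarrow> j \<noteq> i \<Longrightarrow> gVstar n j tx ty = gVstar n j x y"
proof -
  assume j: "j \<le> n - 1" "j \<noteq> i"
  have "gV n j tx ty = gV n j x y \<and> gVstar n j tx ty = gVstar n j x y"
  proof (cases "j < i")
    case False
    then obtain k where "j = i + k + 1" using j less_imp_Suc_add[of i j] by auto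
    then show ?thesis using V_gt[of k] j by simp
  qed (use V_lt in auto)
  then show "gV n j tx ty = gV n j x y" "gVstar n j tx ty = gVstar n j x y" by auto
qed

lemma W_inv: "j \<le> n - 1 \<Longrightarrow> j \<noteq> i \<Longrightarrow> gW n j tx ty = gW n j x y"
proof (cases "j \<le> n - 2")
  case True
  moreover assume "j \<noteq> i"
  ultimately show ?thesis
    using V_inv[of j] Vstar_inv[of j] by (simp add: gW_eq[OF px py n3] gW_eq[OF ptx pty n3] ell_tx ell_ty)
next
  case False
  moreover assume "j \<le> n - 1" "j \<noteq> i"
  ultimately have "j = n - 1" "j \<noteq> 0" "j \<noteq> 1" using n3 by auto
  then show ?thesis using V_inv[of j] Vstar_inv[of j] \<open>j \<noteq> i\<close> by (simp add: gW_def)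
qed

end

lemma gRx_nth:
  assumes "1 \<le> i" "i \<le> n - 1"
  shows "fst (gRx n x y) i = fst x i * gVstar n (i - 1) x y / gVstar n i x y"
    "snd (gRx n x y) i = snd x i * gVstar n (i - 1) x y * gW n i x y / gVstar n i x y / gW n (i - 1) x y"
    "fst (gRy n x y) i = fst y i * gV n (i - 1) x y * gW n i x y / gV n i x y / gW n (i - 1) x y"
    "snd (gRy n x y) i = snd y i * gV n (i - 1) x y / gV n i x y"
  using assms by (auto simp: gRx_def gRy_def)

lemma gRx_n:
  "fst (gRx n x y) n = fst x n * gVstar n (n - 1) x y / gV n (n - 1) x y"
  "fst (gRy n x y) n = fst y n * gV n (n - 1) x y / gVstar n (n - 1) x y"
  by (auto simp: gRx_def gRy_def)

lemma one_add_ratio: "(m::real) \<noteq> 0 \<Longrightarrow> 1 + k / m = (k + m) / m"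
  by (simp add: add_divide_distrib)

context pair_e
begin

abbreviation "p \<equiv> X2 / x2"
abbreviation "q \<equiv> y2 / Y2"
abbreviation "A0 \<equiv> gV n (i-1) x y"
abbreviation "B0 \<equiv> gVstar n (i-1) x y"
abbreviation "A2 \<equiv> gV n (i+1) x y"
abbreviation "B2 \<equiv> gVstar n (i+1) x y"
abbreviation "w0 \<equiv> gW n (i-1) x y"
abbreviation "w1 \<equiv> gW n i x y"
abbreviation "w2 \<equiv> gW n (i+1) x y"
abbreviation "x' \<equiv> gRx n x y"
abbreviation "y' \<equiv> gRy n x y"

text \<open>\<open>w\<close> is W_{i+1} up to the factor p q, by \<open>w2_eq\<close>.
  \<open>S\<close> and \<open>T\<close> appear in phi_i and eps_i of the image, and
  \<open>u\<close>, \<open>v\<close> are phi_i of its left factor and eps_i of its right factor up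
  to the common factor \<open>kap\<close>.\<close>

definition "w = a * b + d * (b * p - a * q)"
definition "S = (1 + p) * (b + d) - (1 + q) * d"
definition "T = (1 + q) * (a - d) + (1 + p) * d"
definition "u = (x1 * (a - d) - d * Y1) * S"
definition "v = (Y1 * (b + d) + d * x1) * T"
definition "c1' = gleft n i c y' x'"
definition "xi' = gxi i c1' y'"
definition "xi'' = gxi i (c / c1') x'"

lemma posw: "a > 0" "b > 0" "A0 > 0" "B0 > 0" "A2 > 0" "B2 > 0" "w0 > 0" "w1 > 0" "w2 > 0"
  using gV_pos[OF n3 px py] gVstar_pos[OF n3 px py] gW_pos[OF px py n3] by auto

lemma w1_eq: "w1 = a * b + d * (a - b)"
  by (rule gW_eq[OF px py n3 i(2)])

lemma w2_eq: "w2 * (p * q) = w"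
proof -
  have "Suc i \<le> n - 1" using ni by simp
  from gW_next[OF px py n3 this] show ?thesis unfolding w_def by (simp add: mult_ac)
qed

lemma w_pos: "w > 0"
  unfolding w2_eq[symmetric] using posw(9) pa.pos(3,4) by (intro mult_pos_pos)

lemma S_eq: "w + p * w1 = a * S"
  unfolding w1_eq w_def S_def by algebra

lemma T_eq: "w + q * w1 = b * T"
  unfolding w1_eq w_def T_def by algebra

lemma ratio_S: "1 + w / (p * w1) = a * S / (p * w1)"
  unfolding S_eq[symmetric]
  by (rule one_add_ratio) (use mult_pos_pos[OF pa.pos(3) posw(8)] in linarith)

lemma S_pos: "S > 0"
proof -
  have "a * S > 0" unfolding S_eq[symmetric] using w_pos posw pa.pos by (intro add_pos_pos mult_pos_pos)
  then show ?thesis using posw by (simp add: zero_less_mult_iff)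
qed

lemma T_pos: "T > 0"
proof -
  have "b * T > 0" unfolding T_eq[symmetric] using w_pos posw pa.pos by (intro add_pos_pos mult_pos_pos)
  then show ?thesis using posw by (simp add: zero_less_mult_iff)
qed

text \<open>The link between the two sides: \<open>kap\<close> cancels in \<open>gleft\<close>, so
  that c is divided on the image in the proportion u to v, while t refers to phi_i + eps_i at the
  source.\<close>

lemma uv: "u + v = (gphi n i x + geps n i y) * w1"
  unfolding phi_x eps_y w1_eq u_def v_def S_def T_def by algebra

lemma A0_eq: "x1 * (a - d) - d * Y1 = x1 * Y1 * A0 / X1"
  using recs(1) posv unfolding Ka_def by (simp add: field_simps)

lemma B0_eq: "Y1 * (b + d) + d * x1 = x1 * Y1 * B0 / y1"
  using recs(3) posv unfolding Kb_def by (simp add: field_simps)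

lemma uv_pos: "u > 0" "v > 0"
  unfolding u_def v_def A0_eq B0_eq using posv posw S_pos T_pos by simp_all

lemma i12: "1 \<le> i" "i \<le> n - 1" "1 \<le> i + 1" "i + 1 \<le> n - 1" using i by auto

lemma ratio_y: "fst y' (i+1) / snd y' (i+1) = w / (p * w1)"
  unfolding gRx_nth[OF i12(3,4)] w2_eq[symmetric] using posv posw by (simp add: field_simps)

lemma ratio_x: "fst x' (i+1) / snd x' (i+1) = q * w1 / w"
  unfolding gRx_nth[OF i12(3,4)] w2_eq[symmetric] using posv posw by (simp add: field_simps)

lemma eps_y': "geps n i y' = Y1 * A0 * S / (p * w1)"
proof -
  show ?thesis
    unfolding geps_def if_not_P[OF ni(1)] ratio_y ratio_S unfolding gRx_nth[OF i12(1,2)]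
    using posw by simp
qed

lemma phi_y': "gphi n i y' = y1 * A0 * w1 / (w0 * w) * S"
proof -
  have "snd y' (i+1) / fst y' (i+1) = p * w1 / w"
    using arg_cong[OF ratio_y, of inverse] by simp
  moreover have "1 + p * w1 / w = a * S / w" unfolding S_eq[symmetric] using w_pos by (simp add: add_divide_distrib)
  ultimately show ?thesis
    unfolding gphi_def if_not_P[OF ni(1)] unfolding gRx_nth[OF i12(1,2)]
    using posw by simp
qed

lemma eps_x': "geps n i x' = X1 * B0 * w1 / (w0 * w) * T"
proof -
  have "1 + q * w1 / w = b * T / w" unfolding T_eq[symmetric] using w_pos by (simp add: add_divide_distrib)
  then show ?thesis
    unfolding geps_def if_not_P[OF ni(1)] ratio_x unfolding gRx_nth[OF i12(1,2)]
    using posw by simp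
qed

definition "kap = X1 * y1 / (x1 * Y1) * w1 / (w0 * w)"

lemma kap_pos: "kap > 0" unfolding kap_def using posv posw w_pos by simp

lemma phi_u: "gphi n i y' = kap * u" and eps_v: "geps n i x' = kap * v"
  unfolding phi_y' eps_x' kap_def u_def v_def A0_eq B0_eq using posv by (simp_all add: field_simps)

lemma c_1: "c - 1 = t * (gphi n i x + geps n i y)"
  using c_t by linarith

text \<open>The right-hand side also occurs in \<open>W'_eq\<close>, so the share of the left factor
  of the image is visible in the change of W_i.\<close>

lemma c1'_eq: "c1' * w1 = w1 + t * u"
proof -
  have "c1' = (c * u + v) / (u + v)"
  proof -
    have "c * (kap * u) + kap * v = kap * (c * u + v)" by algebra
    then show ?thesis
      unfolding c1'_def gleft_def phi_u eps_v distrib_left[symmetric] using kap_pos by simp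
  qed
  then have "c1' * (u + v) = c * u + v" using uv_pos by simp
  then have "c1' * (u + v) = (u + v) + (c - 1) * u" by algebra
  then have "(c1' - 1) * ((gphi n i x + geps n i y) * w1) = t * (gphi n i x + geps n i y) * u"
    unfolding uv c_1 by algebra
  then have "(gphi n i x + geps n i y) * ((c1' - 1) * w1) = (gphi n i x + geps n i y) * (t * u)"
    by algebra
  then have "(c1' - 1) * w1 = t * u" using N0 by simp
  then show ?thesis by algebra
qed

lemma p': "gpos x'" "gpos y'" using gpos_gR[OF px py n3] .

lemma c1'_pos: "c1' > 0" unfolding c1'_def by (rule gleft_pos[OF p'(2,1) c0])

lemma xi'_pos: "xi' > 0" unfolding xi'_def by (rule gxi_pos[OF p'(2) c1'_pos])
lemma xi''_pos: "xi'' > 0" unfolding xi''_def using c0 c1'_pos by (intro gxi_pos[OF p'(1)]) simp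

text \<open>The factor c1 / D compensates for the action on the barred y_i, so that the barred entry
  i of the image y' is divided by exactly \<open>xi'\<close>, as e_i requires.\<close>

lemma a'_xi: "a' = a * xi' * c1 / D"
proof -
  note e = ratio_S
  have "c1' - 1 = t * u / w1" using c1'_eq posw(8) by (simp add: field_simps)
  then have "xi' = 1 + t * u / w1 / (a * S / (p * w1))"
    unfolding xi'_def gxi_eq[OF p'(2)] ratio_y e by simp
  also have "\<dots> = 1 + t * p * (x1 * (a - d) - d * Y1) / a"
    unfolding u_def using posw S_pos by (simp add: mult_ac)
  finally have "a * xi' = a + t * p * (x1 * (a - d) - d * Y1)" using posw(1) by (simp add: distrib_left)
  also have "\<dots> = D / c1 * a'" by (rule pa.a'_eq[OF recs, symmetric])
  finally show ?thesis using pa.cpos by (simp add: field_simps)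
qed

lemma w'_eq: "gW n i tx ty = c1' * w1 * c1 / c"
proof -
  have "gW n i tx ty * c / c1 = w1 + t * u"
    using pa.W'_eq[OF recs] unfolding gW_eq[OF ptx pty n3 i(2)] ell_tx ell_ty w1_eq u_def S_def .
  then show ?thesis unfolding c1'_eq[symmetric] using pa.cpos c1_pos by (simp add: field_simps)
qed

lemma b'_xi: "b' = (c1 / xi) * b * xi'' * c1' / c"
proof -
  have e: "1 + q * w1 / w = b * T / w" unfolding T_eq[symmetric] using w_pos by (simp add: add_divide_distrib)
  have "(c - c1') * w1 = t * v"
  proof -
    have "(c - c1') * w1 = (c - 1) * w1 - (c1' * w1 - w1)" by algebra
    also have "\<dots> = t * (u + v) - t * u" unfolding uv c1'_eq c_1 by algebra
    finally show ?thesis by algebra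
  qed
  then have "c - c1' = t * v / w1" using posw(8) by (simp add: field_simps)
  then have "c / c1' - 1 = t * v / w1 / c1'"
    using c1'_pos by (simp add: field_simps)
  then have "xi'' = 1 + t * v / w1 / c1' / (b * T / w)"
    unfolding xi''_def gxi_eq[OF p'(1)] ratio_x e by simp
  also have "\<dots> = 1 + t * (Y1 * (b + d) + d * x1) * w / (b * (c1' * w1))"
    unfolding v_def using posw T_pos c1'_pos by (simp add: mult_ac)
  finally have "b * (c1' * w1) * xi'' = b * (c1' * w1) + t * (Y1 * (b + d) + d * x1) * w"
    using posw c1'_pos by (simp add: field_simps)
  then have "b' * c * w1 = (c1 / xi) * (b * (c1' * w1) * xi'')"
    using pa.b'_eq2[OF recs w_def] unfolding w1_eq[symmetric] S_def[symmetric] u_def[symmetric] c1'_eq[symmetric]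
    by simp
  then have "(b' * c) * w1 = ((c1 / xi) * (b * c1' * xi'')) * w1" by (simp add: mult_ac)
  moreover have "w1 \<noteq> 0" using posw(8) by linarith
  ultimately have "b' * c = (c1 / xi) * (b * c1' * xi'')" by (metis mult_cancel_right)
  then have "b' = (c1 / xi) * (b * c1' * xi'') / c" using c0 by (intro eq_divide_imp) auto
  then show ?thesis by (simp add: mult_ac)
qed

lemma other:
  assumes "j \<noteq> i" "j \<noteq> i + 1"
  shows "fst (gRx n tx ty) j = fst x' j" "snd (gRx n tx ty) j = snd x' j"
    "fst (gRy n tx ty) j = fst y' j" "snd (gRy n tx ty) j = snd y' j"
proof -
  have n: "gV n (n-1) tx ty = gV n (n-1) x y" "gVstar n (n-1) tx ty = gVstar n (n-1) x y"
    by (rule V_inv Vstar_inv, rule order_refl, rule ni(1)[symmetric])+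
  have "fst (gRx n tx ty) j = fst x' j \<and> snd (gRx n tx ty) j = snd x' j \<and>
    fst (gRy n tx ty) j = fst y' j \<and> snd (gRy n tx ty) j = snd y' j"
  proof (cases "1 \<le> j \<and> j \<le> n - 1")
    case True
    then have j: "j - 1 \<noteq> i" "j - 1 \<le> n - 1" "1 \<le> j" "j \<le> n - 1" using assms by auto
    show ?thesis
      unfolding gRx_nth[OF j(3,4)] V_inv[OF j(2,1)] Vstar_inv[OF j(2,1)] W_inv[OF j(2,1)]
        V_inv[OF j(4) assms(1)] Vstar_inv[OF j(4) assms(1)] W_inv[OF j(4) assms(1)]
        tx_nth(5,6)[OF assms] ty_nth(5,6)[OF assms] by simp
  next
    case False
    have s: "snd (gRx n u v) j = 1" "snd (gRy n u v) j = 1" for u v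
      using False unfolding gRx_def gRy_def by auto
    show ?thesis
    proof (cases "j = n")
      case True
      show ?thesis unfolding s unfolding True gRx_n n tx_nth(5)[OF ni(2)[symmetric] ni(3)[symmetric]]
        ty_nth(5)[OF ni(2)[symmetric] ni(3)[symmetric]] by simp
    next
      case j: False
      have "fst (gRx n u v) j = 1" "fst (gRy n u v) j = 1" for u v
        using False j unfolding gRx_def gRy_def by auto
      then show ?thesis using s by simp
    qed
  qed
  then show "fst (gRx n tx ty) j = fst x' j" "snd (gRx n tx ty) j = snd x' j"
    "fst (gRy n tx ty) j = fst y' j" "snd (gRy n tx ty) j = snd y' j" by auto
qed

lemma inv_near: "gV n (i-1) tx ty = A0" "gVstar n (i-1) tx ty = B0" "gW n (i-1) tx ty = w0"
   "gV n (i+1) tx ty = A2" "gVstar n (i+1) tx ty = B2" "gW n (i+1) tx ty = w2"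
  using V_inv[of "i-1"] V_inv[of "i+1"] Vstar_inv[of "i-1"] Vstar_inv[of "i+1"] W_inv[of "i-1"] W_inv[of "i+1"] i ni
  by auto

lemma commute_y: "gRy n tx ty = ge n i c1' y'"
proof -
  have 1: "fst (gRy n tx ty) i = fst y' i * (c1' / xi')" "snd (gRy n tx ty) i = snd y' i / xi'"
    unfolding gRx_nth[OF i12(1,2)] inv_near a'_xi w'_eq tx_nth ty_nth
    using posw pa.cpos c1'_pos xi'_pos by (simp_all add: mult_ac)
  have 2: "fst (gRy n tx ty) (i+1) = fst y' (i+1) / (c1' / xi')" "snd (gRy n tx ty) (i+1) = snd y' (i+1) * xi'"
    unfolding gRx_nth[OF i12(3,4)] add_diff_cancel_right' inv_near a'_xi w'_eq tx_nth ty_nth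
    using posw pa.cpos c1'_pos xi'_pos by (simp_all add: mult_ac)
  show ?thesis unfolding ge_def if_not_P[OF ni(1)] xi'_def[symmetric]
  proof (rule prod_eqI; rule ext)
    fix j
    show "fst (gRy n tx ty) j = fst ((fst y')(i := fst y' i * (c1' / xi'), i + 1 := fst y' (i + 1) / (c1' / xi')),
          (snd y')(i := snd y' i / xi', i + 1 := snd y' (i + 1) * xi')) j"
      using other[of j] 1 2 by (cases "j = i"; cases "j = i + 1") auto
    show "snd (gRy n tx ty) j = snd ((fst y')(i := fst y' i * (c1' / xi'), i + 1 := fst y' (i + 1) / (c1' / xi')),
          (snd y')(i := snd y' i / xi', i + 1 := snd y' (i + 1) * xi')) j"
      using other[of j] 1 2 by (cases "j = i"; cases "j = i + 1") auto
  qed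
qed

lemma commute_x: "gRx n tx ty = ge n i (c / c1') x'"
proof -
  have 1: "fst (gRx n tx ty) i = fst x' i * (c / c1' / xi'')" "snd (gRx n tx ty) i = snd x' i / xi''"
    unfolding gRx_nth[OF i12(1,2)] inv_near b'_xi w'_eq tx_nth ty_nth
    using posw pa.cpos c1'_pos xi''_pos c0 by (simp_all add: mult_ac)
  have 2: "fst (gRx n tx ty) (i+1) = fst x' (i+1) / (c / c1' / xi'')" "snd (gRx n tx ty) (i+1) = snd x' (i+1) * xi''"
    unfolding gRx_nth[OF i12(3,4)] add_diff_cancel_right' inv_near b'_xi w'_eq tx_nth ty_nth
    using posw pa.cpos c1'_pos xi''_pos c0 by (simp_all add: mult_ac)
  show ?thesis unfolding ge_def if_not_P[OF ni(1)] xi''_def[symmetric]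
  proof (rule prod_eqI; rule ext)
    fix j
    show "fst (gRx n tx ty) j = fst ((fst x')(i := fst x' i * (c / c1' / xi''), i + 1 := fst x' (i + 1) / (c / c1' / xi'')),
          (snd x')(i := snd x' i / xi'', i + 1 := snd x' (i + 1) * xi'')) j"
      using other[of j] 1 2 by (cases "j = i"; cases "j = i + 1") auto
    show "snd (gRx n tx ty) j = snd ((fst x')(i := fst x' i * (c / c1' / xi''), i + 1 := fst x' (i + 1) / (c / c1' / xi'')),
          (snd x')(i := snd x' i / xi'', i + 1 := snd x' (i + 1) * xi'')) j"
      using other[of j] 1 2 by (cases "j = i"; cases "j = i + 1") auto
  qed
qed

text \<open>Both sides are the lift of eps_i of a tensor product, \<open>eps2\<close> in the
  piecewise linear setting: \<open>R\<close> preserves the lengths of strings.\<close>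

lemma eps_pair: "geps n i y' * (gphi n i y' + geps n i x') / gphi n i y'
   = geps n i x * (gphi n i x + geps n i y) / gphi n i x"
proof -
  define N where "N = gphi n i x + geps n i y"
  have "geps n i y' * (gphi n i y' + geps n i x') / gphi n i y' = geps n i y' * (u + v) / u"
    unfolding phi_u eps_v distrib_left[symmetric] using kap_pos by simp
  also have "\<dots> = X1 / (p * x1) * N"
    unfolding uv N_def[symmetric] unfolding eps_y' u_def A0_eq using posv posw S_pos by simp
  also have "X1 / (p * x1) = geps n i x / gphi n i x"
  proof -
    have "1 + x2 / X2 = (1 + p) / p" "1 + p > 0" using posv by (simp_all add: field_simps)
    then show ?thesis unfolding phi_x geps_def if_not_P[OF ni(1)] using posv by simp
  qed
  finally show ?thesis by (simp add: N_def)
qed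

end

section \<open>The node n - 1\<close>

locale pair_e_last =
  fixes n m :: nat and c :: real and x y :: gcoords
  assumes nm: "n = Suc (Suc m)" "m \<ge> 1" and px: "gpos x" and py: "gpos y" and c0: "c > 0"
begin

abbreviation "l \<equiv> Suc m"
abbreviation "x1 \<equiv> fst x l"
abbreviation "X1 \<equiv> snd x l"
abbreviation "y1 \<equiv> fst y l"
abbreviation "Y1 \<equiv> snd y l"
abbreviation "P \<equiv> fst x n"
abbreviation "Q \<equiv> fst y n"

lemma n3: "n \<ge> 3" and l: "l = n - 1" "n - 1 = l" "n - 2 = m" "l \<noteq> n" using nm by auto

lemma posv: "x1 > 0" "X1 > 0" "y1 > 0" "Y1 > 0" "P > 0" "Q > 0"
  using px py by auto

definition "c1 = gleft n l c x y"
definition "tx = ge n l c1 x"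
definition "ty = ge n l (c / c1) y"

lemma c1_eq: "c1 = (c * x1 + Y1 * Q) / (x1 + Y1 * Q)"
  unfolding c1_def gleft_def gphi_def geps_def if_P[OF l(1)] ..

lemma c1_pos: "c1 > 0" unfolding c1_def by (rule gleft_pos[OF px py c0])

lemma tx_nth: "fst tx l = x1 * c1" "fst tx n = P / c1" "snd tx = snd x"
    "j \<noteq> l \<Longrightarrow> j \<noteq> n \<Longrightarrow> fst tx j = fst x j"
  unfolding tx_def ge_def if_P[OF l(1)] using l(4) by auto

lemma ty_nth: "fst ty l = y1 * (c / c1)" "fst ty n = Q / (c / c1)" "snd ty = snd y"
    "j \<noteq> l \<Longrightarrow> j \<noteq> n \<Longrightarrow> fst ty j = fst y j"
  unfolding ty_def ge_def if_P[OF l(1)] using l(4) by auto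

lemma ptx: "gpos tx" unfolding tx_def by (rule gpos_ge[OF px c1_pos])
lemma pty: "gpos ty" unfolding ty_def using c0 c1_pos by (intro gpos_ge[OF py]) auto

lemma le_m: "j \<le> m \<Longrightarrow> j \<noteq> l" "j \<le> m \<Longrightarrow> j \<noteq> n" using nm by auto

lemma prod_upto: "prod f {1..l} = prod f {1..m} * f l" for f :: "nat \<Rightarrow> real"
  by simp

lemma ell_tx: "gell n tx = gell n x" and ell_ty: "gell n ty = gell n y"
proof -
  have "(\<Prod>i=1..m. fst tx i * snd tx i) = (\<Prod>i=1..m. fst x i * snd x i)"
       "(\<Prod>i=1..m. fst ty i * snd ty i) = (\<Prod>i=1..m. fst y i * snd y i)"
    by (auto intro!: prod.cong simp: tx_nth ty_nth le_m)
  then show "gell n tx = gell n x" "gell n ty = gell n y"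
    unfolding gell_def l(2) prod_upto tx_nth ty_nth using c1_pos c0 by simp_all
qed

lemma gr_t: "gr j tx ty = gr j x y"
  unfolding gr_def tx_nth ty_nth ..

lemma gs_t: "j \<le> m \<Longrightarrow> gs j tx ty = gs j x y"
  unfolding gs_def by (intro prod.cong refl) (auto simp: tx_nth ty_nth le_m)

lemma gs_l: "gs l tx ty = gs l x y * ((c / c1) / c1)"
  unfolding gs_Suc gs_t[OF order_refl] tx_nth ty_nth by (simp add: mult_ac)

lemma V0_t: "gV n 0 tx ty = gV n 0 x y"
proof -
  have s: "(\<Sum>j=1..n-1. gh n j u v) = (\<Sum>j=1..m. gh n j u v) + gh n l u v" for u v
    unfolding l(2) by simp
  have 1: "(\<Sum>j=1..m. gh n j tx ty) = (\<Sum>j=1..m. gh n j x y)"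
    by (intro sum.cong refl) (auto simp: le_m gh_def ell_tx ell_ty gr_t gs_t tx_nth ty_nth)
  have o: "of_bool (l \<le> n - 2) = (0::real)" using nm by auto
  define G where "G = gell n y * gr l x y"
  have G: "gell n x * gs l x y = G * P / Q"
    using prod_ratio_0[OF px py, of n] posv unfolding G_def gr_def gs_def l(2) by (simp add: field_simps)
  have "gh n l tx ty + (gell n ty * gr (n-1) tx ty * fst tx n + gell n tx * gs (n-1) tx ty / fst tx n)
     = G * (Y1 / (x1 * c1)) + G * P / Q * ((c / c1) / c1) * (x1 * c1 / Y1) + (G * (P / c1) + G * P / Q * ((c / c1) / c1) / (P / c1))"
    unfolding gh_def l(2) gr_t gs_l ell_tx ell_ty tx_nth ty_nth
    by (simp only: o add_0_left mult.assoc[symmetric] G_def[symmetric] G)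
  also have "\<dots> = G * (Y1 + x1 * P) / (x1 * Y1 * Q) * ((Y1 * Q + c * x1) / c1)"
    using posv c1_pos by (simp add: field_simps)
  also have "(Y1 * Q + c * x1) / c1 = Y1 * Q + x1"
  proof -
    have "c1 * (x1 + Y1 * Q) = c * x1 + Y1 * Q" unfolding c1_eq using posv
      by (simp add: add_pos_pos less_imp_neq[symmetric])
    then show ?thesis using c1_pos by (simp add: field_simps)
  qed
  also have "G * (Y1 + x1 * P) / (x1 * Y1 * Q) * (Y1 * Q + x1) = G * (Y1 / x1) + G * P / Q * (x1 / Y1) + (G * P + G * P / Q / P)"
    using posv by (simp add: field_simps)
  also have "\<dots> = gh n l x y + (gell n y * gr (n-1) x y * P + gell n x * gs (n-1) x y / P)"
    unfolding gh_def l(2) by (simp only: o add_0_left G_def[symmetric] G)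
  finally show ?thesis unfolding gV_0_eq[OF n3] s 1 by simp
qed

lemma V_le: "j \<le> m \<Longrightarrow> gV n j tx ty = gV n j x y \<and> gVstar n j tx ty = gVstar n j x y"
proof (induction j)
  case 0
  then show ?case using V0_t gV_0_star[OF px py n3] gV_0_star[OF ptx pty n3] by auto
next
  case (Suc k)
  then have k: "Suc k \<le> n - 2" "Suc k \<noteq> l" "Suc k \<noteq> n" using nm by auto
  have IH: "gV n k tx ty = gV n k x y" "gVstar n k tx ty = gVstar n k x y" using Suc by auto
  show ?case unfolding gV_rec[OF px py k(1)] gVstar_rec[OF px py k(1)] gV_rec[OF ptx pty k(1)] gVstar_rec[OF ptx pty k(1)]
    unfolding IH ell_tx ell_ty tx_nth(3) ty_nth(3) tx_nth(4)[OF k(2,3)] ty_nth(4)[OF k(2,3)] by simp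
qed

abbreviation "d \<equiv> gell n x - gell n y"
abbreviation "K \<equiv> gV n m x y"
abbreviation "Ks \<equiv> gVstar n m x y"
abbreviation "a \<equiv> gV n l x y"
abbreviation "b \<equiv> gVstar n l x y"
abbreviation "w0 \<equiv> gW n m x y"

lemma posw: "a > 0" "b > 0" "K > 0" "Ks > 0" "w0 > 0"
  using gV_pos[OF n3 px py] gVstar_pos[OF n3 px py] gW_pos[OF px py n3] by auto

text \<open>\<open>gV_last\<close> and the two final recursions eliminate d. In the resulting
  subtraction-free form the action produces just the numerators of \<open>c1\<close> and
  \<open>c1'\<close>.\<close>

lemma b_eq: "gVstar n l u v = fst u l * fst v n * snd v l / (fst u l + fst v n * snd v l) *
    (gVstar n m u v / fst v l + gV n m u v / (fst u n * snd u l))" if "gpos u" "gpos v"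
proof -
  define x1 X1 y1 Y1 P Q K Ks d where defs: "x1 = fst u l" "X1 = snd u l" "y1 = fst v l" "Y1 = snd v l"
    "P = fst u n" "Q = fst v n" "K = gV n m u v" "Ks = gVstar n m u v" "d = gell n u - gell n v"
  have pos: "x1 > 0" "X1 > 0" "y1 > 0" "Y1 > 0" "P > 0" "Q > 0" using that by (auto simp: defs)
  have A: "gV n l u v = Y1 / X1 * K + d * (Y1 / x1 + 1 / Q)"
    unfolding defs by (rule gV_rec_last[OF that nm(2,1)])
  have B: "gVstar n l u v = x1 / y1 * Ks - d * (x1 / Y1 + 1 / P)"
    unfolding defs by (rule gVstar_rec_last[OF that nm(2,1)])
  have C: "Q * (Y1 / X1 * K + d * (Y1 / x1 + 1 / Q)) - P * (x1 / y1 * Ks - d * (x1 / Y1 + 1 / P)) = d * (1 - P * Q)"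
    using gV_last[OF that n3] unfolding l(2) A B unfolding defs .
  \<comment> \<open>Again the difference of the two sides is a multiple of the relation
    \<open>C\<close>.\<close>
  have "(x1 / y1 * Ks - d * (x1 / Y1 + 1 / P)) - x1 * Q * Y1 / (x1 + Q * Y1) * (Ks / y1 + K / (P * X1))
     = - x1 / (P * (x1 + Q * Y1)) * (Q * (Y1 / X1 * K + d * (Y1 / x1 + 1 / Q)) - P * (x1 / y1 * Ks - d * (x1 / Y1 + 1 / P)) - d * (1 - P * Q))"
  proof -
    define s where "s = x1 + Q * Y1"
    have "s > 0" unfolding s_def using pos by (simp add: add_pos_pos)
    moreover have x1: "x1 = s - Q * Y1" by (simp add: s_def)
    have "x1 * P * y1 * X1 * Y1 * ((x1 / y1 * Ks - d * (x1 / Y1 + 1 / P)) * s - x1 * Q * Y1 * (Ks / y1 + K / (P * X1)))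
     = x1 * P * y1 * X1 * Y1 * (- x1 / P * (Q * (Y1 / X1 * K + d * (Y1 / x1 + 1 / Q)) - P * (x1 / y1 * Ks - d * (x1 / Y1 + 1 / P)) - d * (1 - P * Q)))"
      unfolding s_def using pos by (simp add: field_simps)
    then have "(x1 / y1 * Ks - d * (x1 / Y1 + 1 / P)) * s - x1 * Q * Y1 * (Ks / y1 + K / (P * X1))
     = - x1 / P * (Q * (Y1 / X1 * K + d * (Y1 / x1 + 1 / Q)) - P * (x1 / y1 * Ks - d * (x1 / Y1 + 1 / P)) - d * (1 - P * Q))"
      by (rule mult_left_cancel[THEN iffD1, rotated]) (use pos in auto)
    then have "((x1 / y1 * Ks - d * (x1 / Y1 + 1 / P)) * s - x1 * Q * Y1 * (Ks / y1 + K / (P * X1))) / s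
     = - x1 / P * (Q * (Y1 / X1 * K + d * (Y1 / x1 + 1 / Q)) - P * (x1 / y1 * Ks - d * (x1 / Y1 + 1 / P)) - d * (1 - P * Q)) / s"
      by simp
    then show ?thesis unfolding s_def[symmetric] using \<open>s > 0\<close> by (simp add: diff_divide_distrib)
  qed
  then have "gVstar n l u v = x1 * Q * Y1 / (x1 + Q * Y1) * (Ks / y1 + K / (P * X1))"
    unfolding C B by simp
  then show ?thesis unfolding defs .
qed

abbreviation "x' \<equiv> gRx n x y"
abbreviation "y' \<equiv> gRy n x y"

lemma w1_eq: "gW n l u v = gV n l u v * gVstar n l u v"
  using nm by (simp add: gW_def)

lemma l1: "1 \<le> l" "l \<le> n - 1" "l - 1 = m" using nm by auto

lemma R_nth: "fst x' l = x1 * Ks / b" "snd x' l = X1 * Ks * a / w0" "fst y' l = y1 * K * b / w0"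
   "snd y' l = Y1 * K / a" "fst x' n = P * b / a" "fst y' n = Q * a / b"
  using posw unfolding gRx_nth[OF l1(1,2)] gRx_n l(2) w1_eq l1(3) by simp_all

definition "c1' = gleft n l c y' x'"

lemma phi': "gphi n l y' = y1 * K * b / w0" and eps': "geps n l x' = X1 * Ks * P * b / w0"
  unfolding gphi_def geps_def if_P[OF l(1)] R_nth using posw by simp_all

lemma c1'_eq: "c1' = (c * (y1 * K) + X1 * Ks * P) / (y1 * K + X1 * Ks * P)"
proof -
  have "c * (y1 * K * b / w0) + X1 * Ks * P * b / w0 = (b / w0) * (c * (y1 * K) + X1 * Ks * P)"
    "y1 * K * b / w0 + X1 * Ks * P * b / w0 = (b / w0) * (y1 * K + X1 * Ks * P)"
    using posw by (simp_all add: field_simps)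
  then show ?thesis unfolding c1'_def gleft_def phi' eps' using posw by simp
qed

lemma p': "gpos x'" "gpos y'" using gpos_gR[OF px py n3] .

lemma c1'_pos: "c1' > 0" unfolding c1'_def by (rule gleft_pos[OF p'(2,1) c0])

lemma b'_eq: "gVstar n l tx ty = b * c1 * c1' / c"
proof -
  have V: "gV n m tx ty = K" "gVstar n m tx ty = Ks" using V_le[of m] by auto
  define s1 s2 where s: "s1 = x1 + Y1 * Q" "s2 = y1 * K + X1 * Ks * P"
  have sp: "s1 > 0" "s2 > 0" unfolding s using posv posw by (simp_all add: add_pos_pos)
  have e1: "c * x1 + Y1 * Q = c1 * s1" using c1_eq sp(1) by (simp add: s)
  have e2: "c * (y1 * K) + X1 * Ks * P = c1' * s2" using c1'_eq sp(2) by (simp add: s)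
  have 1: "x1 * c1 + Q / (c / c1) * Y1 = c1 / c * (c1 * s1)"
    unfolding e1[symmetric] using c1_pos c0 by (simp add: field_simps)
  have 2: "Ks / (y1 * (c / c1)) + K / (P / c1 * X1) = c1 / (c * y1 * P * X1) * (c1' * s2)"
    unfolding e2[symmetric] using c1_pos c0 posv by (simp add: field_simps)
  have 3: "Ks / y1 + K / (P * X1) = s2 / (y1 * P * X1)" unfolding s using posv by (simp add: field_simps)
  have 4: "x1 + Q * Y1 = s1" by (simp add: s mult.commute)
  show ?thesis unfolding b_eq[OF ptx pty] b_eq[OF px py] V tx_nth ty_nth 1 2 3 4
    using c1_pos c1'_pos c0 posv sp by (simp add: mult_ac)
qed

text \<open>The choice of \<open>c1\<close> is equivalent to the invariance of Y_{n-1} / x_{n-1} + 1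
  / y_n, the inhomogeneous term of the last recursion. At this node only V^*_{n-1} and, through it,
  W_{n-1} change.\<close>

lemma a'_eq: "gV n l tx ty = a"
proof -
  have V: "gV n m tx ty = K" using V_le[of m] by auto
  have s: "x1 + Y1 * Q > 0" using posv by (simp add: add_pos_pos)
  have "Y1 / (x1 * c1) + 1 / (Q / (c / c1)) = (c * x1 + Y1 * Q) / (c1 * (x1 * Q))"
    using posv c1_pos c0 by (simp add: field_simps)
  also have "c * x1 + Y1 * Q = c1 * (x1 + Y1 * Q)" using c1_eq s by simp
  also have "c1 * (x1 + Y1 * Q) / (c1 * (x1 * Q)) = Y1 / x1 + 1 / Q"
    using posv c1_pos by (simp add: field_simps)
  finally show ?thesis
    unfolding gV_rec_last[OF ptx pty nm(2,1)] gV_rec_last[OF px py nm(2,1)] V ell_tx ell_ty tx_nth ty_nth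
    by simp
qed

lemma W_le: "j \<le> m \<Longrightarrow> gW n j tx ty = gW n j x y"
  using V_le[of j] gW_eq[OF px py n3, of j] gW_eq[OF ptx pty n3, of j] unfolding l(3) ell_tx ell_ty by simp

lemma other:
  assumes "j \<noteq> l" "j \<noteq> n"
  shows "fst (gRx n tx ty) j = fst x' j \<and> snd (gRx n tx ty) j = snd x' j \<and>
    fst (gRy n tx ty) j = fst y' j \<and> snd (gRy n tx ty) j = snd y' j"
proof (cases "1 \<le> j \<and> j \<le> n - 1")
  case True
  then have j: "j - 1 \<le> m" "j \<le> m" "1 \<le> j" "j \<le> n - 1" using assms nm by auto
  note V = V_le[OF j(1), THEN conjunct1] V_le[OF j(1), THEN conjunct2] V_le[OF j(2), THEN conjunct1] V_le[OF j(2), THEN conjunct2]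
  show ?thesis
    unfolding gRx_nth[OF j(3,4)] V W_le[OF j(1)] W_le[OF j(2)]
      tx_nth(3) tx_nth(4)[OF assms] ty_nth(3) ty_nth(4)[OF assms] by simp
next
  case False
  then have "fst (gRx n u v) j = 1" "snd (gRx n u v) j = 1" "fst (gRy n u v) j = 1" "snd (gRy n u v) j = 1" for u v
    using assms unfolding gRx_def gRy_def by auto
  then show ?thesis by simp
qed

lemma snd_n: "snd (gRx n u v) n = 1" "snd (gRy n u v) n = 1"
  using nm unfolding gRx_def gRy_def by auto

lemma R_nth': "fst (gRx n tx ty) l = fst x' l * (c / c1')" "snd (gRx n tx ty) l = snd x' l"
   "fst (gRy n tx ty) l = fst y' l * c1'"
   "snd (gRy n tx ty) l = snd y' l" "fst (gRx n tx ty) n = fst x' n / (c / c1')" "fst (gRy n tx ty) n = fst y' n / c1'"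
  unfolding R_nth
  using posw c1_pos c1'_pos c0 V_le[OF order_refl] W_le[OF order_refl]
  unfolding gRx_nth[OF l1(1,2)] gRx_n l(2) w1_eq l1(3) a'_eq b'_eq tx_nth ty_nth by (simp_all add: mult_ac)

lemma commute_y: "gRy n tx ty = ge n l c1' y'"
  unfolding ge_def if_P[OF l(1)]
proof (rule prod_eqI; rule ext)
  fix j
  show "fst (gRy n tx ty) j = fst ((fst y')(l := fst y' l * c1', n := fst y' n / c1'), snd y') j"
    using other[of j] R_nth' l(4) by (cases "j = l"; cases "j = n") auto
  show "snd (gRy n tx ty) j = snd ((fst y')(l := fst y' l * c1', n := fst y' n / c1'), snd y') j"
    using other[of j] R_nth' snd_n by (cases "j = l"; cases "j = n") auto
qed

lemma commute_x: "gRx n tx ty = ge n l (c / c1') x'"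
  unfolding ge_def if_P[OF l(1)]
proof (rule prod_eqI; rule ext)
  fix j
  show "fst (gRx n tx ty) j = fst ((fst x')(l := fst x' l * (c / c1'), n := fst x' n / (c / c1')), snd x') j"
    using other[of j] R_nth' l(4) by (cases "j = l"; cases "j = n") auto
  show "snd (gRx n tx ty) j = snd ((fst x')(l := fst x' l * (c / c1'), n := fst x' n / (c / c1')), snd x') j"
    using other[of j] R_nth' snd_n by (cases "j = l"; cases "j = n") auto
qed

lemma eps_pair: "geps n l y' * (gphi n l y' + geps n l x') / gphi n l y'
   = geps n l x * (gphi n l x + geps n l y) / gphi n l x"
proof -
  define s1 s2 where s: "s1 = x1 + Y1 * Q" "s2 = y1 * K + X1 * Ks * P"
  have sp: "s1 > 0" "s2 > 0" unfolding s using posv posw by (simp_all add: add_pos_pos)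
  have b: "b = x1 * Q * Y1 / s1 * (s2 / (y1 * P * X1))"
  proof -
    have 3: "Ks / y1 + K / (P * X1) = s2 / (y1 * P * X1)" unfolding s using posv by (simp add: field_simps)
    have 4: "x1 + Q * Y1 = s1" by (simp add: s mult.commute)
    show ?thesis unfolding b_eq[OF px py] 3 4 ..
  qed
  have "geps n l y' = Y1 * Q * K / b" unfolding geps_def if_P[OF l(1)] R_nth using posw by simp
  moreover have "gphi n l y' + geps n l x' = s2 * b / w0"
    unfolding phi' eps' s using posw by (simp add: field_simps)
  ultimately have "geps n l y' * (gphi n l y' + geps n l x') / gphi n l y' = Y1 * Q * s2 / (y1 * b)"
    unfolding phi' using posw posv by simp
  also have "\<dots> = X1 * P * s1 / x1" unfolding b using posv sp by simp
  also have "\<dots> = geps n l x * (gphi n l x + geps n l y) / gphi n l x"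
    unfolding geps_def gphi_def if_P[OF l(1)] s by simp
  finally show ?thesis .
qed

end

lemma geometric_R_commute:
  assumes "n \<ge> 3" "1 \<le> i" "i \<le> n - 1" "gpos x" "gpos y" "c > 0"
    and "c1 = gleft n i c x y" "c1' = gleft n i c (gRy n x y) (gRx n x y)"
  shows "gRy n (ge n i c1 x) (ge n i (c / c1) y) = ge n i c1' (gRy n x y)"
    and "gRx n (ge n i c1 x) (ge n i (c / c1) y) = ge n i (c / c1') (gRx n x y)"
    and "gV n 0 (ge n i c1 x) (ge n i (c / c1) y) = gV n 0 x y"
    and "geps n i (gRy n x y) * (gphi n i (gRy n x y) + geps n i (gRx n x y)) / gphi n i (gRy n x y)
       = geps n i x * (gphi n i x + geps n i y) / gphi n i x"
proof -
  have "gRy n (ge n i c1 x) (ge n i (c / c1) y) = ge n i c1' (gRy n x y) \<and>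
    gRx n (ge n i c1 x) (ge n i (c / c1) y) = ge n i (c / c1') (gRx n x y) \<and>
    gV n 0 (ge n i c1 x) (ge n i (c / c1) y) = gV n 0 x y \<and>
    geps n i (gRy n x y) * (gphi n i (gRy n x y) + geps n i (gRx n x y)) / gphi n i (gRy n x y)
       = geps n i x * (gphi n i x + geps n i y) / gphi n i x"
  proof (cases "i = n - 1")
    case True
    then have i: "i = Suc (n - 2)" using assms(1) by auto
    interpret E: pair_e_last n "n - 2" c x y using assms by unfold_locales auto
    show ?thesis
      using E.commute_y E.commute_x E.V0_t E.eps_pair
      unfolding E.c1'_def E.tx_def E.ty_def E.c1_def assms(7,8) i by blast
  next
    case False
    interpret E: pair_e n i c x y using assms False by unfold_locales auto
    show ?thesis
      using E.commute_y E.commute_x E.V0_t E.eps_pair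
      unfolding E.c1'_def E.tx_def E.ty_def E.c1_def assms(7,8) by blast
  qed
  then show "gRy n (ge n i c1 x) (ge n i (c / c1) y) = ge n i c1' (gRy n x y)"
    "gRx n (ge n i c1 x) (ge n i (c / c1) y) = ge n i (c / c1') (gRx n x y)"
    "gV n 0 (ge n i c1 x) (ge n i (c / c1) y) = gV n 0 x y"
    "geps n i (gRy n x y) * (gphi n i (gRy n x y) + geps n i (gRx n x y)) / gphi n i (gRy n x y)
       = geps n i x * (gphi n i x + geps n i y) / gphi n i x" by blast+
qed

text \<open>The automorphism exchanging \<open>\<zeta>\<^sub>n\<close> and its barred partner, in the coordinates \<open>x\<close>.\<close>

definition gsigman :: "nat \<Rightarrow> gcoords \<Rightarrow> gcoords" where
  "gsigman n x = ((fst x)(n - 1 := fst x (n - 1) * fst x n, n := 1 / fst x n),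
                  (snd x)(n - 1 := snd x (n - 1) * fst x n))"

lemma gpos_gsigman: "gpos x \<Longrightarrow> gpos (gsigman n x)"
  unfolding gpos_def gsigman_def by auto

text \<open>Below n - 1 the recursion does not see the modified entries, once V_0 is known to be
  invariant. At n - 1 it yields the expression that \<open>gV_last\<close> gives for
  V^*_{n-1}.\<close>

lemma gsigman_gV:
  assumes "n \<ge> 3" "gpos x" "gpos y"
  shows "i \<le> n - 2 \<Longrightarrow> gV n i (gsigman n x) (gsigman n y) = gV n i x y"
    and "gV n (n - 1) (gsigman n x) (gsigman n y) = gVstar n (n - 1) x y"
proof -
  define m where "m = n - 2"
  have nm: "n = Suc (Suc m)" "m \<ge> 1" "n - 1 = Suc m" "n - 2 = m" "Suc m \<noteq> n" using assms(1) by (auto simp: m_def)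
  let ?l = "Suc m"
  let ?u = "gsigman n x" and ?v = "gsigman n y"
  note p = gpos_gsigman[OF assms(2), of n] gpos_gsigman[OF assms(3), of n]
  define P Q where PQ: "P = fst x n" "Q = fst y n"
  have pos: "P > 0" "Q > 0" "fst x ?l > 0" "snd x ?l > 0" "fst y ?l > 0" "snd y ?l > 0"
    using assms by (auto simp: PQ)
  have u: "fst ?u ?l = fst x ?l * P" "snd ?u ?l = snd x ?l * P" "fst ?u n = 1 / P"
     "j \<noteq> ?l \<Longrightarrow> j \<noteq> n \<Longrightarrow> fst ?u j = fst x j" "j \<noteq> ?l \<Longrightarrow> snd ?u j = snd x j" for j
    using nm(5) unfolding gsigman_def nm(3) PQ by auto
  have v: "fst ?v ?l = fst y ?l * Q" "snd ?v ?l = snd y ?l * Q" "fst ?v n = 1 / Q"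
     "j \<noteq> ?l \<Longrightarrow> j \<noteq> n \<Longrightarrow> fst ?v j = fst y j" "j \<noteq> ?l \<Longrightarrow> snd ?v j = snd y j" for j
    using nm(5) unfolding gsigman_def nm(3) PQ by auto
  have le: "j \<le> m \<Longrightarrow> j \<noteq> ?l" "j \<le> m \<Longrightarrow> j \<noteq> n" for j using nm by auto
  have pr: "prod f {1..?l} = prod f {1..m} * f ?l" for f :: "nat \<Rightarrow> real" by simp
  have "(\<Prod>i=1..m. fst ?u i * snd ?u i) = (\<Prod>i=1..m. fst x i * snd x i)"
    by (intro prod.cong refl) (auto simp: u le)
  moreover have "(\<Prod>i=1..m. fst ?v i * snd ?v i) = (\<Prod>i=1..m. fst y i * snd y i)"
    by (intro prod.cong refl) (auto simp: v le)
  ultimately have ell: "gell n ?u = gell n x" "gell n ?v = gell n y"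
    unfolding gell_def nm(3) pr u v PQ[symmetric] using pos by simp_all
  have gr: "gr j ?u ?v = gr j x y" "gs j ?u ?v = gs j x y" if "j \<le> m" for j
    using that by (auto simp: gr_def gs_def u v le intro!: prod.cong)
  have grl: "gr ?l ?u ?v = gr ?l x y * (P / Q)" "gs ?l ?u ?v = gs ?l x y * (Q / P)"
    unfolding gr_Suc gs_Suc gr[OF order_refl] u v by simp_all
  have o: "of_bool (?l \<le> m) = (0::real)" by simp
  define G where "G = gell n y * gr ?l x y"
  have G: "gell n x * gs ?l x y = G * P / Q"
    using prod_ratio_0[OF assms(2,3), of n] pos unfolding G_def gr_def gs_def nm(3) PQ by (simp add: field_simps)
  have s: "(\<Sum>j=1..?l. gh n j u v) = (\<Sum>j=1..m. gh n j u v) + gh n ?l u v" for u v by simp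
  have 1: "(\<Sum>j=1..m. gh n j ?u ?v) = (\<Sum>j=1..m. gh n j x y)"
    by (intro sum.cong refl) (auto simp: gh_def ell gr u v le)
  have 2: "gh n ?l ?u ?v = gh n ?l x y"
    unfolding gh_def nm(4) o grl ell u v using pos by simp
  have V0: "gV n 0 ?u ?v = gV n 0 x y"
    unfolding gV_0_eq[OF assms(1)] nm(3) s 1 2 grl ell u v PQ[symmetric]
    by (simp only: mult.assoc[symmetric] G_def[symmetric] G) (use pos in \<open>simp add: field_simps\<close>)
  have V: "gV n j ?u ?v = gV n j x y" if "j \<le> m" for j
    using that
  proof (induction j)
    case 0
    then show ?case using V0 by simp
  next
    case (Suc k)
    then have k: "Suc k \<le> n - 2" "Suc k \<noteq> ?l" "Suc k \<noteq> n" using nm by auto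
    show ?case using Suc unfolding gV_rec[OF assms(2,3) k(1)] gV_rec[OF p k(1)] ell u(4,5)[OF k(2)] v(4,5)[OF k(2)]
      by (simp add: u(4)[OF k(2,3)])
  qed
  then show "i \<le> n - 2 \<Longrightarrow> gV n i ?u ?v = gV n i x y" unfolding nm(4) by simp
  define d where "d = gell n x - gell n y"
  have A: "gV n ?l ?u ?v = (snd y ?l * Q) / (snd x ?l * P) * gV n m x y + d * ((snd y ?l * Q) / (fst x ?l * P) + 1 / (1 / Q))"
    unfolding gV_rec_last[OF p nm(2,1)] ell u v V[OF order_refl] d_def ..
  have B: "gV n ?l x y = snd y ?l / snd x ?l * gV n m x y + d * (snd y ?l / fst x ?l + 1 / Q)"
    unfolding gV_rec_last[OF assms(2,3) nm(2,1)] d_def PQ ..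
  have C: "Q * gV n ?l x y - P * gVstar n ?l x y = d * (1 - P * Q)"
    using gV_last[OF assms(2,3,1)] unfolding d_def PQ nm(3) .
  then have "gVstar n ?l x y = (Q * gV n ?l x y - d * (1 - P * Q)) / P"
    using pos by (simp add: field_simps)
  also have "\<dots> = gV n ?l ?u ?v" unfolding A B using pos by (simp add: field_simps)
  finally show "gV n (n - 1) ?u ?v = gVstar n (n - 1) x y" unfolding nm(3) ..
qed

subsection \<open>Tropicalization\<close>

text \<open>Positivity is demanded at every t > 1 and not just eventually, so that identities proved
  under \<open>gpos\<close> can be applied at each such t.\<close>

definition trop :: "(real \<Rightarrow> real) \<Rightarrow> int \<Rightarrow> bool" where
  "trop F f \<longleftrightarrow> (\<forall>t>1. F t > 0) \<and> ((\<lambda>t. ln (F t) / ln t) \<longlongrightarrow> of_int f) at_top"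

lemma trop_pos: "trop F f \<Longrightarrow> t > 1 \<Longrightarrow> F t > 0"
  by (simp add: trop_def)

lemma trop_cong:
  assumes "trop F f" "\<And>t. t > 1 \<Longrightarrow> F t = G t"
  shows "trop G f"
proof -
  have "eventually (\<lambda>t. ln (F t) / ln t = ln (G t) / ln t) at_top"
    using eventually_gt_at_top[of 1] by eventually_elim (simp add: assms(2))
  from tendsto_cong[OF this] show ?thesis using assms unfolding trop_def by simp
qed

lemma trop_unique: "trop F f \<Longrightarrow> trop F g \<Longrightarrow> f = g"
  unfolding trop_def using tendsto_unique[of at_top] by (metis of_int_eq_iff trivial_limit_at_top_linorder)

lemma trop_one [simp]: "trop (\<lambda>t. 1) 0"
  by (simp add: trop_def)

lemma trop_powr [simp]: "trop (\<lambda>t. t powr of_int k) k"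
proof -
  have "eventually (\<lambda>t::real. ln (t powr of_int k) / ln t = of_int k) at_top"
    using eventually_gt_at_top[of "1::real"] by eventually_elim (simp add: ln_powr)
  then have "((\<lambda>t::real. ln (t powr of_int k) / ln t) \<longlongrightarrow> (of_int k :: real)) at_top"
    by (rule tendsto_eventually)
  then show ?thesis unfolding trop_def by auto
qed

lemma trop_mult: "trop F f \<Longrightarrow> trop G g \<Longrightarrow> trop (\<lambda>t. F t * G t) (f + g)"
proof -
  assume a: "trop F f" "trop G g"
  have "((\<lambda>t. ln (F t) / ln t + ln (G t) / ln t) \<longlongrightarrow> of_int f + of_int g) at_top"
    using a by (auto simp: trop_def intro!: tendsto_add)
  moreover have "eventually (\<lambda>t. ln (F t) / ln t + ln (G t) / ln t = ln (F t * G t) / ln t) at_top"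
    using eventually_gt_at_top[of 1]
    by eventually_elim (use a in \<open>simp add: trop_def ln_mult add_divide_distrib less_imp_neq[symmetric]\<close>)
  ultimately show ?thesis using a by (auto simp: trop_def dest: tendsto_cong[THEN iffD1])
qed

lemma trop_inverse: "trop F f \<Longrightarrow> trop (\<lambda>t. inverse (F t)) (- f)"
proof -
  assume a: "trop F f"
  have "((\<lambda>t. - (ln (F t) / ln t)) \<longlongrightarrow> - of_int f) at_top"
    using a by (auto simp: trop_def intro!: tendsto_minus)
  moreover have "eventually (\<lambda>t. - (ln (F t) / ln t) = ln (inverse (F t)) / ln t) at_top"
    using eventually_gt_at_top[of 1]
    by eventually_elim (use a in \<open>simp add: trop_def ln_inverse\<close>)
  ultimately show ?thesis using a by (auto simp: trop_def dest: tendsto_cong[THEN iffD1])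
qed

lemma trop_divide: "trop F f \<Longrightarrow> trop G g \<Longrightarrow> trop (\<lambda>t. F t / G t) (f - g)"
  using trop_mult[OF _ trop_inverse, of F f G g] by (simp add: divide_inverse)

text \<open>The sum lies between its larger summand and twice that, and ln 2 / ln t tends to
  0.\<close>

lemma trop_add:
  assumes "trop F f" "trop G g"
  shows "trop (\<lambda>t. F t + G t) (max f g)"
proof -
  let ?M = "\<lambda>t. max (ln (F t) / ln t) (ln (G t) / ln t)"
  have M: "(?M \<longlongrightarrow> of_int (max f g)) at_top"
    using assms by (auto simp: trop_def of_int_max intro!: tendsto_max)
  have "((\<lambda>t. ln 2 / ln t) \<longlongrightarrow> 0) (at_top :: real filter)"
    by (intro real_tendsto_divide_at_top[OF tendsto_const] ln_at_top)
  from tendsto_add[OF M this] have M2: "((\<lambda>t. ?M t + ln 2 / ln t) \<longlongrightarrow> of_int (max f g)) at_top" by simp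
  have "eventually (\<lambda>t. ?M t \<le> ln (F t + G t) / ln t) at_top"
    using eventually_gt_at_top[of 1]
  proof eventually_elim
    case (elim t)
    then have "F t > 0" "G t > 0" "ln t > 0" using assms by (auto simp: trop_def)
    then show ?case by (auto intro!: divide_right_mono)
  qed
  moreover have "eventually (\<lambda>t. ln (F t + G t) / ln t \<le> ?M t + ln 2 / ln t) at_top"
    using eventually_gt_at_top[of 1]
  proof eventually_elim
    case (elim t)
    then have p: "F t > 0" "G t > 0" "ln t > 0" using assms by (auto simp: trop_def)
    have "ln (F t + G t) \<le> ln (2 * max (F t) (G t))" using p by (subst ln_le_cancel_iff) auto
    also have "\<dots> = ln 2 + max (ln (F t)) (ln (G t))" using p by (auto simp: ln_mult max_def)
    finally have "ln (F t + G t) / ln t \<le> (ln 2 + max (ln (F t)) (ln (G t))) / ln t"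
      using p by (simp add: divide_right_mono)
    also have "\<dots> = ?M t + ln 2 / ln t" using p by (auto simp: add_divide_distrib max_def divide_le_cancel)
    finally show ?case .
  qed
  ultimately have "((\<lambda>t. ln (F t + G t) / ln t) \<longlongrightarrow> of_int (max f g)) at_top"
    by (rule tendsto_sandwich[OF _ _ M M2])
  then show ?thesis using assms by (auto simp: trop_def add_pos_pos)
qed

lemma trop_prod:
  assumes "\<And>j. j \<in> S \<Longrightarrow> trop (F j) (f j)"
  shows "trop (\<lambda>t. \<Prod>j\<in>S. F j t) (\<Sum>j\<in>S. f j)"
  using assms
proof (induction S rule: infinite_finite_induct)
  case (insert a S)
  then show ?case using trop_mult[of "F a" "f a"] by simp
qed auto

lemma trop_sum:
  assumes "finite S" "S \<noteq> {}" "\<And>j. j \<in> S \<Longrightarrow> trop (F j) (f j)"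
  shows "trop (\<lambda>t. \<Sum>j\<in>S. F j t) (Max (f ` S))"
  using assms
proof (induction S rule: finite_ne_induct)
  case (insert a S)
  then show ?case using trop_add[of "F a" "f a"] by simp
qed auto

lemma trop_if: "(b \<Longrightarrow> trop F f) \<Longrightarrow> (\<not> b \<Longrightarrow> trop G g) \<Longrightarrow> trop (\<lambda>t. if b then F t else G t) (if b then f else g)"
  by auto

definition tropc :: "(real \<Rightarrow> gcoords) \<Rightarrow> coords \<Rightarrow> bool" where
  "tropc F u \<longleftrightarrow> (\<forall>i. trop (\<lambda>t. fst (F t) i) (fst u i) \<and> trop (\<lambda>t. snd (F t) i) (snd u i))"

lemma tropc_fst: "tropc F u \<Longrightarrow> trop (\<lambda>t. fst (F t) i) (fst u i)"
  and tropc_snd: "tropc F u \<Longrightarrow> trop (\<lambda>t. snd (F t) i) (snd u i)"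
  by (auto simp: tropc_def)

lemma tropc_gpos: "tropc F u \<Longrightarrow> t > 1 \<Longrightarrow> gpos (F t)"
  unfolding gpos_def
  by (intro allI conjI) (rule trop_pos[OF tropc_fst] trop_pos[OF tropc_snd], assumption+)+

lemma tropc_cong: "tropc F u \<Longrightarrow> (\<And>t. t > 1 \<Longrightarrow> F t = G t) \<Longrightarrow> tropc G u"
  unfolding tropc_def by (auto intro: trop_cong)

lemma tropc_unique: "tropc F u \<Longrightarrow> tropc F v \<Longrightarrow> u = v"
  unfolding tropc_def by (auto intro!: prod_eqI ext dest: trop_unique)

text \<open>A curve through the positive points with limit \<open>u\<close>; since it exists for
  every integer point, identities of rational functions pass to all integer arguments.\<close>

definition powc :: "coords \<Rightarrow> real \<Rightarrow> gcoords" where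
  "powc u t = (\<lambda>i. t powr of_int (fst u i), \<lambda>i. t powr of_int (snd u i))"

lemma tropc_powc [simp]: "tropc (powc u) u"
  by (simp add: tropc_def powc_def)

definition sigman :: "nat \<Rightarrow> coords \<Rightarrow> coords" where
  "sigman n x = ((fst x)(n - 1 := fst x (n - 1) + fst x n, n := - fst x n),
                  (snd x)(n - 1 := snd x (n - 1) + fst x n))"

text \<open>The usual phi_i of the crystal. At the last node the coordinate x_{n-1} already counts
  the letter n - 1 together with the barred letter n.\<close>

definition phi :: "nat \<Rightarrow> nat \<Rightarrow> coords \<Rightarrow> int" where
  "phi n i x = (if i = n - 1 then fst x i else fst x i + max 0 (snd x (i+1) - fst x (i+1)))"

definition eps :: "nat \<Rightarrow> nat \<Rightarrow> coords \<Rightarrow> int" where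
  "eps n i x = (if i = n - 1 then snd x i + fst x n else snd x i + max 0 (fst x (i+1) - snd x (i+1)))"

definition pxi :: "nat \<Rightarrow> int \<Rightarrow> coords \<Rightarrow> int" where
  "pxi i c x = max (c + snd x (i+1)) (fst x (i+1)) - max (snd x (i+1)) (fst x (i+1))"

definition pe :: "nat \<Rightarrow> nat \<Rightarrow> int \<Rightarrow> coords \<Rightarrow> coords" where
  "pe n i c x =
    (if i = n - 1 then ((fst x)(i := fst x i + c, n := fst x n - c), snd x)
     else ((fst x)(i := fst x i + (c - pxi i c x), i+1 := fst x (i+1) - (c - pxi i c x)),
           (snd x)(i := snd x i - pxi i c x, i+1 := snd x (i+1) + pxi i c x)))"

definition pleft :: "nat \<Rightarrow> nat \<Rightarrow> int \<Rightarrow> coords \<Rightarrow> coords \<Rightarrow> int" where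
  "pleft n i c x y = max (c + phi n i x) (eps n i y) - max (phi n i x) (eps n i y)"

lemmas trop_intros = trop_mult trop_divide trop_add trop_prod trop_one tropc_fst tropc_snd

lemma trop_fun_upd:
  assumes "\<And>j. trop (\<lambda>t. F t j) (f j)" "trop G g"
  shows "trop (\<lambda>t. ((F t)(i := G t)) j) ((f(i := g)) j)"
  using assms by (cases "j = i") auto

context
  fixes F u
  assumes F: "tropc F u"
begin

lemma tropc_gsigma1: "tropc (\<lambda>t. gsigma1 (F t)) (sigma1 u)"
  using F unfolding tropc_def gsigma1_def sigma1_def by auto

lemma tropc_gstar: "tropc (\<lambda>t. gstar n (F t)) (star n u)"
  using F unfolding tropc_def gstar_def star_def by auto

lemma tropc_gsigman: "tropc (\<lambda>t. gsigman n (F t)) (sigman n u)"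
  unfolding tropc_def gsigman_def sigman_def fst_conv snd_conv
  using trop_divide[OF trop_one tropc_fst[OF F, of n]]
  by (intro allI conjI trop_fun_upd) (auto intro!: trop_intros F)

lemma trop_gell: "trop (\<lambda>t. gell n (F t)) (ell n u)"
  unfolding gell_def ell_def by (intro trop_intros F)

lemma trop_gphi: "trop (\<lambda>t. gphi n i (F t)) (phi n i u)"
  unfolding gphi_def phi_def by (intro trop_if trop_intros F)

lemma trop_geps: "trop (\<lambda>t. geps n i (F t)) (eps n i u)"
  unfolding geps_def eps_def by (intro trop_if trop_intros F)

lemma trop_gxi: "trop C c \<Longrightarrow> trop (\<lambda>t. gxi i (C t) (F t)) (pxi i c u)"
  unfolding gxi_def pxi_def by (intro trop_intros F)

lemma tropc_ge: "trop C c \<Longrightarrow> tropc (\<lambda>t. ge n i (C t) (F t)) (pe n i c u)"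
proof (cases "i = n - 1")
  case True
  assume C: "trop C c"
  show ?thesis unfolding tropc_def ge_def pe_def if_P[OF True] fst_conv snd_conv
    by (intro allI conjI trop_fun_upd trop_intros C F)
next
  case False
  assume C: "trop C c"
  show ?thesis unfolding tropc_def ge_def pe_def if_not_P[OF False] fst_conv snd_conv
    by (intro allI conjI trop_fun_upd trop_intros trop_gxi C F)
qed

end

context
  fixes F G u v
  assumes F: "tropc F u" and G: "tropc G v"
begin

lemma trop_gleft: "trop C c \<Longrightarrow> trop (\<lambda>t. gleft n i (C t) (F t) (G t)) (pleft n i c u v)"
  unfolding gleft_def pleft_def
  by (rule trop_divide[OF trop_add[OF trop_mult[OF _ trop_gphi[OF F]] trop_geps[OF G]]
        trop_add[OF trop_gphi[OF F] trop_geps[OF G]]])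

lemma trop_gtheta: "trop (\<lambda>t. gtheta n i j (F t) (G t)) (theta n i j u v)"
  unfolding gtheta_def theta_def by (intro trop_if trop_intros trop_gell F G)

lemma trop_gtheta': "trop (\<lambda>t. gtheta' n i j (F t) (G t)) (theta' n i j u v)"
  unfolding gtheta'_def theta'_def by (intro trop_if trop_intros trop_gell F G)

text \<open>\<open>eta\<close> tests j \<le> i first and \<open>geta\<close> tests j \<le> n - 1
  first; the bound on i makes the cases agree at j = n.\<close>

lemma trop_geta:
  assumes "i \<le> n - 1"
  shows "trop (\<lambda>t. geta n i j (F t) (G t)) (eta n i j u v)"
proof (cases "j \<le> n - 1")
  case True
  have "eta n i j u v = theta n i j u v + (snd v j - fst u j)"
    using True by (simp add: eta_def theta_def)
  then show ?thesis unfolding geta_def if_P[OF True]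
    using trop_mult[OF trop_gtheta[of n i j] trop_divide[OF tropc_snd[OF G, of j] tropc_fst[OF F, of j]]] by simp
next
  case False
  have "eta n i j u v = ell n v + (\<Sum>k=i+1..n-1. snd u k - snd v k) + fst u n"
    using False assms by (simp add: eta_def)
  then show ?thesis unfolding geta_def if_not_P[OF False]
    by (simp only:) (intro trop_intros trop_gell F G)
qed

lemma trop_geta': "trop (\<lambda>t. geta' n i j (F t) (G t)) (eta' n i j u v)"
proof (cases "j \<le> n - 1")
  case True
  have "eta' n i j u v = theta' n i j u v + (fst u j - snd v j)"
    using True by (simp add: eta'_def theta'_def)
  then show ?thesis unfolding geta'_def if_P[OF True]
    using trop_mult[OF trop_gtheta'[of n i j] trop_divide[OF tropc_fst[OF F, of j] tropc_snd[OF G, of j]]] by simp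
next
  case False
  have "eta' n i j u v = (if i = n - 1 then ell n u - ell n v else 0) + theta' n i (n - 1) u v - fst u n"
    using False by (simp add: eta'_def theta'_def)
  then show ?thesis unfolding geta'_def if_not_P[OF False]
    by (simp only:) (intro trop_if trop_intros trop_gtheta' trop_gell F G)
qed

end

lemma Max_Un4:
  fixes A B C D :: "int set"
  assumes "finite A" "finite B" "finite C" "finite D" "A \<noteq> {}" "B \<noteq> {}" "C \<noteq> {}" "D \<noteq> {}"
  shows "Max (A \<union> B \<union> C \<union> D) = max (max (Max A) (Max B)) (max (Max C) (Max D))"
proof -
  have "Max (A \<union> B \<union> C \<union> D) = max (max (max (Max A) (Max B)) (Max C)) (Max D)"
    using assms by (simp add: Max_Un)
  then show ?thesis by linarith
qed

lemma trop_gV: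
  assumes "n \<ge> 3" "i \<le> n - 1" and F: "tropc F u" and G: "tropc G v"
  shows "trop (\<lambda>t. gV n i (F t) (G t)) (V n i u v)"
proof -
  let ?I = "{1..n-2}" and ?J = "{1..n}"
  have S: "?I \<noteq> {}" "?J \<noteq> {}" using assms by auto
  have V: "V n i u v = max (max (Max ((\<lambda>j. theta n i j u v) ` ?I)) (Max ((\<lambda>j. theta' n i j u v) ` ?I)))
      (max (Max ((\<lambda>j. eta n i j u v) ` ?J)) (Max ((\<lambda>j. eta' n i j u v) ` ?J)))"
    unfolding V_def by (rule Max_Un4) (simp_all only: S image_is_empty finite_imageI finite_atLeastAtMost not_False_eq_True)
  have 1: "trop (\<lambda>t. \<Sum>j\<in>?I. gtheta n i j (F t) (G t)) (Max ((\<lambda>j. theta n i j u v) ` ?I))"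
    by (rule trop_sum[OF _ S(1)]) (simp, rule trop_gtheta[OF F G])
  have 2: "trop (\<lambda>t. \<Sum>j\<in>?I. gtheta' n i j (F t) (G t)) (Max ((\<lambda>j. theta' n i j u v) ` ?I))"
    by (rule trop_sum[OF _ S(1)]) (simp, rule trop_gtheta'[OF F G])
  have 3: "trop (\<lambda>t. \<Sum>j\<in>?J. geta n i j (F t) (G t)) (Max ((\<lambda>j. eta n i j u v) ` ?J))"
    by (rule trop_sum[OF _ S(2)]) (simp, rule trop_geta[OF F G assms(2)])
  have 4: "trop (\<lambda>t. \<Sum>j\<in>?J. geta' n i j (F t) (G t)) (Max ((\<lambda>j. eta' n i j u v) ` ?J))"
    by (rule trop_sum[OF _ S(2)]) (simp, rule trop_geta'[OF F G])
  show ?thesis unfolding gV_def sum.distrib V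
    by (rule trop_add[OF trop_add[OF 1 2] trop_add[OF 3 4]])
qed

lemma trop_gVstar:
  assumes "n \<ge> 3" "i \<le> n - 1" and F: "tropc F u" and G: "tropc G v"
  shows "trop (\<lambda>t. gVstar n i (F t) (G t)) (Vstar n i u v)"
  unfolding gVstar_def Vstar_def by (intro trop_gV assms tropc_gstar)

lemma trop_gW:
  assumes "n \<ge> 3" "i \<le> n - 1" and F: "tropc F u" and G: "tropc G v"
  shows "trop (\<lambda>t. gW n i (F t) (G t)) (W n i u v)"
proof -
  have le: "0 \<le> n - 1" "n - 1 \<le> n - 1" "i - 1 \<le> n - 1" using assms(2) by auto
  note V = trop_gV[OF assms(1) _ F G] trop_gVstar[OF assms(1) _ F G]
  \<comment> \<open>The minimum is written as a negated maximum, the form in which the limit of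
    \<open>gW\<close> arrives.\<close>
  have w: "W n i u v = (if i = 0 then V n 0 u v + V n 0 u v
     else if i = 1 then V n 0 u v + V n 0 (sigma1 u) (sigma1 v)
     else if i = n - 1 then V n (n - 1) u v + Vstar n (n - 1) u v
     else max (V n i u v + Vstar n (i - 1) u v - fst v i)
              (V n (i - 1) u v + Vstar n i u v - snd u i)
          - max (0 - fst u i) (0 - snd v i))"
    unfolding W_def Vsigma1_def by (auto simp: min_def max_def)
  show ?thesis unfolding gW_def w
    by (intro trop_if trop_intros V le assms(2) trop_gV[OF assms(1)] tropc_gsigma1 F G)
qed

lemma tropc_gRx:
  assumes "n \<ge> 3" and F: "tropc F u" and G: "tropc G v"
  shows "tropc (\<lambda>t. gRx n (F t) (G t)) (Rx' n u v)"
    and "tropc (\<lambda>t. gRy n (F t) (G t)) (Ry' n u v)"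
proof -
  note V = trop_gV[OF assms(1) _ F G] and Vs = trop_gVstar[OF assms(1) _ F G]
    and W = trop_gW[OF assms(1) _ F G] and xy = F[THEN tropc_fst] F[THEN tropc_snd] G[THEN tropc_fst] G[THEN tropc_snd]
  have "trop (\<lambda>t. fst (gRx n (F t) (G t)) i) (fst (Rx' n u v) i) \<and>
      trop (\<lambda>t. snd (gRx n (F t) (G t)) i) (snd (Rx' n u v) i) \<and>
      trop (\<lambda>t. fst (gRy n (F t) (G t)) i) (fst (Ry' n u v) i) \<and>
      trop (\<lambda>t. snd (gRy n (F t) (G t)) i) (snd (Ry' n u v) i)" for i
  proof (cases "1 \<le> i \<and> i \<le> n - 1")
    case True
    then have i: "i \<noteq> n" "i - 1 \<le> n - 1" "i \<le> n - 1" by auto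
    note R = trop_mult[OF trop_mult] V[OF i(2)] V[OF i(3)] Vs[OF i(2)] Vs[OF i(3)] W[OF i(2)] W[OF i(3)]
    show ?thesis
      unfolding gRx_def gRy_def Rx'_def Ry'_def fst_conv snd_conv if_P[OF True] if_not_P[OF i(1)]
      by (intro conjI trop_mult trop_divide R(2-) xy)
  next
    case False
    show ?thesis
      unfolding gRx_def gRy_def Rx'_def Ry'_def fst_conv snd_conv if_not_P[OF False]
      by (intro conjI trop_if trop_one trop_mult trop_divide V[OF order_refl] Vs[OF order_refl] xy)
  qed
  then show "tropc (\<lambda>t. gRx n (F t) (G t)) (Rx' n u v)" "tropc (\<lambda>t. gRy n (F t) (G t)) (Ry' n u v)"
    unfolding tropc_def by auto
qed

section \<open>Piecewise linear identities as limits\<close>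

lemma PL_V_sigma1:
  assumes "n \<ge> 3" "1 \<le> i" "i \<le> n - 1"
  shows "V n i (sigma1 u) (sigma1 v) = V n i u v"
proof (rule trop_unique)
  show "trop (\<lambda>t. gV n i (powc u t) (powc v t)) (V n i u v)"
    by (intro trop_gV assms tropc_powc)
  have "trop (\<lambda>t. gV n i (gsigma1 (powc u t)) (gsigma1 (powc v t))) (V n i (sigma1 u) (sigma1 v))"
    by (intro trop_gV assms tropc_gsigma1 tropc_powc)
  then show "trop (\<lambda>t. gV n i (powc u t) (powc v t)) (V n i (sigma1 u) (sigma1 v))"
    by (rule trop_cong) (intro gV_sigma1 assms tropc_gpos[OF tropc_powc])
qed

lemma PL_V0_star:
  assumes "n \<ge> 3"
  shows "Vstar n 0 u v = V n 0 u v"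
proof (rule trop_unique)
  show "trop (\<lambda>t. gV n 0 (powc u t) (powc v t)) (V n 0 u v)"
    by (intro trop_gV assms tropc_powc le0)
  have "trop (\<lambda>t. gVstar n 0 (powc u t) (powc v t)) (Vstar n 0 u v)"
    by (intro trop_gVstar assms tropc_powc le0)
  then show "trop (\<lambda>t. gV n 0 (powc u t) (powc v t)) (Vstar n 0 u v)"
    by (rule trop_cong) (intro gV_0_star assms tropc_gpos[OF tropc_powc])
qed

lemma PL_V_sigman:
  assumes "n \<ge> 3"
  shows "i \<le> n - 2 \<Longrightarrow> V n i (sigman n u) (sigman n v) = V n i u v"
    and "V n (n - 1) (sigman n u) (sigman n v) = Vstar n (n - 1) u v"
proof -
  have A: "trop (\<lambda>t. gV n i (gsigman n (powc u t)) (gsigman n (powc v t))) (V n i (sigman n u) (sigman n v))"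
    if "i \<le> n - 1" for i by (intro trop_gV assms that tropc_gsigman tropc_powc)
  show "V n i (sigman n u) (sigman n v) = V n i u v" if "i \<le> n - 2"
  proof (rule trop_unique)
    have i: "i \<le> n - 1" using that by simp
    show "trop (\<lambda>t. gV n i (powc u t) (powc v t)) (V n i u v)"
      by (intro trop_gV assms tropc_powc i)
    show "trop (\<lambda>t. gV n i (powc u t) (powc v t)) (V n i (sigman n u) (sigman n v))"
      using A[OF i] by (rule trop_cong) (intro gsigman_gV assms that tropc_gpos[OF tropc_powc])
  qed
  show "V n (n - 1) (sigman n u) (sigman n v) = Vstar n (n - 1) u v"
  proof (rule trop_unique)
    show "trop (\<lambda>t. gVstar n (n-1) (powc u t) (powc v t)) (Vstar n (n-1) u v)"
      by (intro trop_gVstar assms tropc_powc order_refl)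
    show "trop (\<lambda>t. gVstar n (n-1) (powc u t) (powc v t)) (V n (n-1) (sigman n u) (sigman n v))"
      using A[OF order_refl] by (rule trop_cong) (intro gsigman_gV assms tropc_gpos[OF tropc_powc])
  qed
qed

text \<open>The exponent is lifted together with the points: c becomes t^c, and the share of the
  left factor becomes a function of t with limit \<open>pleft\<close>.\<close>

lemma PL_commute:
  fixes u v :: coords and c :: int
  assumes n: "n \<ge> 3" and i: "1 \<le> i" "i \<le> n - 1"
    and c1: "c1 = pleft n i c u v" and c1': "c1' = pleft n i c (Ry' n u v) (Rx' n u v)"
  shows "Ry' n (pe n i c1 u) (pe n i (c - c1) v) = pe n i c1' (Ry' n u v)"
    and "Rx' n (pe n i c1 u) (pe n i (c - c1) v) = pe n i (c - c1') (Rx' n u v)"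
    and "V n 0 (pe n i c1 u) (pe n i (c - c1) v) = V n 0 u v"
    and "eps n i (Ry' n u v) + max 0 (eps n i (Rx' n u v) - phi n i (Ry' n u v))
       = eps n i u + max 0 (eps n i v - phi n i u)"
proof -
  define C where "C t = t powr of_int c" for t :: real
  have C: "trop C c" unfolding C_def by simp
  have Cp: "C t > 0" if "t > 1" for t using trop_pos[OF C that] .
  define X where "X = powc u"
  define Y where "Y = powc v"
  have X: "tropc X u" and Y: "tropc Y v" by (simp_all add: X_def Y_def)
  define C1 where "C1 t = gleft n i (C t) (X t) (Y t)" for t
  define C1' where "C1' t = gleft n i (C t) (gRy n (X t) (Y t)) (gRx n (X t) (Y t))" for t
  have R: "tropc (\<lambda>t. gRx n (X t) (Y t)) (Rx' n u v)" "tropc (\<lambda>t. gRy n (X t) (Y t)) (Ry' n u v)"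
    by (rule tropc_gRx[OF n X Y])+
  have C1: "trop C1 c1" unfolding C1_def c1 by (rule trop_gleft[OF X Y C])
  have C1': "trop C1' c1'" unfolding C1'_def c1' by (rule trop_gleft[OF R(2,1) C])
  have eX: "tropc (\<lambda>t. ge n i (C1 t) (X t)) (pe n i c1 u)" by (rule tropc_ge[OF X C1])
  have eY: "tropc (\<lambda>t. ge n i (C t / C1 t) (Y t)) (pe n i (c - c1) v)"
    by (rule tropc_ge[OF Y trop_divide[OF C C1]])
  note G = geometric_R_commute[OF n i tropc_gpos[OF X] tropc_gpos[OF Y] Cp C1_def C1'_def]
  show "Ry' n (pe n i c1 u) (pe n i (c - c1) v) = pe n i c1' (Ry' n u v)"
    by (rule tropc_unique[OF tropc_cong[OF tropc_gRx(2)[OF n eX eY] G(1)] tropc_ge[OF R(2) C1']])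
  show "Rx' n (pe n i c1 u) (pe n i (c - c1) v) = pe n i (c - c1') (Rx' n u v)"
    by (rule tropc_unique[OF tropc_cong[OF tropc_gRx(1)[OF n eX eY] G(2)] tropc_ge[OF R(1) trop_divide[OF C C1']]])
  show "V n 0 (pe n i c1 u) (pe n i (c - c1) v) = V n 0 u v"
    by (rule trop_unique[OF trop_cong[OF trop_gV[OF n le0 eX eY] G(3)] trop_gV[OF n le0 X Y]])
  have h1: "trop (\<lambda>t. geps n i (gRy n (X t) (Y t)) * (gphi n i (gRy n (X t) (Y t)) + geps n i (gRx n (X t) (Y t)))
          / gphi n i (gRy n (X t) (Y t)))
     (eps n i (Ry' n u v) + max (phi n i (Ry' n u v)) (eps n i (Rx' n u v)) - phi n i (Ry' n u v))"
    by (intro trop_divide trop_mult trop_add trop_gphi trop_geps R)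
  have h2: "trop (\<lambda>t. geps n i (X t) * (gphi n i (X t) + geps n i (Y t)) / gphi n i (X t))
     (eps n i u + max (phi n i u) (eps n i v) - phi n i u)"
    by (intro trop_divide trop_mult trop_add trop_gphi trop_geps X Y)
  have "eps n i (Ry' n u v) + max (phi n i (Ry' n u v)) (eps n i (Rx' n u v)) - phi n i (Ry' n u v)
     = eps n i u + max (phi n i u) (eps n i v) - phi n i u"
    by (rule trop_unique[OF trop_cong[OF h1 G(4)] h2])
  then show "eps n i (Ry' n u v) + max 0 (eps n i (Rx' n u v) - phi n i (Ry' n u v))
       = eps n i u + max 0 (eps n i v - phi n i u)" by linarith
qed

lemma star_star [simp]: "star n (star n x) = x"
  by (auto simp: star_def prod_eq_iff)

lemma star_sigma1: "n \<ge> 2 \<Longrightarrow> star n (sigma1 x) = sigma1 (star n x)"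
  by (auto simp: star_def sigma1_def prod_eq_iff)

lemma sigma1_sigma1 [simp]: "sigma1 (sigma1 x) = x"
  by (auto simp: sigma1_def prod_eq_iff)

lemma star_sigman: "n \<ge> 2 \<Longrightarrow> star n (sigman n x) = sigman n (star n x)"
  by (auto simp: star_def sigman_def prod_eq_iff)

lemma sigman_sigman [simp]: "n \<ge> 1 \<Longrightarrow> sigman n (sigman n x) = x"
  by (auto simp: sigman_def prod_eq_iff)

lemma sigma1_sigman: "n \<ge> 3 \<Longrightarrow> sigma1 (sigman n x) = sigman n (sigma1 x)"
  by (auto simp: sigma1_def sigman_def prod_eq_iff)

lemma Vstar_sigma1:
  assumes "n \<ge> 3" "1 \<le> i" "i \<le> n - 1"
  shows "Vstar n i (sigma1 u) (sigma1 v) = Vstar n i u v"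
  using assms by (simp add: Vstar_def star_sigma1 PL_V_sigma1)

lemma Vstar_sigman:
  assumes "n \<ge> 3"
  shows "i \<le> n - 2 \<Longrightarrow> Vstar n i (sigman n u) (sigman n v) = Vstar n i u v"
    and "Vstar n (n - 1) (sigman n u) (sigman n v) = V n (n - 1) u v"
  using assms PL_V_sigman(1)[OF assms, of i "star n v" "star n u"] PL_V_sigman(2)[OF assms, of "star n v" "star n u"]
  by (auto simp add: Vstar_def star_sigman)

lemma W_sigma1:
  assumes "n \<ge> 3" "1 \<le> i" "i \<le> n - 1"
  shows "W n i (sigma1 u) (sigma1 v) = W n i u v"
proof -
  consider "i = 1" | "i = n - 1" "i \<noteq> 1" | "2 \<le> i" "i \<noteq> n - 1" using assms(2) by linarith
  then show ?thesis
  proof cases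
    case 3
    have l: "1 \<le> i - 1" "i - 1 \<le> n - 1" using 3 assms(3) by auto
    have "fst (sigma1 u) i = fst u i" "snd (sigma1 u) i = snd u i" "fst (sigma1 v) i = fst v i" "snd (sigma1 v) i = snd v i"
      using 3 by (auto simp: sigma1_def)
    then show ?thesis using 3
      by (simp add: W_def PL_V_sigma1[OF assms] Vstar_sigma1[OF assms] PL_V_sigma1[OF assms(1) l, simplified]
          Vstar_sigma1[OF assms(1) l, simplified])
  qed (use assms in \<open>auto simp: W_def Vsigma1_def PL_V_sigma1 Vstar_sigma1\<close>)
qed

lemma W_sigman:
  assumes "n \<ge> 3" "i \<le> n - 1"
  shows "W n i (sigman n u) (sigman n v) = W n i u v"
proof -
  consider "i = 0" | "i = 1" | "i = n - 1" "i \<noteq> 1" "i \<noteq> 0" | "2 \<le> i" "i \<le> n - 2" using assms(2) by linarith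
  then show ?thesis
  proof cases
    case 4
    have l: "i - 1 \<le> n - 2" using 4 by auto
    have "fst (sigman n u) i = fst u i" "snd (sigman n u) i = snd u i" "fst (sigman n v) i = fst v i" "snd (sigman n v) i = snd v i"
      using 4 assms(1) by (auto simp: sigman_def)
    moreover have "i \<noteq> n - 1" using 4 assms(1) by simp
    ultimately show ?thesis using 4
      by (simp add: W_def PL_V_sigman(1)[OF assms(1) 4(2)] Vstar_sigman(1)[OF assms(1) 4(2)]
          PL_V_sigman(1)[OF assms(1) l, simplified] Vstar_sigman(1)[OF assms(1) l, simplified])
  next
    case 3
    then show ?thesis using PL_V_sigman(2)[OF assms(1)] Vstar_sigman(2)[OF assms(1)] by (simp add: W_def)
  qed (use assms in \<open>auto simp: W_def Vsigma1_def PL_V_sigman sigma1_sigman\<close>)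
qed

text \<open>The functions of index at least 1 are invariant, so i = 1 is the only delicate entry.
  There W_1 - W_0 is the difference between the transformed V_0 and V_0, and it exchanges the
  formulas for the unbarred and the barred coordinate.\<close>

lemma R_sigma1:
  assumes n: "n \<ge> 3"
  shows "Rx' n (sigma1 x) (sigma1 y) = sigma1 (Rx' n x y)"
    and "Ry' n (sigma1 x) (sigma1 y) = sigma1 (Ry' n x y)"
proof -
  have "fst (Rx' n (sigma1 x) (sigma1 y)) i = fst (sigma1 (Rx' n x y)) i \<and>
    snd (Rx' n (sigma1 x) (sigma1 y)) i = snd (sigma1 (Rx' n x y)) i \<and>
    fst (Ry' n (sigma1 x) (sigma1 y)) i = fst (sigma1 (Ry' n x y)) i \<and>
    snd (Ry' n (sigma1 x) (sigma1 y)) i = snd (sigma1 (Ry' n x y)) i" for i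
  proof (cases "i = 1")
    case True
    have 1: "i \<noteq> n" "1 \<le> i \<and> i \<le> n - 1" using True n by auto
    have W: "W n 1 (sigma1 x) (sigma1 y) = W n 1 x y"
      "W n 1 x y = V n 0 x y + V n 0 (sigma1 x) (sigma1 y)" "W n 0 u v = 2 * V n 0 u v" for u v
      using n by (auto simp: W_sigma1) (auto simp: W_def Vsigma1_def)
    have Vs: "Vstar n 1 (sigma1 x) (sigma1 y) = Vstar n 1 x y" "V n 1 (sigma1 x) (sigma1 y) = V n 1 x y"
      using n by (auto intro!: Vstar_sigma1 PL_V_sigma1)
    have s: "fst (sigma1 u) 1 = snd u 1" "snd (sigma1 u) 1 = fst u 1" for u by (auto simp: sigma1_def)
    show ?thesis
      unfolding True s
      unfolding Rx'_def Ry'_def fst_conv snd_conv if_not_P[OF 1(1)[unfolded True]] if_P[OF 1(2)[unfolded True]]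
        s W Vs diff_self_eq_0 PL_V0_star[OF n] by auto
  next
    case False
    have s: "fst (sigma1 u) i = fst u i" "snd (sigma1 u) i = snd u i" for u using False by (auto simp: sigma1_def)
    have sn: "fst (sigma1 u) n = fst u n" for u using n by (auto simp: sigma1_def)
    have l: "1 \<le> n - 1" "n - 1 \<le> n - 1" using n by auto
    show ?thesis
    proof (cases "1 \<le> i \<and> i \<le> n - 1")
      case True
      then have i: "1 \<le> i" "i \<le> n - 1" "1 \<le> i - 1" "i - 1 \<le> n - 1" "i \<noteq> n" using False by auto
      show ?thesis unfolding Rx'_def Ry'_def
        unfolding Rx'_def[symmetric] Ry'_def[symmetric] s
        unfolding Rx'_def Ry'_def fst_conv snd_conv if_P[OF True] if_not_P[OF i(5)] s
          Vstar_sigma1[OF n i(1,2)] Vstar_sigma1[OF n i(3,4)] PL_V_sigma1[OF n i(1,2)] PL_V_sigma1[OF n i(3,4)]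
          W_sigma1[OF n i(1,2)] W_sigma1[OF n i(3,4)] by simp
    next
      case nt: False
      show ?thesis unfolding s
        unfolding Rx'_def Ry'_def fst_conv snd_conv if_not_P[OF nt] sn
          Vstar_sigma1[OF n l] PL_V_sigma1[OF n l] by simp
    qed
  qed
  then show "Rx' n (sigma1 x) (sigma1 y) = sigma1 (Rx' n x y)" "Ry' n (sigma1 x) (sigma1 y) = sigma1 (Ry' n x y)"
    by (auto intro!: prod_eqI ext)
qed

lemma R_sigman:
  assumes n: "n \<ge> 3"
  shows "Rx' n (sigman n x) (sigman n y) = sigman n (Rx' n x y)"
    and "Ry' n (sigman n x) (sigman n y) = sigman n (Ry' n x y)"
proof -
  have "fst (Rx' n (sigman n x) (sigman n y)) i = fst (sigman n (Rx' n x y)) i \<and>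
    snd (Rx' n (sigman n x) (sigman n y)) i = snd (sigman n (Rx' n x y)) i \<and>
    fst (Ry' n (sigman n x) (sigman n y)) i = fst (sigman n (Ry' n x y)) i \<and>
    snd (Ry' n (sigman n x) (sigman n y)) i = snd (sigman n (Ry' n x y)) i" for i
  proof -
    have nn: "n - 1 \<noteq> n" "1 \<le> n - 1 \<and> n - 1 \<le> n - 1" "\<not> (1 \<le> n \<and> n \<le> n - 1)" "n - 1 - 1 \<le> n - 2" "n - 1 - 1 \<le> n - 1" using n by auto
    have s: "fst (sigman n u) (n-1) = fst u (n-1) + fst u n" "snd (sigman n u) (n-1) = snd u (n-1) + fst u n"
      "fst (sigman n u) n = - fst u n" "snd (sigman n u) n = snd u n" for u using nn by (auto simp: sigman_def)
    consider "i = n" | "i = n - 1" | "i \<noteq> n" "i \<noteq> n - 1" "1 \<le> i \<and> i \<le> n - 1" | "i \<noteq> n" "\<not> (1 \<le> i \<and> i \<le> n - 1)" by blast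
    then show ?thesis
    proof cases
      case 1
      show ?thesis unfolding 1 s
        unfolding Rx'_def Ry'_def fst_conv snd_conv s if_P[OF refl] if_not_P[OF nn(3)]
          PL_V_sigman(2)[OF n] Vstar_sigman(2)[OF n] by simp
    next
      case 2
      show ?thesis unfolding 2 s
        unfolding Rx'_def Ry'_def fst_conv snd_conv s if_P[OF refl] if_not_P[OF nn(1)] if_P[OF nn(2)]
          PL_V_sigman(2)[OF n] Vstar_sigman(2)[OF n] PL_V_sigman(1)[OF n nn(4)] Vstar_sigman(1)[OF n nn(4)]
          W_sigman[OF n order_refl] W_sigman[OF n nn(5)] by simp
    next
      case 3
      have i: "i \<le> n - 2" "i - 1 \<le> n - 2" "i - 1 \<le> n - 1" "i \<le> n - 1" using 3 by auto
      have si: "fst (sigman n u) i = fst u i" "snd (sigman n u) i = snd u i" for u using 3 by (auto simp: sigman_def)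
      show ?thesis unfolding si
        unfolding Rx'_def Ry'_def fst_conv snd_conv si if_not_P[OF 3(1)] if_P[OF 3(3)]
          PL_V_sigman(1)[OF n i(1)] Vstar_sigman(1)[OF n i(1)] PL_V_sigman(1)[OF n i(2)] Vstar_sigman(1)[OF n i(2)]
          W_sigman[OF n i(3)] W_sigman[OF n i(4)] by simp
    next
      case 4
      then have "i \<noteq> n - 1" using n by auto
      then have si: "fst (sigman n u) i = fst u i" "snd (sigman n u) i = snd u i" for u using 4 by (auto simp: sigman_def)
      show ?thesis unfolding si
        unfolding Rx'_def Ry'_def fst_conv snd_conv si if_not_P[OF 4(1)] if_not_P[OF 4(2)] by simp
    qed
  qed
  then show "Rx' n (sigman n x) (sigman n y) = sigman n (Rx' n x y)" "Ry' n (sigman n x) (sigman n y) = sigman n (Ry' n x y)"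
    by (auto intro!: prod_eqI ext)
qed

section \<open>Crystals and their operators in the coordinates x\<close>

definition Bx :: "nat \<Rightarrow> int \<Rightarrow> coords set" where
  "Bx n l = {x. (\<forall>i\<in>{1..n-1}. fst x i \<ge> 0 \<and> snd x i \<ge> 0)
     \<and> fst x n \<ge> - fst x (n-1) \<and> fst x n \<ge> - snd x (n-1) \<and> ell n x = l
     \<and> (\<forall>i. i \<notin> {1..n} \<longrightarrow> fst x i = 0) \<and> (\<forall>i. i \<notin> {1..n-1} \<longrightarrow> snd x i = 0)}"

lemma phi_pe: "n \<ge> 1 \<Longrightarrow> phi n i (pe n i c x) = phi n i x + c"
  and eps_pe: "n \<ge> 1 \<Longrightarrow> eps n i (pe n i c x) = eps n i x - c"
  by (auto simp: phi_def eps_def pe_def pxi_def)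

text \<open>Additivity of the exponent rests on the cocycle property of \<open>pxi\<close>, derived
  as \<open>e\<close> below.\<close>

lemma pe_pe: "n \<ge> 1 \<Longrightarrow> pe n i a (pe n i b x) = pe n i (a + b) x"
proof (cases "i = n - 1")
  case True
  assume "n \<ge> 1"
  then show ?thesis by (auto simp: pe_def True fun_eq_iff)
next
  case False
  have "max (a + (X + k)) (x' - (b - k)) - max (X + k) (x' - (b - k)) + k = max (a + b + X) x' - max X x'"
    if "k = max (b + X) x' - max X x'" for X x' k :: int
    using that by (auto simp: max_def)
  from this[OF refl, of "snd x (i+1)" "fst x (i+1)"]
  have e: "pxi i a (pe n i b x) = pxi i (a + b) x - pxi i b x"
    unfolding pxi_def pe_def if_not_P[OF False] by simp
  show ?thesis unfolding pe_def[of n i a "pe n i b x"] pe_def[of n i "a + b" x] if_not_P[OF False] e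
    unfolding pe_def[of n i b x] if_not_P[OF False] by (auto simp: fun_eq_iff)
qed

lemma pe_0: "n \<ge> 1 \<Longrightarrow> pe n i 0 x = x"
  by (auto simp: pe_def pxi_def fun_eq_iff prod_eq_iff)

lemma sum_two_change_int:
  fixes f g :: "nat \<Rightarrow> int"
  assumes "finite S" "i \<in> S" "k \<in> S" "i \<noteq> k" "f i + f k = g i + g k"
    and "\<And>j. j \<in> S \<Longrightarrow> j \<noteq> i \<Longrightarrow> j \<noteq> k \<Longrightarrow> f j = g j"
  shows "sum f S = sum g S"
proof -
  have *: "sum h S = h i + h k + sum h (S - {i} - {k})" for h :: "nat \<Rightarrow> int"
    using assms(1-4) sum.remove[of S i h] sum.remove[of "S - {i}" k h] by (simp add: add_ac)
  have "sum f (S - {i} - {k}) = sum g (S - {i} - {k})" using assms(6) by (intro sum.cong) auto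
  then show ?thesis unfolding * assms(5) by simp
qed

lemma ell_split: "n \<ge> 2 \<Longrightarrow> ell n x = (\<Sum>i=1..n-2. fst x i + snd x i) + (fst x (n-1) + snd x (n-1)) + fst x n"
proof -
  assume "n \<ge> 2"
  then obtain m where "n = Suc (Suc m)" by (metis add_2_eq_Suc le_Suc_ex)
  then show ?thesis by (simp add: ell_def)
qed

lemma ell_pe:
  assumes "n \<ge> 3" "1 \<le> i" "i \<le> n - 1"
  shows "ell n (pe n i c x) = ell n x"
proof (cases "i = n - 1")
  case True
  have n: "n - 1 \<noteq> n" using assms(1) by simp
  have "(\<Sum>j=1..n-2. fst (pe n i c x) j + snd (pe n i c x) j) = (\<Sum>j=1..n-2. fst x j + snd x j)"
    using assms(1) by (intro sum.cong refl) (auto simp: True pe_def)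
  moreover have "fst (pe n i c x) (n-1) = fst x (n-1) + c" "snd (pe n i c x) (n-1) = snd x (n-1)"
    "fst (pe n i c x) n = fst x n - c"
    unfolding True pe_def if_P[OF refl] fst_conv snd_conv
    by (simp_all only: fun_upd_apply n refl if_True if_False)
  ultimately show ?thesis using assms(1) by (simp add: ell_split)
next
  case False
  then have I: "i \<in> {1..n-1}" "i + 1 \<in> {1..n-1}" "i \<noteq> n" "i + 1 \<noteq> n" using assms by auto
  have "(\<Sum>j=1..n-1. fst (pe n i c x) j + snd (pe n i c x) j) = (\<Sum>j=1..n-1. fst x j + snd x j)"
    unfolding pe_def if_not_P[OF False]
    by (rule sum_two_change_int[OF _ I(1,2)]) auto
  moreover have "fst (pe n i c x) n = fst x n"
    using I unfolding pe_def if_not_P[OF False] by auto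
  ultimately show ?thesis by (simp add: ell_def)
qed

text \<open>\<open>pe\<close> is defined for every integer c; positive values are powers of e_i and
  negative ones powers of f_i. The interval is the range in which these powers do not vanish on the
  crystal.\<close>

lemma Bx_pe:
  assumes n: "n \<ge> 3" and i: "1 \<le> i" "i \<le> n - 1" and x: "x \<in> Bx n l"
    and c: "- phi n i x \<le> c" "c \<le> eps n i x"
  shows "pe n i c x \<in> Bx n l"
proof -
  let ?y = "pe n i c x"
  have e: "ell n ?y = l" using ell_pe[OF n i] x by (simp add: Bx_def)
  have nn: "n - 1 \<in> {1..n-1}" "n - 1 \<noteq> n" using n by auto
  have z: "i \<in> {1..n-1} \<Longrightarrow> fst x i \<ge> 0 \<and> snd x i \<ge> 0" "fst x n \<ge> - fst x (n-1)" "fst x n \<ge> - snd x (n-1)"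
    "i \<notin> {1..n} \<Longrightarrow> fst x i = 0" "i \<notin> {1..n-1} \<Longrightarrow> snd x i = 0" for i using x unfolding Bx_def by auto
  show ?thesis
  proof (cases "i = n - 1")
    case True
    have y: "fst ?y (n-1) = fst x (n-1) + c" "fst ?y n = fst x n - c" "snd ?y = snd x"
       "j \<noteq> n - 1 \<Longrightarrow> j \<noteq> n \<Longrightarrow> fst ?y j = fst x j" for j using nn by (auto simp: True pe_def)
    have "fst ?y j \<ge> 0 \<and> snd ?y j \<ge> 0" if "j \<in> {1..n-1}" for j
      using z(1)[OF that] c y(4)[of j] that y(1) unfolding y(3) phi_def if_P[OF True] by (cases "j = n - 1") (auto simp: True)
    moreover have "fst ?y n \<ge> - fst ?y (n-1)" "fst ?y n \<ge> - snd ?y (n-1)"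
      using z(2,3) c unfolding y eps_def if_P[OF True] by (auto simp: True)
    moreover have "j \<notin> {1..n} \<Longrightarrow> fst ?y j = 0" "j \<notin> {1..n-1} \<Longrightarrow> snd ?y j = 0" for j
      using z(4,5) y(3) y(4)[of j] nn by (auto simp: True)
    ultimately show ?thesis using e unfolding Bx_def by blast
  next
    case False
    then have I: "i \<in> {1..n-1}" "i + 1 \<in> {1..n-1}" "i \<noteq> n" "i + 1 \<noteq> n" using n i by auto
    let ?k = "pxi i c x"
    have y: "fst ?y i = fst x i + (c - ?k)" "fst ?y (i+1) = fst x (i+1) - (c - ?k)"
       "snd ?y i = snd x i - ?k" "snd ?y (i+1) = snd x (i+1) + ?k"
       "j \<noteq> i \<Longrightarrow> j \<noteq> i + 1 \<Longrightarrow> fst ?y j = fst x j" "j \<noteq> i \<Longrightarrow> j \<noteq> i + 1 \<Longrightarrow> snd ?y j = snd x j" for j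
      unfolding pe_def if_not_P[OF False] by auto
    note c' = c[unfolded phi_def eps_def if_not_P[OF False]]
    have p: "fst ?y i \<ge> 0" "fst ?y (i+1) \<ge> 0" "snd ?y i \<ge> 0" "snd ?y (i+1) \<ge> 0"
      using z(1)[OF I(1)] z(1)[OF I(2)] c' unfolding y pxi_def by auto
    have m: "min (fst ?y (i+1)) (snd ?y (i+1)) \<ge> min (fst x (i+1)) (snd x (i+1))"
      using c' unfolding y pxi_def by auto
    have "fst ?y j \<ge> 0 \<and> snd ?y j \<ge> 0" if "j \<in> {1..n-1}" for j
      using z(1)[OF that] p y(5,6)[of j] by (cases "j = i"; cases "j = i + 1") auto
    moreover have "fst ?y n \<ge> - fst ?y (n-1) \<and> fst ?y n \<ge> - snd ?y (n-1)"
    proof -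
      have "fst ?y n = fst x n" using y(5)[of n] I by auto
      moreover have "min (fst ?y (n-1)) (snd ?y (n-1)) \<ge> min (fst x (n-1)) (snd x (n-1))"
        using m y(5,6)[of "n-1"] False by (cases "n - 1 = i + 1") auto
      ultimately show ?thesis using z(2,3) by linarith
    qed
    moreover have "j \<notin> {1..n} \<Longrightarrow> fst ?y j = 0" "j \<notin> {1..n-1} \<Longrightarrow> snd ?y j = 0" for j
      using z(4,5)[of j] y(5,6)[of j] I by auto
    ultimately show ?thesis using e unfolding Bx_def by blast
  qed
qed

lemma phi_eps_nonneg:
  assumes "n \<ge> 3" "1 \<le> i" "i \<le> n - 1" "x \<in> Bx n l"
  shows "phi n i x \<ge> 0" "eps n i x \<ge> 0"
proof -
  have "fst x i \<ge> 0" "snd x i \<ge> 0" "fst x n \<ge> - snd x (n-1)" using assms by (auto simp: Bx_def)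
  then show "phi n i x \<ge> 0" "eps n i x \<ge> 0" by (auto simp: phi_def eps_def)
qed

lemma sigma1_Bx:
  assumes "n \<ge> 3" "x \<in> Bx n l"
  shows "sigma1 x \<in> Bx n l"
proof -
  have "(\<Sum>i=1..n-1. fst (sigma1 x) i + snd (sigma1 x) i) = (\<Sum>i=1..n-1. fst x i + snd x i)"
    by (intro sum.cong) (auto simp: sigma1_def)
  moreover have "fst (sigma1 x) n = fst x n" using assms(1) by (auto simp: sigma1_def)
  ultimately have e: "ell n (sigma1 x) = ell n x" by (simp add: ell_def)
  have s: "i \<noteq> 1 \<Longrightarrow> fst (sigma1 x) i = fst x i \<and> snd (sigma1 x) i = snd x i"
     "fst (sigma1 x) 1 = snd x 1" "snd (sigma1 x) 1 = fst x 1" for i by (auto simp: sigma1_def)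
  have n: "n \<noteq> 1" "n - 1 \<noteq> 1" "1 \<in> {1..n-1}" "1 \<in> {1..n}" using assms(1) by auto
  have a: "fst (sigma1 x) i \<ge> 0 \<and> snd (sigma1 x) i \<ge> 0" if "i \<in> {1..n-1}" for i
    using assms(2) s(1)[of i] s(2,3) that unfolding Bx_def by (cases "i = 1") auto
  have b: "i \<notin> {1..n} \<Longrightarrow> fst (sigma1 x) i = 0" "i \<notin> {1..n-1} \<Longrightarrow> snd (sigma1 x) i = 0" for i
    using assms(2) s(1)[of i] n unfolding Bx_def by (cases "i = 1"; auto)+
  show ?thesis using assms(2) e a b s(1)[of n] s(1)[of "n-1"] n unfolding Bx_def by auto
qed

lemma sigman_nth:
  assumes "n \<ge> 3"
  shows "fst (sigman n x) (n-1) = fst x (n-1) + fst x n" "snd (sigman n x) (n-1) = snd x (n-1) + fst x n"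
    "fst (sigman n x) n = - fst x n" "j \<noteq> n - 1 \<Longrightarrow> j \<noteq> n \<Longrightarrow> fst (sigman n x) j = fst x j"
    "j \<noteq> n - 1 \<Longrightarrow> snd (sigman n x) j = snd x j"
  using assms by (auto simp: sigman_def)

lemma sigman_Bx:
  assumes "n \<ge> 3" "x \<in> Bx n l"
  shows "sigman n x \<in> Bx n l"
proof -
  note s = sigman_nth[OF assms(1), where x=x]
  have "(\<Sum>i=1..n-2. fst (sigman n x) i + snd (sigman n x) i) = (\<Sum>i=1..n-2. fst x i + snd x i)"
    using assms(1) by (intro sum.cong) (auto simp: sigman_def)
  then have e: "ell n (sigman n x) = ell n x" using assms(1) s by (simp add: ell_split)
  have a: "fst (sigman n x) i \<ge> 0 \<and> snd (sigman n x) i \<ge> 0" if "i \<in> {1..n-1}" for i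
  proof (cases "i = n - 1")
    case True
    show ?thesis using assms(2) unfolding True s Bx_def by auto
  next
    case False
    then have "i \<noteq> n" using that by auto
    then show ?thesis using assms(2) that False unfolding s(4)[OF False \<open>i \<noteq> n\<close>] s(5)[OF False] Bx_def by auto
  qed
  have b: "i \<notin> {1..n} \<Longrightarrow> fst (sigman n x) i = 0" "i \<notin> {1..n-1} \<Longrightarrow> snd (sigman n x) i = 0" for i
    using assms s(4,5)[of i] unfolding Bx_def by auto
  have "n - 1 \<in> {1..n-1}" using assms(1) by auto
  then have "fst x (n-1) \<ge> 0" "snd x (n-1) \<ge> 0" using assms(2) unfolding Bx_def by blast+
  then show ?thesis using assms(2) e a b s unfolding Bx_def by auto
qed

subsection \<open>Tensor products\<close>

text \<open>The rule of \<open>pleft\<close> as a function of integers, so that it applies equally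
  to phi and eps of single factors and of pairs.\<close>

definition pl :: "int \<Rightarrow> int \<Rightarrow> int \<Rightarrow> int" where
  "pl c f e = max (c + f) e - max f e"

definition phi2 :: "nat \<Rightarrow> nat \<Rightarrow> coords \<Rightarrow> coords \<Rightarrow> int" where
  "phi2 n i x y = phi n i y + max 0 (phi n i x - eps n i y)"

definition eps2 :: "nat \<Rightarrow> nat \<Rightarrow> coords \<Rightarrow> coords \<Rightarrow> int" where
  "eps2 n i x y = eps n i x + max 0 (eps n i y - phi n i x)"

type_synonym triple = "coords \<times> coords \<times> coords"

fun phi3 :: "nat \<Rightarrow> nat \<Rightarrow> triple \<Rightarrow> int" where
  "phi3 n i (x, y, z) = phi n i z + max 0 (phi2 n i x y - eps n i z)"

fun eps3 :: "nat \<Rightarrow> nat \<Rightarrow> triple \<Rightarrow> int" where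
  "eps3 n i (x, y, z) = eps2 n i x y + max 0 (eps n i z - phi2 n i x y)"

fun tact :: "nat \<Rightarrow> nat \<Rightarrow> int \<Rightarrow> triple \<Rightarrow> triple" where
  "tact n i c (x, y, z) =
    (let c12 = pl c (phi2 n i x y) (eps n i z); c1 = pl c12 (phi n i x) (eps n i y)
     in (pe n i c1 x, pe n i (c12 - c1) y, pe n i (c - c12) z))"

lemma pleft_pl: "pleft n i c x y = pl c (phi n i x) (eps n i y)"
  by (simp add: pleft_def pl_def)

lemma pl_assoc:
  "pl (pl c (f2 + max 0 (f1 - e2)) e3) f1 e2 = pl c f1 (e2 + max 0 (e3 - f2))"
  "pl c (f2 + max 0 (f1 - e2)) e3 - pl c f1 (e2 + max 0 (e3 - f2)) = pl (c - pl c f1 (e2 + max 0 (e3 - f2))) f2 e3"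
  unfolding pl_def by (auto simp: max_def)

text \<open>Associativity of the tensor product: \<open>tact\<close> brackets the first two factors,
  and this is the bracketing needed for \<open>R\<close> on the last two.\<close>

lemma tact_right:
  "tact n i c (x, y, z) =
    (let c1 = pl c (phi n i x) (eps2 n i y z); c2 = pl (c - c1) (phi n i y) (eps n i z)
     in (pe n i c1 x, pe n i c2 y, pe n i (c - c1 - c2) z))"
  unfolding tact.simps phi2_def eps2_def pl_assoc(1) Let_def
  unfolding pl_assoc(2)[symmetric] by simp

text \<open>Guarantees that an operator that stays within the string of a pair keeps each factor
  within its own string, hence within its crystal.\<close>

lemma pl_range:
  assumes "- (f2 + max 0 (f1 - e2)) \<le> c" "c \<le> e1 + max 0 (e2 - f1)" "e1 \<ge> 0" "f2 \<ge> 0" "e2 \<ge> 0" "f1 \<ge> 0"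
  shows "- f1 \<le> pl c f1 e2" "pl c f1 e2 \<le> e1" "- f2 \<le> c - pl c f1 e2" "c - pl c f1 e2 \<le> e2"
  using assms unfolding pl_def by auto

fun Bx3 :: "nat \<Rightarrow> triple \<Rightarrow> bool" where
  "Bx3 n (x, y, z) \<longleftrightarrow> (\<exists>l. x \<in> Bx n l) \<and> (\<exists>l. y \<in> Bx n l) \<and> (\<exists>l. z \<in> Bx n l)"

fun map3 :: "(coords \<Rightarrow> coords) \<Rightarrow> triple \<Rightarrow> triple" where
  "map3 f (x, y, z) = (f x, f y, f z)"

lemma phi_eps2_nonneg:
  assumes "n \<ge> 3" "1 \<le> i" "i \<le> n - 1" "x \<in> Bx n l" "y \<in> Bx n m"
  shows "phi2 n i x y \<ge> 0" "eps2 n i x y \<ge> 0"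
  using phi_eps_nonneg[OF assms(1-3,4)] phi_eps_nonneg[OF assms(1-3,5)] by (auto simp: phi2_def eps2_def)

lemma phi_eps3_nonneg:
  assumes "n \<ge> 3" "1 \<le> i" "i \<le> n - 1" "Bx3 n p"
  shows "phi3 n i p \<ge> 0" "eps3 n i p \<ge> 0"
proof -
  obtain x y z where p: "p = (x, y, z)" by (cases p)
  then obtain a b c where B: "x \<in> Bx n a" "y \<in> Bx n b" "z \<in> Bx n c" using assms(4) by auto
  show "phi3 n i p \<ge> 0" "eps3 n i p \<ge> 0"
    using phi_eps2_nonneg[OF assms(1-3) B(1,2)] phi_eps_nonneg[OF assms(1-3) B(3)] by (auto simp: p)
qed

lemma pair_Bx:
  assumes "n \<ge> 3" "1 \<le> i" "i \<le> n - 1" "x \<in> Bx n l" "y \<in> Bx n m"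
    and "- phi2 n i x y \<le> c" "c \<le> eps2 n i x y"
    and "c1 = pl c (phi n i x) (eps n i y)"
  shows "pe n i c1 x \<in> Bx n l" "pe n i (c - c1) y \<in> Bx n m"
  using pl_range[OF assms(6,7)[unfolded phi2_def eps2_def]]
    phi_eps_nonneg[OF assms(1-3,4)] phi_eps_nonneg[OF assms(1-3,5)]
  unfolding assms(8) by (auto intro!: Bx_pe assms(1-5))

lemma tact_Bx3:
  assumes "n \<ge> 3" "1 \<le> i" "i \<le> n - 1" "Bx3 n p" "- phi3 n i p \<le> c" "c \<le> eps3 n i p"
  shows "Bx3 n (tact n i c p)"
proof -
  obtain x y z where p: "p = (x, y, z)" by (cases p)
  then obtain l1 l2 l3 where B: "x \<in> Bx n l1" "y \<in> Bx n l2" "z \<in> Bx n l3" using assms(4) by auto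
  note N = phi_eps2_nonneg[OF assms(1-3) B(1,2)] phi_eps_nonneg[OF assms(1-3) B(3)]
  note r = pl_range[of "phi n i z" "phi2 n i x y" "eps n i z" c "eps2 n i x y"]
  have r: "- phi2 n i x y \<le> pl c (phi2 n i x y) (eps n i z)" "pl c (phi2 n i x y) (eps n i z) \<le> eps2 n i x y"
     "- phi n i z \<le> c - pl c (phi2 n i x y) (eps n i z)" "c - pl c (phi2 n i x y) (eps n i z) \<le> eps n i z"
    using r N assms(5,6) unfolding p by auto
  from pair_Bx[OF assms(1-3) B(1,2) r(1,2) refl] Bx_pe[OF assms(1-3) B(3) r(3,4)]
  show ?thesis unfolding p by (auto simp: Let_def)
qed

lemma pl_add: "pl a (f + pl b f e) (e - (b - pl b f e)) + pl b f e = pl (a + b) f e"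
  unfolding pl_def by (auto simp: max_def)

lemma phi2_add: "(f2 + (c - pl c f1 e2)) + max 0 ((f1 + pl c f1 e2) - (e2 - (c - pl c f1 e2))) = f2 + max 0 (f1 - e2) + (c::int)"
  unfolding pl_def by (auto simp: max_def)

lemma eps2_add: "(e1 - pl c f1 e2) + max 0 ((e2 - (c - pl c f1 e2)) - (f1 + pl c f1 e2)) = e1 + max 0 (e2 - f1) - (c::int)"
  unfolding pl_def by (auto simp: max_def)

lemma phi2_act:
  assumes "n \<ge> 1"
  shows "phi2 n i (pe n i (pl c (phi n i x) (eps n i y)) x) (pe n i (c - pl c (phi n i x) (eps n i y)) y) = phi2 n i x y + c"
   and "eps2 n i (pe n i (pl c (phi n i x) (eps n i y)) x) (pe n i (c - pl c (phi n i x) (eps n i y)) y) = eps2 n i x y - c"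
  unfolding phi2_def eps2_def phi_pe[OF assms] eps_pe[OF assms]
  by (rule phi2_add, rule eps2_add)

text \<open>Makes steps through \<open>tact\<close> invertible, as the backward argument in
  \<open>triple_induct\<close> requires.\<close>

lemma tact_tact:
  assumes "n \<ge> 1"
  shows "tact n i a (tact n i b p) = tact n i (a + b) p"
proof -
  obtain x y z where p: "p = (x, y, z)" by (cases p)
  define b12 where "b12 = pl b (phi2 n i x y) (eps n i z)"
  define b1 where "b1 = pl b12 (phi n i x) (eps n i y)"
  have t: "tact n i b p = (pe n i b1 x, pe n i (b12 - b1) y, pe n i (b - b12) z)"
    by (simp add: p b12_def b1_def Let_def)
  have f: "phi2 n i (pe n i b1 x) (pe n i (b12 - b1) y) = phi2 n i x y + b12"
    unfolding b1_def by (rule phi2_act(1)[OF assms])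
  define a12 where "a12 = pl a (phi2 n i x y + b12) (eps n i z - (b - b12))"
  define a1 where "a1 = pl a12 (phi n i x + b1) (eps n i y - (b12 - b1))"
  have A: "a12 + b12 = pl (a + b) (phi2 n i x y) (eps n i z)"
    unfolding a12_def b12_def by (rule pl_add)
  have A1: "a1 + b1 = pl (a12 + b12) (phi n i x) (eps n i y)"
    unfolding a1_def b1_def by (rule pl_add)
  have "tact n i a (tact n i b p) = (pe n i (a1 + b1) x, pe n i (a12 - a1 + (b12 - b1)) y, pe n i (a - a12 + (b - b12)) z)"
    unfolding t tact.simps f phi_pe[OF assms] eps_pe[OF assms] a12_def[symmetric] a1_def[symmetric] Let_def pe_pe[OF assms] ..
  also have "\<dots> = tact n i (a + b) p"
    unfolding p tact.simps A[symmetric] A1[symmetric] Let_def by (simp add: algebra_simps)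
  finally show ?thesis .
qed

lemma phi3_tact:
  assumes "n \<ge> 1"
  shows "phi3 n i (tact n i c p) = phi3 n i p + c" "eps3 n i (tact n i c p) = eps3 n i p - c"
proof -
  obtain x y z where p: "p = (x, y, z)" by (cases p)
  show "phi3 n i (tact n i c p) = phi3 n i p + c"
    unfolding p tact.simps Let_def phi3.simps phi2_act[OF assms] phi_pe[OF assms] eps_pe[OF assms]
    by (rule phi2_add)
  show "eps3 n i (tact n i c p) = eps3 n i p - c"
    unfolding p tact.simps Let_def eps3.simps phi2_act[OF assms] phi_pe[OF assms] eps_pe[OF assms]
    by (rule eps2_add)
qed

lemma tact_0: "n \<ge> 1 \<Longrightarrow> tact n i 0 p = p"
  by (cases p) (simp add: Let_def pl_def pe_0)

fun R12 :: "nat \<Rightarrow> triple \<Rightarrow> triple" where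
  "R12 n (x, y, z) = (Ry' n x y, Rx' n x y, z)"

fun R23 :: "nat \<Rightarrow> triple \<Rightarrow> triple" where
  "R23 n (x, y, z) = (x, Ry' n y z, Rx' n y z)"

fun V12 :: "nat \<Rightarrow> triple \<Rightarrow> int" where
  "V12 n (x, y, z) = V n 0 x y"

fun V23 :: "nat \<Rightarrow> triple \<Rightarrow> int" where
  "V23 n (x, y, z) = V n 0 y z"

lemma R_weight:
  assumes "n \<ge> 3" "1 \<le> i" "i \<le> n - 1"
  shows "fst (Rx' n x y) i - snd (Rx' n x y) i + fst (Ry' n x y) i - snd (Ry' n x y) i
    = fst x i - snd x i + fst y i - snd y i"
    and "fst (Rx' n x y) n + fst (Ry' n x y) n = fst x n + fst y n"
  using assms by (auto simp: Rx'_def Ry'_def)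

lemma phi_minus_eps: "i \<noteq> n - 1 \<Longrightarrow> phi n i x - eps n i x = fst x i - snd x i - (fst x (i+1) - snd x (i+1))"
  "phi n (n-1) x - eps n (n-1) x = fst x (n-1) - snd x (n-1) - fst x n"
  by (auto simp: phi_def eps_def)

lemma R_eps2:
  assumes "n \<ge> 3" "1 \<le> i" "i \<le> n - 1"
  shows "eps2 n i (Ry' n x y) (Rx' n x y) = eps2 n i x y"
  unfolding eps2_def by (rule PL_commute(4)[OF assms refl refl])

text \<open>phi - eps depends on the weight only, and the total weight is conserved, so this reduces
  to \<open>R_eps2\<close>.\<close>

lemma R_phi2:
  assumes "n \<ge> 3" "1 \<le> i" "i \<le> n - 1"
  shows "phi2 n i (Ry' n x y) (Rx' n x y) = phi2 n i x y"
proof -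
  have *: "phi2 n i u v = eps2 n i u v + (phi n i u - eps n i u) + (phi n i v - eps n i v)" for u v
    by (auto simp: phi2_def eps2_def)
  have "(phi n i (Ry' n x y) - eps n i (Ry' n x y)) + (phi n i (Rx' n x y) - eps n i (Rx' n x y))
     = (phi n i x - eps n i x) + (phi n i y - eps n i y)"
  proof (cases "i = n - 1")
    case True
    show ?thesis using R_weight(1)[OF assms, of x y] R_weight(2)[OF assms, of x y]
      unfolding True phi_minus_eps(2) by linarith
  next
    case False
    then have i: "1 \<le> i + 1" "i + 1 \<le> n - 1" using assms by auto
    show ?thesis using R_weight(1)[OF assms, of x y] R_weight(1)[OF assms(1) i, of x y]
      unfolding phi_minus_eps(1)[OF False] by linarith
  qed
  then show ?thesis using * R_eps2[OF assms, of x y] by simp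
qed

lemma tact_R12:
  assumes "n \<ge> 3" "1 \<le> i" "i \<le> n - 1"
  shows "R12 n (tact n i c p) = tact n i c (R12 n p)" "V12 n (tact n i c p) = V12 n p"
proof -
  obtain x y z where p: "p = (x, y, z)" by (cases p)
  define d where "d = pl c (phi2 n i x y) (eps n i z)"
  note C = PL_commute[where u = x and v = y and c = d, OF assms refl refl, unfolded pleft_pl]
  show "R12 n (tact n i c p) = tact n i c (R12 n p)"
    unfolding p tact.simps R12.simps Let_def R_phi2[OF assms] d_def[symmetric] C ..
  show "V12 n (tact n i c p) = V12 n p"
    unfolding p tact.simps V12.simps Let_def d_def[symmetric] C ..
qed

lemma tact_R23:
  assumes "n \<ge> 3" "1 \<le> i" "i \<le> n - 1"
  shows "R23 n (tact n i c p) = tact n i c (R23 n p)" "V23 n (tact n i c p) = V23 n p"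
proof -
  obtain x y z where p: "p = (x, y, z)" by (cases p)
  define d where "d = c - pl c (phi n i x) (eps2 n i y z)"
  note C = PL_commute[where u = y and v = z and c = d, OF assms refl refl, unfolded pleft_pl]
  show "R23 n (tact n i c p) = tact n i c (R23 n p)"
    unfolding p R23.simps tact_right Let_def R_eps2[OF assms] d_def[symmetric] C ..
  show "V23 n (tact n i c p) = V23 n p"
    unfolding p V23.simps tact_right Let_def d_def[symmetric] C ..
qed

lemma map3_R:
  assumes "n \<ge> 3"
  shows "R12 n (map3 sigma1 p) = map3 sigma1 (R12 n p)" "R23 n (map3 sigma1 p) = map3 sigma1 (R23 n p)"
    "R12 n (map3 (sigman n) p) = map3 (sigman n) (R12 n p)" "R23 n (map3 (sigman n) p) = map3 (sigman n) (R23 n p)"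
    "V12 n (map3 (sigman n) p) = V12 n p" "V23 n (map3 (sigman n) p) = V23 n p"
  by (cases p; simp add: R_sigma1[OF assms] R_sigman[OF assms] PL_V_sigman(1)[OF assms])+

text \<open>The V_0 summed on each side belong to the two crossings of the first factor on its way
  to the right end. Lengths are preserved, so equality of these sums is equality of the energies
  v^*_0 on that line.\<close>

definition yang_baxter :: "nat \<Rightarrow> triple \<Rightarrow> bool" where
  "yang_baxter n p \<longleftrightarrow> R12 n (R23 n (R12 n p)) = R23 n (R12 n (R23 n p))
    \<and> V12 n p + V23 n (R12 n p) = V12 n (R23 n p) + V23 n (R12 n (R23 n p))"

lemma yang_baxter_tact:
  assumes "n \<ge> 3" "1 \<le> i" "i \<le> n - 1" "yang_baxter n p"
  shows "yang_baxter n (tact n i c p)"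
  using assms(4) unfolding yang_baxter_def tact_R12[OF assms(1-3)] tact_R23[OF assms(1-3)] by simp

lemma yang_baxter_sigman: "n \<ge> 3 \<Longrightarrow> yang_baxter n p \<Longrightarrow> yang_baxter n (map3 (sigman n) p)"
  unfolding yang_baxter_def by (simp add: map3_R)

text \<open>Compare the first unbarred entry x_1 + V_0 - V^*_1 of the image before and after sigma1,
  which leaves V^*_1 invariant and exchanges the first entries.\<close>

lemma V_sigma1_diff:
  assumes "n \<ge> 3"
  shows "V n 0 (sigma1 x) (sigma1 y) = V n 0 x y + (snd (Rx' n x y) 1 - fst (Rx' n x y) 1) - (snd x 1 - fst x 1)"
proof -
  have n: "1 \<noteq> n" "1 \<le> (1::nat) \<and> 1 \<le> n - 1" "1 - 1 = (0::nat)" "1 \<le> n - 1" using assms by auto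
  have a: "fst (Rx' n (sigma1 x) (sigma1 y)) 1 = snd (Rx' n x y) 1"
    unfolding R_sigma1[OF assms] by (simp add: sigma1_def)
  have b: "fst (Rx' n u v) 1 = fst u 1 + V n 0 u v - Vstar n 1 u v" for u v
    unfolding Rx'_def fst_conv if_not_P[OF n(1)] if_P[OF n(2)] n(3) PL_V0_star[OF assms] ..
  have "fst (sigma1 x) 1 = snd x 1" by (simp add: sigma1_def)
  then show ?thesis using a b[of "sigma1 x" "sigma1 y"] b[of x y] Vstar_sigma1[OF assms order_refl n(4), of x y] by simp
qed

text \<open>By \<open>V_sigma1_diff\<close> the sum over the path of the first factor changes by a
  difference between its final and its initial weight. The final forms on the two sides agree by the
  Yang-Baxter equation itself.\<close>

lemma yang_baxter_sigma1:
  assumes "n \<ge> 3" "yang_baxter n p"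
  shows "yang_baxter n (map3 sigma1 p)"
proof -
  obtain x y z where p: "p = (x, y, z)" by (cases p)
  have e: "R12 n (R23 n (R12 n p)) = R23 n (R12 n (R23 n p))"
    and v: "V12 n p + V23 n (R12 n p) = V12 n (R23 n p) + V23 n (R12 n (R23 n p))"
    using assms(2) by (auto simp: yang_baxter_def)
  have "Rx' n (Rx' n x y) z = Rx' n (Rx' n x (Ry' n y z)) (Rx' n y z)"
    using e unfolding p by simp
  then have "V12 n (map3 sigma1 p) + V23 n (R12 n (map3 sigma1 p)) =
    V12 n (R23 n (map3 sigma1 p)) + V23 n (R12 n (R23 n (map3 sigma1 p)))"
    using v unfolding map3_R[OF assms(1)] unfolding p by (simp add: V_sigma1_diff[OF assms(1)])
  then show ?thesis unfolding yang_baxter_def using e by (simp add: map3_R[OF assms(1)])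
qed

subsection \<open>Connectedness\<close>

text \<open>Each step applies \<open>f\<^sub>k\<close> as often as possible, and \<open>sigman\<close> for \<open>k = n\<close>. Along \<open>word n\<close> the last
  factor of a triple is taken to the vacuum \<open>ux\<close>. If it was \<open>sigma1 (ux m)\<close> to begin with, then
  \<open>eps\<close> vanishes at each step on its way (it is \<open>good\<close>), so that by the signature rule the steps act
  with full strength on the factor before it as well. Alternating with \<open>sigma1\<close> thus takes all
  three factors to vacua.\<close>

definition word :: "nat \<Rightarrow> nat list" where
  "word n = [1..<n] @ n # rev [1..<n]"

definition step :: "nat \<Rightarrow> nat \<Rightarrow> coords \<Rightarrow> coords" where
  "step n k x = (if k = n then sigman n x else pe n k (- phi n k x) x)"

definition step3 :: "nat \<Rightarrow> nat \<Rightarrow> triple \<Rightarrow> triple" where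
  "step3 n k p = (if k = n then map3 (sigman n) p else tact n k (- phi3 n k p) p)"

fun good :: "nat \<Rightarrow> coords \<Rightarrow> nat list \<Rightarrow> bool" where
  "good n z [] = True"
| "good n z (k # ks) = ((k \<noteq> n \<longrightarrow> eps n k z = 0) \<and> good n (step n k z) ks)"

lemma good_append: "good n z (a @ b) \<longleftrightarrow> good n z a \<and> good n (fold (step n) a z) b"
  by (induction a arbitrary: z) auto

definition ux :: "int \<Rightarrow> coords" where
  "ux l = (\<lambda>_. 0, \<lambda>i. if i = 1 then l else 0)"

lemma step_eq:
  assumes "k < n - 1" "x \<in> Bx n l" "1 \<le> k"
  shows "fst (step n k x) = (fst x)(k := 0, k+1 := fst x (k+1) + fst x k)"
    "snd (step n k x) = (snd x)(k := snd x k + max 0 (snd x (k+1) - fst x (k+1)), k+1 := min (fst x (k+1)) (snd x (k+1)))"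
proof -
  have k: "k \<noteq> n" "k \<noteq> n - 1" using assms by auto
  have nn: "fst x k \<ge> 0" using assms by (auto simp: Bx_def)
  have ph: "phi n k x = fst x k + max 0 (snd x (k+1) - fst x (k+1))"
    unfolding phi_def if_not_P[OF k(2)] ..
  have "pxi k (- phi n k x) x = - max 0 (snd x (k+1) - fst x (k+1))"
    unfolding pxi_def ph using nn by (auto simp: max_def)
  then show "fst (step n k x) = (fst x)(k := 0, k+1 := fst x (k+1) + fst x k)"
    "snd (step n k x) = (snd x)(k := snd x k + max 0 (snd x (k+1) - fst x (k+1)), k+1 := min (fst x (k+1)) (snd x (k+1)))"
    unfolding step_def if_not_P[OF k(1)] pe_def if_not_P[OF k(2)] ph by (auto simp: fun_eq_iff)
qed

lemma step_last:
  assumes "n \<ge> 3"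
  shows "fst (step n (n-1) x) = (fst x)(n-1 := 0, n := fst x n + fst x (n-1))" "snd (step n (n-1) x) = snd x"
proof -
  have k: "n - 1 \<noteq> n" using assms by auto
  then show "fst (step n (n-1) x) = (fst x)(n-1 := 0, n := fst x n + fst x (n-1))" "snd (step n (n-1) x) = snd x"
    unfolding step_def if_not_P[OF k] pe_def phi_def by auto
qed

lemma step_Bx:
  assumes "n \<ge> 3" "1 \<le> k" "k \<le> n" "x \<in> Bx n l"
  shows "step n k x \<in> Bx n l"
proof (cases "k = n")
  case True
  then show ?thesis using sigman_Bx[OF assms(1,4)] by (simp add: step_def)
next
  case False
  then have k: "k \<le> n - 1" using assms by simp
  note N = phi_eps_nonneg[OF assms(1,2) k assms(4)]
  show ?thesis unfolding step_def if_not_P[OF False] by (rule Bx_pe[OF assms(1,2) k assms(4)]) (use N in auto)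
qed

lemma fold_step_Bx:
  assumes "n \<ge> 3" "set ks \<subseteq> {1..n}" "x \<in> Bx n l"
  shows "fold (step n) ks x \<in> Bx n l"
  using assms(2,3)
proof (induction ks arbitrary: x)
  case (Cons k ks)
  then show ?case using step_Bx[OF assms(1), of k x] by auto
qed simp

text \<open>Step k empties x_k into x_{k+1} and leaves the preceding unbarred entries alone.\<close>

lemma fold_up:
  assumes "n \<ge> 3" "x \<in> Bx n l" "1 \<le> k" "k \<le> n"
  shows "\<forall>j<k. fst (fold (step n) [1..<k] x) j = 0"
  using assms(3,4)
proof (induction k)
  case (Suc k)
  let ?y = "fold (step n) [1..<k] x"
  show ?case
  proof (cases "k = 0")
    case False
    then have IH: "\<forall>j<k. fst ?y j = 0" using Suc by auto
    have y: "?y \<in> Bx n l" using Suc by (intro fold_step_Bx assms(1,2)) auto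
    have "fst (step n k ?y) = (fst ?y)(k := 0, k+1 := fst ?y (k+1) + fst ?y k)"
    proof (cases "k = n - 1")
      case True
      then show ?thesis using step_last(1)[OF assms(1), of ?y] assms(1) by simp
    next
      case F: False
      then show ?thesis using Suc False by (intro step_eq(1)[OF _ y]) auto
    qed
    then have "\<forall>j<Suc k. fst (step n k ?y) j = 0" using IH by (auto simp: less_Suc_eq)
    then show ?thesis using False by simp
  next
    case True
    then show ?thesis using assms(2) by (auto simp: Bx_def)
  qed
qed simp

text \<open>In the absence of unbarred entries, step k moves the whole of the barred entry k + 1 to
  the barred entry k.\<close>

lemma fold_down:
  assumes "n \<ge> 3" "x \<in> Bx n l" "1 \<le> k" "k \<le> n - 1" "\<forall>j. fst x j = 0" "\<forall>j>k. snd x j = 0"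
  shows "fold (step n) (rev [1..<k]) x = ux l"
  using assms(2-6)
proof (induction k arbitrary: x)
  case (Suc k)
  show ?case
  proof (cases "k = 0")
    case True
    have "snd x 1 = l"
    proof -
      have "1 \<in> {1..n-1}" using assms(1) by auto
      then have "(\<Sum>i=1..n-1. fst x i + snd x i) = snd x 1"
        using Suc.prems True by (subst sum.remove[of _ 1]) auto
      then show ?thesis using Suc.prems by (simp add: Bx_def ell_def)
    qed
    moreover have "snd x 0 = 0" using Suc.prems by (auto simp: Bx_def)
    ultimately have "snd x j = (if j = 1 then l else 0)" for j
      using Suc.prems(5) True by (cases "j = 0"; cases "j = 1") auto
    then have "x = ux l" using Suc.prems(4) by (auto simp: ux_def prod_eq_iff)
    then show ?thesis using True by simp
  next
    case False
    let ?y = "step n k x"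
    have k: "k < n - 1" "1 \<le> k" using Suc.prems False by auto
    have y: "?y \<in> Bx n l" using k by (intro step_Bx assms(1) Suc.prems(1)) auto
    have "snd x (k+1) \<ge> 0" using Suc.prems k by (auto simp: Bx_def)
    then have "\<forall>j. fst ?y j = 0" "\<forall>j>k. snd ?y j = 0"
      unfolding step_eq[OF k(1) Suc.prems(1) k(2)] using Suc.prems(4,5) by auto
    from Suc.IH[OF y k(2) _ this] have "fold (step n) (rev [1..<k]) ?y = ux l" using k by simp
    then show ?thesis using False by simp
  qed
qed simp

text \<open>After the ascending part x_n is the only unbarred entry that can be nonzero.
  \<open>sigman\<close> copies it to x_{n-1} and reverses its sign at n, and step n - 1 adds the two
  to 0. The descending part then collects everything in the barred first entry.\<close>

lemma fold_word:
  assumes "n \<ge> 3" "x \<in> Bx n l"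
  shows "fold (step n) (word n) x = ux l"
proof -
  let ?y = "fold (step n) [1..<n] x"
  have 1: "\<forall>j<n. fst ?y j = 0" by (rule fold_up[OF assms]) (use assms(1) in auto)
  have y: "?y \<in> Bx n l" by (intro fold_step_Bx assms) auto
  let ?z = "step n n ?y"
  have z: "?z \<in> Bx n l" using assms(1) by (intro step_Bx assms(1) y) auto
  have zz: "?z = sigman n ?y" by (simp add: step_def)
  let ?w = "step n (n-1) ?z"
  have w: "?w \<in> Bx n l" using assms(1) by (intro step_Bx assms(1) z) auto
  have "fst ?w j = 0" for j
  proof -
    consider "j = n" | "j = n - 1" | "j < n" "j \<noteq> n - 1" | "j > n" by linarith
    then show ?thesis
    proof cases
      case 1
      then show ?thesis using assms(1) \<open>\<forall>j<n. fst ?y j = 0\<close> unfolding step_last[OF assms(1)] zz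
        by (simp add: sigman_nth[OF assms(1), simplified])
    next
      case 2
      have "n - 1 \<noteq> n" using assms(1) by simp
      then show ?thesis unfolding 2 step_last[OF assms(1)] by (simp only: fun_upd_apply if_False if_True refl)
    next
      case 3
      then show ?thesis using 1 unfolding step_last[OF assms(1)] zz
        using sigman_nth(4)[OF assms(1), of j ?y] by simp
    next
      case 4
      then show ?thesis using w by (auto simp: Bx_def)
    qed
  qed
  moreover have "\<forall>j>n-1. snd ?w j = 0" using w by (auto simp: Bx_def)
  ultimately have "fold (step n) (rev [1..<n-1]) ?w = ux l"
    by (intro fold_down[OF assms(1) w]) (use assms(1) in auto)
  moreover have "[1..<n] = [1..<n-1] @ [n-1]" using assms(1) upt_Suc_append[of 1 "n-1"] by simp
  ultimately show ?thesis unfolding word_def by simp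
qed

definition unb :: "nat \<Rightarrow> int \<Rightarrow> coords" where
  "unb i m = (\<lambda>j. if j = i then m else 0, \<lambda>_. 0)"

definition bar :: "nat \<Rightarrow> int \<Rightarrow> coords" where
  "bar i m = (\<lambda>_. 0, \<lambda>j. if j = i then m else 0)"

lemma sigma1_ux: "sigma1 (ux m) = unb 1 m"
  by (auto simp: ux_def unb_def sigma1_def fun_eq_iff)

lemma ell_ux [simp]: "n \<ge> 3 \<Longrightarrow> ell n (ux m) = m"
proof -
  assume "n \<ge> 3"
  then have "1 \<in> {1..n-1}" by auto
  then have "(\<Sum>i=1..n-1. fst (ux m) i + snd (ux m) i) = m"
    by (simp add: ux_def)
  then show ?thesis by (simp add: ell_def) (simp add: ux_def)
qed

lemma ux_Bx: "n \<ge> 3 \<Longrightarrow> m \<ge> 0 \<Longrightarrow> ux m \<in> Bx n m"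
  using ell_ux[of n m] by (auto simp: Bx_def ux_def)

lemma step_unb:
  assumes "n \<ge> 3" "1 \<le> k" "k \<le> n - 1" "m \<ge> 0"
  shows "step n k (unb k m) = unb (k+1) m" "eps n k (unb k m) = 0"
proof -
  have k: "k \<noteq> n" "k + 1 = n \<longleftrightarrow> k = n - 1" using assms by auto
  have "step n k (unb k m) = unb (k+1) m \<and> eps n k (unb k m) = 0"
  proof (cases "k = n - 1")
    case True
    then have n: "k + 1 = n" using k by simp
    show ?thesis unfolding step_def if_not_P[OF k(1)] pe_def if_P[OF True] phi_def eps_def
      unfolding n using k(1) by (auto simp: unb_def fun_eq_iff)
  next
    case False
    show ?thesis unfolding step_def if_not_P[OF k(1)] pe_def if_not_P[OF False] phi_def eps_def pxi_def
      using assms(4) by (auto simp: unb_def fun_eq_iff)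
  qed
  then show "step n k (unb k m) = unb (k+1) m" "eps n k (unb k m) = 0" by auto
qed

lemma step_bar:
  assumes "n \<ge> 3" "1 \<le> k" "k < n - 1" "m \<ge> 0"
  shows "step n k (bar (k+1) m) = bar k m" "eps n k (bar (k+1) m) = 0"
proof -
  have k: "k \<noteq> n" "k \<noteq> n - 1" using assms by auto
  show "step n k (bar (k+1) m) = bar k m" "eps n k (bar (k+1) m) = 0"
    unfolding step_def if_not_P[OF k(1)] pe_def if_not_P[OF k(2)] phi_def eps_def pxi_def
    using assms(4) by (auto simp: bar_def fun_eq_iff)
qed

lemma good_unb:
  assumes "n \<ge> 3" "m \<ge> 0" "1 \<le> k" "k \<le> n"
  shows "good n (unb 1 m) [1..<k] \<and> fold (step n) [1..<k] (unb 1 m) = unb k m"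
  using assms(3,4)
proof (induction k)
  case (Suc k)
  show ?case
  proof (cases "k = 0")
    case False
    then have k: "1 \<le> k" "k \<le> n - 1" using Suc.prems by auto
    have "good n (unb 1 m) [1..<k]" "fold (step n) [1..<k] (unb 1 m) = unb k m" using Suc.IH Suc.prems k by auto
    then show ?thesis using step_unb[OF assms(1) k assms(2)] k(1) by (simp add: good_append)
  qed simp
qed simp

lemma good_bar:
  assumes "n \<ge> 3" "m \<ge> 0" "1 \<le> k" "k \<le> n - 1"
  shows "good n (bar k m) (rev [1..<k])"
  using assms(3,4)
proof (induction k)
  case (Suc k)
  show ?case
  proof (cases "k = 0")
    case False
    then have k: "1 \<le> k" "k < n - 1" "k \<noteq> n" using Suc.prems by auto
    then show ?thesis using step_bar[OF assms(1) k(1,2) assms(2)] Suc.IH by simp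
  qed simp
qed simp

lemma good_word:
  assumes "n \<ge> 3" "m \<ge> 0"
  shows "good n (sigma1 (ux m)) (word n)"
proof -
  have u: "good n (unb 1 m) [1..<n]" "fold (step n) [1..<n] (unb 1 m) = unb n m"
    using good_unb[OF assms, of n] assms(1) by auto
  have nn: "n - 1 \<noteq> n" using assms(1) by simp
  let ?z = "step n n (unb n m)"
  have z: "fst ?z = (\<lambda>_. 0)(n - 1 := m, n := - m)" "snd ?z = (\<lambda>_. 0)(n - 1 := m)"
    using nn unfolding step_def sigman_def unb_def by auto
  have e: "eps n (n-1) ?z = 0" unfolding eps_def z using nn by auto
  have w: "step n (n-1) ?z = bar (n-1) m"
    using step_last[OF assms(1), of ?z] nn unfolding z by (auto simp: bar_def prod_eq_iff fun_eq_iff)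
  have r: "rev [1..<n] = (n-1) # rev [1..<n-1]" using assms(1) upt_Suc_append[of 1 "n-1"] by simp
  have "good n (bar (n-1) m) (rev [1..<n-1])" using assms by (intro good_bar) auto
  then have "good n (unb n m) (n # rev [1..<n])"
    unfolding r good.simps w using e by simp
  then show ?thesis unfolding sigma1_ux word_def good_append u(2) using u(1) by simp
qed

text \<open>The last factor always makes its full step. If its eps vanishes, nothing of the factor
  before it is cancelled in the signature, and that factor makes its full step too.\<close>

lemma step3_comp:
  assumes "n \<ge> 3" "1 \<le> k" "k \<le> n" "Bx3 n (x, y, z)"
  obtains x' y' where "step3 n k (x, y, z) = (x', y', step n k z)"
    "k = n \<or> eps n k z = 0 \<Longrightarrow> y' = step n k y"
    "k = n \<or> eps n k z = 0 \<Longrightarrow> k = n \<or> eps n k y = 0 \<Longrightarrow> x' = step n k x"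
proof (cases "k = n")
  case True
  show ?thesis by (rule that) (auto simp: True step3_def step_def)
next
  case False
  then have k: "k \<le> n - 1" using assms by simp
  obtain l1 l2 l3 where B: "x \<in> Bx n l1" "y \<in> Bx n l2" "z \<in> Bx n l3" using assms(4) by auto
  note N = phi_eps_nonneg[OF assms(1,2) k B(1)] phi_eps_nonneg[OF assms(1,2) k B(2)] phi_eps_nonneg[OF assms(1,2) k B(3)]
  define c where "c = - phi3 n k (x, y, z)"
  define c12 where "c12 = pl c (phi2 n k x y) (eps n k z)"
  define c1 where "c1 = pl c12 (phi n k x) (eps n k y)"
  have s: "step3 n k (x, y, z) = (pe n k c1 x, pe n k (c12 - c1) y, pe n k (c - c12) z)"
    unfolding step3_def if_not_P[OF False] c_def[symmetric] tact.simps Let_def c12_def c1_def ..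
  have st: "step n k u = pe n k (- phi n k u) u" for u unfolding step_def if_not_P[OF False] ..
  have 1: "c - c12 = - phi n k z" unfolding c12_def c_def phi3.simps pl_def using N by (auto simp: max_def)
  have 2: "c12 - c1 = - phi n k y" if "eps n k z = 0"
    unfolding c1_def c12_def c_def phi3.simps pl_def phi2_def that using N by (auto simp: max_def)
  have 3: "c1 = - phi n k x" if "eps n k z = 0" "eps n k y = 0"
    unfolding c1_def c12_def c_def phi3.simps pl_def phi2_def that using N by (auto simp: max_def)
  show ?thesis
    by (rule that[of "pe n k c1 x" "pe n k (c12 - c1) y"]) (use False 1 2 3 s st in auto)
qed

lemma step3_Bx3:
  assumes "n \<ge> 3" "1 \<le> k" "k \<le> n" "Bx3 n p"
  shows "Bx3 n (step3 n k p)"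
proof (cases "k = n")
  case True
  then show ?thesis using assms by (cases p) (auto simp: step3_def intro: sigman_Bx)
next
  case False
  then have k: "k \<le> n - 1" using assms by simp
  show ?thesis unfolding step3_def if_not_P[OF False]
    using phi_eps3_nonneg[OF assms(1,2) k assms(4)] by (intro tact_Bx3[OF assms(1,2) k assms(4)]) auto
qed

lemma fold_step3:
  assumes "n \<ge> 3" "set ks \<subseteq> {1..n}" "Bx3 n (x, y, z)"
  shows "\<exists>x' y'. fold (step3 n) ks (x, y, z) = (x', y', fold (step n) ks z) \<and>
    Bx3 n (x', y', fold (step n) ks z) \<and>
    (good n z ks \<longrightarrow> y' = fold (step n) ks y) \<and>
    (good n z ks \<longrightarrow> good n y ks \<longrightarrow> x' = fold (step n) ks x)"
  using assms(2,3)
proof (induction ks arbitrary: x y z)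
  case Nil
  then show ?case by (simp del: Bx3.simps)
next
  case (Cons k ks)
  have k: "1 \<le> k" "k \<le> n" "set ks \<subseteq> {1..n}" using Cons.prems by auto
  obtain x1 y1 where s: "step3 n k (x, y, z) = (x1, y1, step n k z)"
    "k = n \<or> eps n k z = 0 \<Longrightarrow> y1 = step n k y"
    "k = n \<or> eps n k z = 0 \<Longrightarrow> k = n \<or> eps n k y = 0 \<Longrightarrow> x1 = step n k x"
    using step3_comp[OF assms(1) k(1,2) Cons.prems(2)] by blast
  have B: "Bx3 n (x1, y1, step n k z)" using step3_Bx3[OF assms(1) k(1,2) Cons.prems(2)] unfolding s(1) .
  from Cons.IH[OF k(3) B] obtain x2 y2 where t: "fold (step3 n) ks (x1, y1, step n k z) = (x2, y2, fold (step n) ks (step n k z))"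
    "Bx3 n (x2, y2, fold (step n) ks (step n k z))"
    "good n (step n k z) ks \<Longrightarrow> y2 = fold (step n) ks y1"
    "good n (step n k z) ks \<Longrightarrow> good n y1 ks \<Longrightarrow> x2 = fold (step n) ks x1"
    by blast
  have a: "y2 = fold (step n) (k # ks) y" if "good n z (k # ks)"
  proof -
    have "y1 = step n k y" by (rule s(2)) (use that in auto)
    then show ?thesis using t(3) that by simp
  qed
  have b: "x2 = fold (step n) (k # ks) x" if "good n z (k # ks)" "good n y (k # ks)"
  proof -
    have "y1 = step n k y" by (rule s(2)) (use that in auto)
    moreover have "x1 = step n k x" by (rule s(3)) (use that in auto)
    ultimately show ?thesis using t(4) that by simp
  qed
  have f: "fold (step3 n) (k # ks) (x, y, z) = (x2, y2, fold (step n) (k # ks) z)"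
    using s(1) t(1) by simp
  have g: "Bx3 n (x2, y2, fold (step n) (k # ks) z)" using t(2) by simp
  show ?case using f g a b by blast
qed

lemma Bx_nonneg:
  assumes "n \<ge> 3" "x \<in> Bx n l"
  shows "l \<ge> 0"
proof -
  have n: "n - 1 \<in> {1..n-1}" using assms by auto
  have "fst x i + snd x i \<ge> 0" if "i \<in> {1..n-2}" for i
  proof -
    have "i \<in> {1..n-1}" using that by auto
    then show ?thesis using assms(2) unfolding Bx_def by force
  qed
  then have "(\<Sum>i=1..n-2. fst x i + snd x i) \<ge> 0" by (rule sum_nonneg)
  moreover have "fst x (n-1) \<ge> 0" "fst x n \<ge> - snd x (n-1)" "ell n x = l"
    using assms(2) n unfolding Bx_def by blast+
  ultimately show ?thesis using assms(1) by (simp add: ell_split)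
qed

text \<open>Every step can be undone by an operation under which \<open>P\<close> is closed, so
  \<open>P\<close> travels backwards along \<open>word n\<close>. \<open>A\<close>,
  \<open>A2\<close> and the final block are the three rounds in reverse order: two, one or none of
  the right factors are already vacua, and sigma1 is applied between the rounds.\<close>

lemma triple_induct:
  assumes n: "n \<ge> 3"
    and tact: "\<And>i c p. 1 \<le> i \<Longrightarrow> i \<le> n - 1 \<Longrightarrow> Bx3 n p \<Longrightarrow> - phi3 n i p \<le> c \<Longrightarrow> c \<le> eps3 n i p \<Longrightarrow> P p \<Longrightarrow> P (tact n i c p)"
    and s1: "\<And>p. Bx3 n p \<Longrightarrow> P p \<Longrightarrow> P (map3 sigma1 p)"
    and sn: "\<And>p. Bx3 n p \<Longrightarrow> P p \<Longrightarrow> P (map3 (sigman n) p)"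
    and base: "\<And>a b c. a \<ge> 0 \<Longrightarrow> b \<ge> 0 \<Longrightarrow> c \<ge> 0 \<Longrightarrow> P (ux a, ux b, ux c)"
    and p: "Bx3 n p"
  shows "P p"
proof -
  have n1: "n \<ge> 1" using n by simp
  have bwd1: "P p" if "1 \<le> k" "k \<le> n" "Bx3 n p" "P (step3 n k p)" for k p
  proof (cases "k = n")
    case True
    have "P (map3 (sigman n) (step3 n k p))" by (rule sn[OF step3_Bx3[OF n that(1-3)] that(4)])
    moreover have "map3 (sigman n) (step3 n k p) = p"
      using n1 by (cases p) (simp add: True step3_def)
    ultimately show ?thesis by simp
  next
    case False
    then have k: "k \<le> n - 1" using that by simp
    have st: "step3 n k p = tact n k (- phi3 n k p) p" by (simp add: step3_def False)
    have B: "Bx3 n (step3 n k p)" by (rule step3_Bx3[OF n that(1-3)])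
    have "P (tact n k (phi3 n k p) (step3 n k p))"
    proof (rule tact[OF that(1) k B _ _ that(4)])
      show "- phi3 n k (step3 n k p) \<le> phi3 n k p" "phi3 n k p \<le> eps3 n k (step3 n k p)"
        unfolding st phi3_tact[OF n1] using phi_eps3_nonneg[OF n that(1) k that(3)] by auto
    qed
    then show ?thesis unfolding st tact_tact[OF n1] by (simp add: tact_0[OF n1])
  qed
  have bwd: "P p" if "set ks \<subseteq> {1..n}" "Bx3 n p" "P (fold (step3 n) ks p)" for ks p
    using that
  proof (induction ks arbitrary: p)
    case (Cons k ks)
    have k: "1 \<le> k" "k \<le> n" using Cons.prems by auto
    have "P (step3 n k p)" by (rule Cons.IH) (use Cons.prems step3_Bx3[OF n k Cons.prems(2)] in auto)
    then show ?case using bwd1[OF k Cons.prems(2)] by simp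
  qed simp
  have w: "set (word n) \<subseteq> {1..n}" using n by (auto simp: word_def)
  have s1b: "P p" if "Bx3 n p" "P (map3 sigma1 p)" for p
  proof -
    have "Bx3 n (map3 sigma1 p)" using that(1) n by (cases p) (auto intro: sigma1_Bx)
    from s1[OF this that(2)] show ?thesis by (cases p) simp
  qed
  have A: "P (x, ux b, ux c)" if "Bx3 n (x, ux b, ux c)" "b \<ge> 0" "c \<ge> 0" for x b c
  proof (rule s1b[OF that(1)])
    let ?q = "(sigma1 x, sigma1 (ux b), sigma1 (ux c))"
    have B: "Bx3 n ?q" using that(1) n by (auto intro: sigma1_Bx)
    from fold_step3[OF n w B] obtain x' y' where f: "fold (step3 n) (word n) ?q = (x', y', fold (step n) (word n) (sigma1 (ux c)))"
      "good n (sigma1 (ux c)) (word n) \<longrightarrow> y' = fold (step n) (word n) (sigma1 (ux b))"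
      "good n (sigma1 (ux c)) (word n) \<longrightarrow> good n (sigma1 (ux b)) (word n) \<longrightarrow> x' = fold (step n) (word n) (sigma1 x)"
      by (elim exE conjE)
    have f': "y' = fold (step n) (word n) (sigma1 (ux b))" "x' = fold (step n) (word n) (sigma1 x)"
      using f(2,3) good_word[OF n that(2)] good_word[OF n that(3)] by blast+
    obtain l1 l2 l3 where l: "sigma1 x \<in> Bx n l1" "sigma1 (ux b) \<in> Bx n l2" "sigma1 (ux c) \<in> Bx n l3" using B by auto
    have "P (fold (step3 n) (word n) ?q)"
      unfolding f(1) f' fold_word[OF n l(1)] fold_word[OF n l(2)] fold_word[OF n l(3)] by (rule base) (use Bx_nonneg[OF n] l in auto)
    then show "P (map3 sigma1 (x, ux b, ux c))" using bwd[OF w B] by simp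
  qed
  have A2: "P (x, y, ux c)" if "Bx3 n (x, y, ux c)" "c \<ge> 0" for x y c
  proof (rule s1b[OF that(1)])
    let ?q = "(sigma1 x, sigma1 y, sigma1 (ux c))"
    have B: "Bx3 n ?q" using that(1) n by (auto intro: sigma1_Bx)
    obtain l1 l2 l3 where l: "sigma1 x \<in> Bx n l1" "sigma1 y \<in> Bx n l2" "sigma1 (ux c) \<in> Bx n l3" using B by auto
    from fold_step3[OF n w B] obtain x' y' where f: "fold (step3 n) (word n) ?q = (x', y', fold (step n) (word n) (sigma1 (ux c)))"
      "good n (sigma1 (ux c)) (word n) \<longrightarrow> y' = fold (step n) (word n) (sigma1 y)"
      "Bx3 n (x', y', fold (step n) (word n) (sigma1 (ux c)))"
      by (elim exE conjE)
    have f': "y' = fold (step n) (word n) (sigma1 y)"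
      using f(2) good_word[OF n that(2)] by blast
    have "P (fold (step3 n) (word n) ?q)"
      using f(3) unfolding f(1) f' fold_word[OF n l(2)] fold_word[OF n l(3)]
      by (rule A) (use Bx_nonneg[OF n] l in auto)
    then show "P (map3 sigma1 (x, y, ux c))" using bwd[OF w B] by simp
  qed
  obtain x y z where q: "p = (x, y, z)" by (cases p)
  obtain l where l: "z \<in> Bx n l" using p q by auto
  from fold_step3[OF n w p[unfolded q]]
  obtain x' y' where f: "fold (step3 n) (word n) p = (x', y', fold (step n) (word n) z)"
      "Bx3 n (x', y', fold (step n) (word n) z)"
    unfolding q[symmetric] by (elim exE conjE)
  have "P (fold (step3 n) (word n) p)"
    using f(2) unfolding f(1) fold_word[OF n l] by (rule A2) (use Bx_nonneg[OF n] l in auto)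
  then show ?thesis using bwd[OF w p] by simp
qed

subsection \<open>Tensor products with the vacuum\<close>

definition bsum :: "nat \<Rightarrow> coords \<Rightarrow> coords \<Rightarrow> int" where
  "bsum i u v = (\<Sum>k=1..i. snd v k - snd u k)"

definition usum :: "nat \<Rightarrow> coords \<Rightarrow> coords \<Rightarrow> int" where
  "usum i u v = (\<Sum>k=1..i. fst v k - fst u k)"

lemma sum_tail: "(j::nat) \<le> i \<Longrightarrow> (\<Sum>k=j+1..i. f k) = (\<Sum>k=1..i. f k) - (\<Sum>k=1..j. f k :: int)"
  using sum.ub_add_nat[of 1 j f "i - j"] by simp

lemma theta_eq: "theta n i j u v = (if j \<le> i then ell n u else ell n v) + bsum i u v - bsum j u v"
proof -
  have "(\<Sum>k=i+1..j. snd u k - snd v k) = - (\<Sum>k=i+1..j. snd v k - snd u k)"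
    by (simp add: sum_negf[symmetric])
  then show ?thesis
    by (simp add: theta_def bsum_def sum_tail del: add_Suc_right One_nat_def Suc_eq_plus1 Suc_eq_plus1_left)
qed

lemma theta'_eq: "theta' n i j u v = ell n u + bsum i u v + usum j u v"
  by (simp add: theta'_def bsum_def usum_def)

lemma eta_eq:
  assumes "i \<le> n - 1"
  shows "eta n i j u v = (if j \<le> n - 1 then theta n i j u v + snd v j - fst u j
     else ell n v + bsum i u v - bsum (n-1) u v + fst u n)"
proof (cases "j \<le> n - 1")
  case True
  then show ?thesis by (simp add: eta_def theta_def)
next
  case False
  have "(\<Sum>k=i+1..n-1. snd u k - snd v k) = - (\<Sum>k=i+1..n-1. snd v k - snd u k)"
    unfolding sum_negf[symmetric] by (intro sum.cong) auto
  also have "\<dots> = bsum i u v - bsum (n-1) u v"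
    unfolding sum_tail[OF assms] bsum_def by simp
  finally show ?thesis using False assms by (simp add: eta_def)
qed

lemma eta'_eq: "eta' n i j u v = (if j \<le> n - 1 then theta' n i j u v + fst u j - snd v j
    else theta' n i (n-1) u v + (if i = n - 1 then ell n u - ell n v else 0) - fst u n)"
  by (simp add: eta'_def theta'_def)

text \<open>In every application the maximum is attained at j = 1, in an unprimed or a primed eta
  term, because the vacuum letter carries index 1.\<close>

lemma V_eqI:
  assumes n: "n \<ge> 3" and i: "i \<le> n - 1"
    and "\<And>j. 1 \<le> j \<Longrightarrow> j \<le> n - 1 \<Longrightarrow> theta n i j u v + snd v j - fst u j \<le> T"
    and "\<And>j. 1 \<le> j \<Longrightarrow> j \<le> n - 1 \<Longrightarrow> theta' n i j u v + fst u j - snd v j \<le> T"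
    and "\<And>j. 1 \<le> j \<Longrightarrow> j \<le> n - 2 \<Longrightarrow> theta n i j u v \<le> T"
    and "\<And>j. 1 \<le> j \<Longrightarrow> j \<le> n - 2 \<Longrightarrow> theta' n i j u v \<le> T"
    and "ell n v + bsum i u v - bsum (n-1) u v + fst u n \<le> T"
    and "theta' n i (n-1) u v + (if i = n - 1 then ell n u - ell n v else 0) - fst u n \<le> T"
    and at: "theta n i 1 u v + snd v 1 - fst u 1 = T \<or> theta' n i 1 u v + fst u 1 - snd v 1 = T"
  shows "V n i u v = T"
  unfolding V_def
proof (rule Max_eqI)
  have "1 \<in> {1..n}" "1 \<le> n - 1" using n by auto
  then have "eta n i 1 u v = T \<or> eta' n i 1 u v = T" using at by (simp add: eta_eq[OF i] eta'_eq)
  with \<open>1 \<in> {1..n}\<close> show "T \<in> (\<lambda>j. theta n i j u v) ` {1..n - 2} \<union> (\<lambda>j. theta' n i j u v) ` {1..n - 2} \<union>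
      (\<lambda>j. eta n i j u v) ` {1..n} \<union> (\<lambda>j. eta' n i j u v) ` {1..n}"
    by (metis UnI1 UnI2 imageI)
next
  fix z
  assume "z \<in> (\<lambda>j. theta n i j u v) ` {1..n - 2} \<union> (\<lambda>j. theta' n i j u v) ` {1..n - 2} \<union>
      (\<lambda>j. eta n i j u v) ` {1..n} \<union> (\<lambda>j. eta' n i j u v) ` {1..n}"
  moreover have "eta n i j u v \<le> T" "eta' n i j u v \<le> T" if "j \<in> {1..n}" for j
    using assms(3,4)[of j] assms(7,8) that by (auto simp: eta_eq[OF i] eta'_eq)
  ultimately show "z \<le> T" using assms(5,6) by auto
qed auto

locale at_ux =
  fixes n :: nat and x :: coords and l m :: int
  assumes n: "n \<ge> 3" and x: "x \<in> Bx n l" and m: "m \<ge> 0"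
begin

definition "sx i = (\<Sum>k=1..i. fst x k)"
definition "sX i = (\<Sum>k=1..i. snd x k)"

lemma nonneg: "1 \<le> i \<Longrightarrow> i \<le> n - 1 \<Longrightarrow> fst x i \<ge> 0" "1 \<le> i \<Longrightarrow> i \<le> n - 1 \<Longrightarrow> snd x i \<ge> 0"
  using x by (auto simp: Bx_def)

lemma n1: "1 \<le> n - 1" "1 \<le> n" "1 \<noteq> n - 1" "1 \<noteq> n" "n - 1 \<noteq> n" "\<not> n \<le> n - 1" using n by auto

lemma last: "fst x (n-1) + fst x n \<ge> 0" "snd x (n-1) + fst x n \<ge> 0"
  using x by (auto simp: Bx_def)

lemma l_eq: "l = sx (n-1) + sX (n-1) + fst x n"
  using x by (auto simp: Bx_def ell_def sx_def sX_def sum.distrib)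

lemma s_mono: "i \<le> j \<Longrightarrow> j \<le> n - 1 \<Longrightarrow> sx i \<le> sx j" "i \<le> j \<Longrightarrow> j \<le> n - 1 \<Longrightarrow> sX i \<le> sX j"
  unfolding sx_def sX_def by (intro sum_mono2; auto intro!: nonneg)+

lemma s_1: "sx 1 = fst x 1" "sX 1 = snd x 1" "sx 0 = 0" "sX 0 = 0"
  "sx (Suc 0) = fst x (Suc 0)" "sX (Suc 0) = snd x (Suc 0)"
  by (auto simp: sx_def sX_def)

lemma s_Suc: "1 \<le> i \<Longrightarrow> sx i = sx (i-1) + fst x i" "1 \<le> i \<Longrightarrow> sX i = sX (i-1) + snd x i"
  unfolding sx_def sX_def by (cases i; simp)+

lemma ge1: "1 \<le> j \<Longrightarrow> j \<le> n - 1 \<Longrightarrow> fst x 1 \<le> sx j" "1 \<le> j \<Longrightarrow> j \<le> n - 1 \<Longrightarrow> snd x 1 \<le> sX j"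
  using s_mono[of 1 j] s_1 by auto

lemma ge2: "2 \<le> j \<Longrightarrow> j \<le> n - 1 \<Longrightarrow> fst x 1 + fst x j \<le> sx j" "2 \<le> j \<Longrightarrow> j \<le> n - 1 \<Longrightarrow> snd x 1 + snd x j \<le> sX j"
  using s_mono[of 1 "j-1"] s_1 s_Suc[of j] by auto

lemma top: "fst x 1 + sX (n-1) \<le> l" "fst x 1 + sX (n-1) + fst x n \<le> l"
proof -
  have "2 \<le> n - 1" using n by simp
  from ge2(1)[OF this] show "fst x 1 + sX (n-1) \<le> l" using l_eq last by simp
  show "fst x 1 + sX (n-1) + fst x n \<le> l" using ge1(1)[of "n-1"] n1 l_eq by simp
qed

lemma ux_nth: "fst (ux m) k = 0" "snd (ux m) k = (if k = 1 then m else 0)"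
  by (auto simp: ux_def)

lemma ell_x: "ell n x = l" using x by (simp add: Bx_def)

lemma sum_if1: "(\<Sum>k=1..i. if k = (1::nat) then c else 0) = (if i = 0 then 0 else c :: int)"
  by (simp add: sum.delta')

text \<open>The maximum is the unprimed eta term with j = 1, and \<open>big\<close> lets it dominate
  the others. For \<open>Vstar\<close> below it is the primed one.\<close>

lemma V_x_ux:
  assumes big: "m + snd x 1 \<ge> l" and i: "1 \<le> i" "i \<le> n - 1"
  shows "V n i x (ux m) = m + l - fst x 1 + snd x 1 - sX i"
proof -
  have D: "bsum j x (ux m) = m - sX j" if "1 \<le> j" for j
    using that unfolding bsum_def ux_nth sum_subtractf sum_if1 sX_def by simp
  have E: "usum j x (ux m) = - sx j" for j
    unfolding usum_def ux_nth sx_def by (simp add: sum_negf)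
  note S = top ge1[OF i] n1 m last ell_ux[OF n] ell_x
  have T1: "theta n i j x (ux m) + snd (ux m) j - fst x j \<le> m + l - fst x 1 + snd x 1 - sX i"
    if j: "1 \<le> j" "j \<le> n - 1" for j
  proof (cases "j = 1")
    case True
    then show ?thesis using S i unfolding theta_eq D[OF i(1)] D[OF j(1)] ux_nth by (simp add: s_1)
  next
    case False
    then show ?thesis using S big ge2[of j] s_mono(2)[OF j(2) order_refl] j nonneg[OF j] nonneg[OF order_refl n1(1)]
      unfolding theta_eq D[OF i(1)] D[OF j(1)] ux_nth by simp
  qed
  have T2: "theta' n i j x (ux m) + fst x j - snd (ux m) j \<le> m + l - fst x 1 + snd x 1 - sX i"
    if j: "1 \<le> j" "j \<le> n - 1" for j
  proof (cases "j = 1")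
    case True
    then show ?thesis using S big s_mono(2)[OF n1(1) order_refl] nonneg[OF order_refl n1(1)]
      unfolding theta'_eq D[OF i(1)] E ux_nth by (simp add: s_1)
  next
    case False
    then show ?thesis using S ge2[of j] j nonneg[OF j] nonneg[OF order_refl n1(1)]
      unfolding theta'_eq D[OF i(1)] E ux_nth by simp
  qed
  show ?thesis
  proof (rule V_eqI[OF n i(2) T1 T2])
    fix j assume j: "1 \<le> j" "j \<le> n - 2"
    then have j': "j \<le> n - 1" by simp
    show "theta n i j x (ux m) \<le> m + l - fst x 1 + snd x 1 - sX i"
      using S big s_mono(2)[OF j' order_refl] nonneg[OF order_refl n1(1)] ge1[OF j(1) j']
      unfolding theta_eq D[OF i(1)] D[OF j(1)] by simp
    show "theta' n i j x (ux m) \<le> m + l - fst x 1 + snd x 1 - sX i"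
      using S ge1[OF j(1) j'] nonneg[OF order_refl n1(1)] unfolding theta'_eq D[OF i(1)] E by simp
  next
    show "ell n (ux m) + bsum i x (ux m) - bsum (n - 1) x (ux m) + fst x n \<le> m + l - fst x 1 + snd x 1 - sX i"
      using S nonneg[OF order_refl n1(1)] unfolding D[OF i(1)] D[OF n1(1)] by simp
    show "theta' n i (n-1) x (ux m) + (if i = n - 1 then ell n x - ell n (ux m) else 0) - fst x n \<le> m + l - fst x 1 + snd x 1 - sX i"
    proof (cases "i = n - 1")
      case True
      show ?thesis using S big l_eq nonneg[OF order_refl n1(1)] unfolding theta'_eq D[OF i(1)] E if_P[OF True] unfolding True by simp
    next
      case False
      have "2 \<le> n - 1" using n by simp
      from ge2[OF this] show ?thesis using S nonneg[OF order_refl n1(1)] unfolding theta'_eq D[OF i(1)] E if_not_P[OF False] by simp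
    qed
    show "theta n i 1 x (ux m) + snd (ux m) 1 - fst x 1 = m + l - fst x 1 + snd x 1 - sX i \<or>
      theta' n i 1 x (ux m) + fst x 1 - snd (ux m) 1 = m + l - fst x 1 + snd x 1 - sX i"
      using S i unfolding theta_eq D[OF i(1)] D[OF order_refl] ux_nth by (simp add: s_1)
  qed
qed

lemma star_nth: "1 \<le> k \<Longrightarrow> k \<le> n - 1 \<Longrightarrow> fst (star n u) k = snd u k" "1 \<le> k \<Longrightarrow> k \<le> n - 1 \<Longrightarrow> snd (star n u) k = fst u k"
   "fst (star n u) n = fst u n"
  using n by (auto simp: star_def)

lemma ell_star: "ell n (star n u) = ell n u"
proof -
  have "(\<Sum>i=1..n-1. fst (star n u) i + snd (star n u) i) = (\<Sum>i=1..n-1. fst u i + snd u i)"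
    by (intro sum.cong refl) (simp add: star_nth)
  then show ?thesis unfolding ell_def star_nth(3) by simp
qed

lemma Vstar_x_ux:
  assumes big: "m + snd x 1 \<ge> l" and i: "i \<le> n - 1"
  shows "Vstar n i x (ux m) = m + snd x 1 - fst x 1 + sx i"
proof -
  let ?u = "star n (ux m)" and ?v = "star n x"
  have D: "bsum j ?u ?v = sx j" if "j \<le> n - 1" for j
    unfolding bsum_def sx_def using that by (intro sum.cong) (auto simp: star_nth ux_nth)
  have E: "usum j ?u ?v = sX j - m" if "1 \<le> j" "j \<le> n - 1" for j
  proof -
    have "usum j ?u ?v = (\<Sum>k=1..j. snd x k - (if k = 1 then m else 0))"
      unfolding usum_def using that by (intro sum.cong) (auto simp: star_nth ux_nth)
    then show ?thesis using that unfolding sum_subtractf sum_if1 sX_def by simp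
  qed
  have el: "ell n ?u = m" "ell n ?v = l" unfolding ell_star using ell_ux[OF n] ell_x by auto
  have un: "fst ?u n = 0" "fst ?v n = fst x n" by (auto simp: star_nth ux_nth)
  note S = top n1 m last big nonneg[OF order_refl n1(1)]
  have i0: "sx i \<ge> 0" using s_mono(1)[of 0 i] i s_1 by simp
  have T1: "theta n i j ?u ?v + snd ?v j - fst ?u j \<le> m + snd x 1 - fst x 1 + sx i"
    if j: "1 \<le> j" "j \<le> n - 1" for j
  proof (cases "j = 1")
    case True
    have "fst x 1 \<le> m" using S ge1(2)[of "n-1"] by simp
    then show ?thesis using True S i0 unfolding theta_eq D[OF i] D[OF j(2)] star_nth(1,2)[OF j] ux_nth el by (auto simp: s_1)
  next
    case False
    have "j \<le> i \<Longrightarrow> sx j \<le> sx i" using s_mono(1) i by simp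
    then show ?thesis using False S ge2[of j] j nonneg[OF j]
      unfolding theta_eq D[OF i] D[OF j(2)] star_nth(1,2)[OF j] ux_nth el by auto
  qed
  have T2: "theta' n i j ?u ?v + fst ?u j - snd ?v j \<le> m + snd x 1 - fst x 1 + sx i"
    if j: "1 \<le> j" "j \<le> n - 1" for j
  proof (cases "j = 1")
    case True
    then show ?thesis using S unfolding theta'_eq D[OF i] E[OF j] star_nth(1,2)[OF j] ux_nth el by (simp add: s_1)
  next
    case False
    then show ?thesis using S j nonneg[OF j] s_mono(2)[OF j(2) order_refl]
      unfolding theta'_eq D[OF i] E[OF j] star_nth(1,2)[OF j] ux_nth el by simp
  qed
  show ?thesis unfolding Vstar_def
  proof (rule V_eqI[OF n i T1 T2])
    fix j assume j: "1 \<le> j" "j \<le> n - 2"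
    then have j': "j \<le> n - 1" by simp
    have "j \<le> i \<Longrightarrow> sx j \<le> sx i" using s_mono(1) i by simp
    then show "theta n i j ?u ?v \<le> m + snd x 1 - fst x 1 + sx i"
      using S ge1[OF j(1) j'] unfolding theta_eq D[OF i] D[OF j'] el by auto
    show "theta' n i j ?u ?v \<le> m + snd x 1 - fst x 1 + sx i"
      using S s_mono(2)[OF j' order_refl] unfolding theta'_eq D[OF i] E[OF j(1) j'] el by simp
  next
    show "ell n ?v + bsum i ?u ?v - bsum (n - 1) ?u ?v + fst ?u n \<le> m + snd x 1 - fst x 1 + sx i"
      using S ge1[OF n1(1) order_refl] unfolding D[OF i] D[OF order_refl] el un by simp
    show "theta' n i (n-1) ?u ?v + (if i = n - 1 then ell n ?u - ell n ?v else 0) - fst ?u n \<le> m + snd x 1 - fst x 1 + sx i"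
    proof (cases "i = n - 1")
      case True
      have "2 \<le> n - 1" using n by simp
      from ge2(1)[OF this] show ?thesis using S l_eq unfolding theta'_eq D[OF i] E[OF n1(1) order_refl] el un if_P[OF True] unfolding True by simp
    next
      case False
      then show ?thesis using S unfolding theta'_eq D[OF i] E[OF n1(1) order_refl] el un if_not_P[OF False] by simp
    qed
    show "theta n i 1 ?u ?v + snd ?v 1 - fst ?u 1 = m + snd x 1 - fst x 1 + sx i \<or>
      theta' n i 1 ?u ?v + fst ?u 1 - snd ?v 1 = m + snd x 1 - fst x 1 + sx i"
      unfolding theta'_eq D[OF i] E[OF order_refl n1(1)] star_nth(1,2)[OF order_refl n1(1)] ux_nth el by (simp add: s_1)
  qed
qed

text \<open>The ingredient still missing for W_1. After sigma1 the right factor consists of unbarred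
  letters 1, and the primed eta term with j = 1 attains the maximum whatever the size of m.\<close>

lemma V0_sigma1_ux: "V n 0 (sigma1 x) (sigma1 (ux m)) = l + m"
proof -
  let ?u = "sigma1 x" and ?v = "sigma1 (ux m)"
  have s1: "fst ?u k = (if k = 1 then snd x 1 else fst x k)" "snd ?u k = (if k = 1 then fst x 1 else snd x k)"
     "fst ?v k = (if k = 1 then m else 0)" "snd ?v k = 0" for k by (auto simp: sigma1_def ux_def)
  have D: "bsum j ?u ?v = snd x 1 - fst x 1 - sX j" if "1 \<le> j" for j
  proof -
    have "bsum j ?u ?v = (\<Sum>k=1..j. (if k = 1 then snd x 1 - fst x 1 else 0) - snd x k)"
      unfolding bsum_def s1 by (intro sum.cong) auto
    then show ?thesis using that unfolding sum_subtractf sum_if1 sX_def by simp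
  qed
  have D0: "bsum 0 ?u ?v = 0" by (simp add: bsum_def)
  have E: "usum j ?u ?v = m + fst x 1 - snd x 1 - sx j" if "1 \<le> j" for j
  proof -
    have "usum j ?u ?v = (\<Sum>k=1..j. (if k = 1 then m + fst x 1 - snd x 1 else 0) - fst x k)"
      unfolding usum_def s1 by (intro sum.cong) auto
    then show ?thesis using that unfolding sum_subtractf sum_if1 sx_def by simp
  qed
  have ev: "ell n ?v = m"
  proof -
    have "(\<Sum>i=1..n-1. fst ?v i + snd ?v i) = (\<Sum>i=1..n-1. if i = 1 then m else 0)" unfolding s1 by simp
    also have "\<dots> = m" unfolding sum_if1 using n1 by simp
    finally show ?thesis using n1 unfolding ell_def s1 by simp
  qed
  have el: "ell n ?u = l" "ell n ?v = m" using sigma1_Bx[OF n x] ev by (auto simp: Bx_def)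
  note S = top n1 m last nonneg[OF order_refl n1(1)]
  have i: "0 \<le> n - 1" by simp
  have T1: "theta n 0 j ?u ?v + snd ?v j - fst ?u j \<le> l + m"
    if j: "1 \<le> j" "j \<le> n - 1" for j
    using S j nonneg[OF j] s_mono(2)[OF j(2) order_refl]
    unfolding theta_eq D0 D[OF j(1)] s1 el by (auto simp: s_1)
  have T2: "theta' n 0 j ?u ?v + fst ?u j - snd ?v j \<le> l + m"
    if j: "1 \<le> j" "j \<le> n - 1" for j
    using S ge2[of j] ge1[of j] j nonneg[OF j]
    unfolding theta'_eq D0 E[OF j(1)] s1 el by (auto simp: s_1)
  show ?thesis
  proof (rule V_eqI[OF n i T1 T2])
    fix j assume j: "1 \<le> j" "j \<le> n - 2"
    then have j': "j \<le> n - 1" by simp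
    show "theta n 0 j ?u ?v \<le> l + m"
      using S s_mono(2)[OF j' order_refl] j unfolding theta_eq D0 D[OF j(1)] el by auto
    show "theta' n 0 j ?u ?v \<le> l + m"
      using S ge1[OF j(1) j'] unfolding theta'_eq D0 E[OF j(1)] el by simp
  next
    show "ell n ?v + bsum 0 ?u ?v - bsum (n - 1) ?u ?v + fst ?u n \<le> l + m"
      using S ge1[OF n1(1) order_refl] unfolding D0 D[OF n1(1)] el s1 by auto
    have "2 \<le> n - 1" "0 \<noteq> n - 1" using n by auto
    then show "theta' n 0 (n-1) ?u ?v + (if 0 = n - 1 then ell n ?u - ell n ?v else 0) - fst ?u n \<le> l + m"
      using S ge2(1)[of "n-1"] unfolding theta'_eq D0 E[OF n1(1)] el s1 by auto
    show "theta n 0 1 ?u ?v + snd ?v 1 - fst ?u 1 = l + m \<or>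
      theta' n 0 1 ?u ?v + fst ?u 1 - snd ?v 1 = l + m"
      unfolding theta'_eq D0 E[OF order_refl] s1 el by (simp add: s_1)
  qed
qed

text \<open>For 2 \<le> i \<le> n - 2 the minimum is 0, as the vacuum has no entry i, and the second
  argument of the maximum wins because V_{i-1} exceeds V_i by exactly the barred x_i.\<close>

lemma W_x_ux:
  assumes big: "m + snd x 1 \<ge> l" and i: "1 \<le> i" "i \<le> n - 1"
  shows "W n i x (ux m) = V n i x (ux m) + Vstar n i x (ux m)"
proof -
  consider "i = 1" | "i = n - 1" "i \<noteq> 1" | "2 \<le> i" "i \<le> n - 2" using i by linarith
  then show ?thesis
  proof cases
    case 1
    have "V n 0 x (ux m) = m + snd x 1 - fst x 1"
      using Vstar_x_ux[OF big, of 0] PL_V0_star[OF n] by (simp add: s_1)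
    then show ?thesis using V_x_ux[OF big i] Vstar_x_ux[OF big i(2)] V0_sigma1_ux
      unfolding 1 by (simp add: W_def Vsigma1_def s_1)
  next
    case 2
    then show ?thesis using n1 by (simp add: W_def)
  next
    case 3
    have i': "1 \<le> i - 1" "i - 1 \<le> n - 1" "i \<noteq> 0" "i \<noteq> 1" "i \<noteq> n - 1" using 3 n by auto
    show ?thesis unfolding W_def if_not_P[OF i'(3)] if_not_P[OF i'(4)] if_not_P[OF i'(5)]
      V_x_ux[OF big i] Vstar_x_ux[OF big i(2)] V_x_ux[OF big i'(1,2)] Vstar_x_ux[OF big i'(2)] ux_nth
      s_Suc[OF i(1)] using nonneg[OF i] i' by simp
  qed
qed

text \<open>From one index to the next V^* grows by x_i and V drops by the barred x_i. This cancels
  every coordinate of the image except the barred first one, which receives the whole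
  length.\<close>

lemma Rx_ux:
  assumes big: "m + snd x 1 \<ge> l"
  shows "Rx' n x (ux m) = ux l"
proof -
  have V0: "V n 0 x (ux m) = m + snd x 1 - fst x 1"
    using Vstar_x_ux[OF big, of 0] PL_V0_star[OF n] by (simp add: s_1)
  have W0: "W n 0 x (ux m) = 2 * V n 0 x (ux m)" by (simp add: W_def)
  have "fst (Rx' n x (ux m)) i = 0 \<and> snd (Rx' n x (ux m)) i = (if i = 1 then l else 0)" for i
  proof -
    consider "i = n" | "i = 1" | "2 \<le> i" "i \<le> n - 1" | "i \<noteq> n" "\<not> (1 \<le> i \<and> i \<le> n - 1)" by linarith
    then show ?thesis
    proof cases
      case 1
      show ?thesis unfolding 1 Rx'_def fst_conv snd_conv if_P[OF refl]
        V_x_ux[OF big n1(1) order_refl] Vstar_x_ux[OF big order_refl]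
        using n1 l_eq by auto
    next
      case 2
      have c: "1 \<le> (1::nat) \<and> 1 \<le> n - 1" "1 - 1 = (0::nat)" using n1 by auto
      show ?thesis unfolding 2 Rx'_def fst_conv snd_conv if_P[OF c(1)] if_not_P[OF n1(4)] c(2)
        W_x_ux[OF big order_refl n1(1)] W0 V0
        V_x_ux[OF big order_refl n1(1)] Vstar_x_ux[OF big n1(1)] Vstar_x_ux[OF big le0]
        by (simp add: s_1)
    next
      case 3
      then have c: "1 \<le> i \<and> i \<le> n - 1" "i \<noteq> n" "1 \<le> i - 1" "i - 1 \<le> n - 1" "1 \<le> i" "i \<le> n - 1" "i \<noteq> 1" by auto
      show ?thesis unfolding Rx'_def fst_conv snd_conv if_P[OF c(1)] if_not_P[OF c(2)]
        W_x_ux[OF big c(5,6)] W_x_ux[OF big c(3,4)]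
        V_x_ux[OF big c(5,6)] Vstar_x_ux[OF big c(6)] V_x_ux[OF big c(3,4)] Vstar_x_ux[OF big c(4)]
        s_Suc[OF c(5)] using c by simp
    next
      case 4
      then show ?thesis using n1 unfolding Rx'_def by auto
    qed
  qed
  then show ?thesis by (auto simp: ux_def intro!: prod_eqI ext)
qed

end

lemma R_ux_ux:
  assumes n: "n \<ge> 3" and "a \<ge> 0" "b \<ge> 0"
  shows "Rx' n (ux a) (ux b) = ux a" "Ry' n (ux a) (ux b) = ux b"
proof -
  interpret at_ux n "ux a" a b
    using assms by unfold_locales (auto intro: ux_Bx)
  have big: "b + snd (ux a) 1 \<ge> a" using assms(3) by (simp add: ux_def)
  show "Rx' n (ux a) (ux b) = ux a" by (rule Rx_ux[OF big])
  have u: "fst (ux a) k = 0" "snd (ux a) k = (if k = 1 then a else 0)" for k by (auto simp: ux_def)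
  have sx: "sx i = 0" "sX i = (if i = 0 then 0 else a)" for i
    unfolding sx_def sX_def u by (auto simp: sum_if1)
  have V0: "V n 0 (ux a) (ux b) = a + b"
    using Vstar_x_ux[OF big, of 0] PL_V0_star[OF n] sx by (simp add: u)
  have V: "V n i (ux a) (ux b) = a + b" "Vstar n i (ux a) (ux b) = a + b" if "i \<le> n - 1" for i
    using V0 V_x_ux[OF big, of i] Vstar_x_ux[OF big that] that sx by (cases "i = 0"; simp add: u)+
  have W: "W n i (ux a) (ux b) = 2 * (a + b)" if "i \<le> n - 1" for i
    using V0 V[OF that] W_x_ux[OF big, of i] that by (cases "i = 0") (auto simp: W_def[of _ 0])
  have "fst (Ry' n (ux a) (ux b)) i = fst (ux b) i \<and> snd (Ry' n (ux a) (ux b)) i = snd (ux b) i" for i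
    unfolding Ry'_def fst_conv snd_conv using V W n1 by (auto simp: ux_def)
  then show "Ry' n (ux a) (ux b) = ux b" by (auto intro!: prod_eqI ext)
qed

text \<open>Induction over triples with a vacuum of length 0 as third factor. An exponent within the
  string of the pair x, y is also within that of the image, by \<open>R_phi2\<close> and
  \<open>R_eps2\<close>, so the image stays in its crystals. Lengths enter through
  \<open>ell\<close>, as the induction ranges over all triples.\<close>

lemma R_Bx:
  assumes n: "n \<ge> 3" and "x \<in> Bx n l" "y \<in> Bx n m"
  shows "Ry' n x y \<in> Bx n m" "Rx' n x y \<in> Bx n l"
proof -
  define P :: "triple \<Rightarrow> bool" where
    "P = (\<lambda>(x, y, z). Ry' n x y \<in> Bx n (ell n y) \<and> Rx' n x y \<in> Bx n (ell n x))"
  have "P (x, y, ux 0)"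
  proof (rule triple_induct[OF n])
    fix i c p
    assume i: "1 \<le> i" "i \<le> n - 1" and p: "Bx3 n p" and c: "- phi3 n i p \<le> c" "c \<le> eps3 n i p" and P: "P p"
    obtain x y z where q: "p = (x, y, z)" by (cases p)
    obtain l1 l2 l3 where B: "x \<in> Bx n l1" "y \<in> Bx n l2" "z \<in> Bx n l3" using p q by auto
    note N = phi_eps2_nonneg[OF n i B(1,2)] phi_eps_nonneg[OF n i B(3)]
    define d where "d = pl c (phi2 n i x y) (eps n i z)"
    have r: "- phi2 n i x y \<le> d" "d \<le> eps2 n i x y"
      using pl_range(1,2)[of "phi n i z" "phi2 n i x y" "eps n i z" c "eps2 n i x y"] c N
      unfolding q d_def by auto
    note C = PL_commute[where u = x and v = y and c = d, OF n i refl refl, unfolded pleft_pl]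
    have PR: "Ry' n x y \<in> Bx n (ell n y)" "Rx' n x y \<in> Bx n (ell n x)" using P unfolding P_def q by auto
    note Q = pair_Bx[OF n i PR _ _ refl, unfolded R_phi2[OF n i] R_eps2[OF n i], OF r]
    show "P (tact n i c p)"
      unfolding P_def q tact.simps Let_def d_def[symmetric] prod.case C ell_pe[OF n i] using Q by simp
  next
    fix p assume "Bx3 n p" "P p"
    then show "P (map3 sigma1 p)"
      using sigma1_Bx[OF n] by (cases p) (auto simp: P_def R_sigma1[OF n] Bx_def)
    from \<open>Bx3 n p\<close> \<open>P p\<close> show "P (map3 (sigman n) p)"
      using sigman_Bx[OF n] by (cases p) (auto simp: P_def R_sigman[OF n] Bx_def)
  next
    fix a b c :: int assume "a \<ge> 0" "b \<ge> 0" "c \<ge> 0"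
    then show "P (ux a, ux b, ux c)" using n by (simp add: P_def R_ux_ux ux_Bx)
  next
    show "Bx3 n (x, y, ux 0)" using assms ux_Bx[OF n, of 0] by auto
  qed
  then show "Ry' n x y \<in> Bx n m" "Rx' n x y \<in> Bx n l" using assms(2,3) by (auto simp: P_def Bx_def)
qed

lemma yang_baxter_Bx:
  assumes n: "n \<ge> 3" and p: "Bx3 n p"
  shows "yang_baxter n p"
proof (rule triple_induct[OF n _ _ _ _ p])
  fix a b c :: int assume "a \<ge> 0" "b \<ge> 0" "c \<ge> 0"
  moreover have "V n 0 (ux a) (ux b) = a + b" if "a \<ge> 0" "b \<ge> 0" for a b
  proof -
    interpret at_ux n "ux a" a b
      using n that by unfold_locales (auto intro: ux_Bx)
    have big: "b + snd (ux a) 1 \<ge> a" using that by (simp add: ux_def)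
    show ?thesis using Vstar_x_ux[OF big, of 0] PL_V0_star[OF n] s_1 by (simp add: ux_def)
  qed
  ultimately show "yang_baxter n (ux a, ux b, ux c)"
    using n by (simp add: yang_baxter_def R_ux_ux)
qed (auto intro: yang_baxter_tact yang_baxter_sigma1 yang_baxter_sigman n)

subsection \<open>Large carriers\<close>

text \<open>A class closed under sums, differences and maxima, hence under all piecewise linear
  functions occurring in \<open>R\<close>, and in which boundedness implies eventual constancy. This
  is the source of all stabilization.\<close>

definition ev_affine :: "(nat \<Rightarrow> int) \<Rightarrow> bool" where
  "ev_affine f \<longleftrightarrow> (\<exists>s t. \<forall>\<^sub>F k in sequentially. f k = s * int k + t)"

lemma ev_affine_const [intro, simp]: "ev_affine (\<lambda>_. c)"
  unfolding ev_affine_def by (rule exI[of _ 0], rule exI[of _ c]) simp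

lemma ev_affine_add [intro]: "ev_affine f \<Longrightarrow> ev_affine g \<Longrightarrow> ev_affine (\<lambda>k. f k + g k)"
  unfolding ev_affine_def
proof (elim exE)
  fix s t s' t'
  assume "\<forall>\<^sub>F k in sequentially. f k = s * int k + t" "\<forall>\<^sub>F k in sequentially. g k = s' * int k + t'"
  then have "\<forall>\<^sub>F k in sequentially. f k + g k = (s + s') * int k + (t + t')"
    by eventually_elim (simp add: algebra_simps)
  then show "\<exists>s t. \<forall>\<^sub>F k in sequentially. f k + g k = s * int k + t" by blast
qed

lemma ev_affine_minus [intro]: "ev_affine f \<Longrightarrow> ev_affine (\<lambda>k. - f k)"
  unfolding ev_affine_def
proof (elim exE)
  fix s t
  assume "\<forall>\<^sub>F k in sequentially. f k = s * int k + t"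
  then have "\<forall>\<^sub>F k in sequentially. - f k = (- s) * int k + (- t)"
    by eventually_elim simp
  then show "\<exists>s t. \<forall>\<^sub>F k in sequentially. - f k = s * int k + t" by blast
qed

lemma ev_affine_diff [intro]: "ev_affine f \<Longrightarrow> ev_affine g \<Longrightarrow> ev_affine (\<lambda>k. f k - g k)"
  using ev_affine_add[OF _ ev_affine_minus, of f g] by simp

lemma ev_affine_cong: "\<forall>\<^sub>F k in sequentially. f k = g k \<Longrightarrow> ev_affine f \<Longrightarrow> ev_affine g"
  unfolding ev_affine_def
proof (elim exE)
  fix s t
  assume "\<forall>\<^sub>F k in sequentially. f k = g k" "\<forall>\<^sub>F k in sequentially. f k = s * int k + t"
  then have "\<forall>\<^sub>F k in sequentially. g k = s * int k + t" by eventually_elim simp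
  then show "\<exists>s t. \<forall>\<^sub>F k in sequentially. g k = s * int k + t" by blast
qed

lemma affine_pos_eventually: "(s::int) > 0 \<Longrightarrow> \<forall>\<^sub>F k in sequentially. s * int k + t \<ge> c"
proof -
  assume s: "s > 0"
  have "\<forall>\<^sub>F k in sequentially. k \<ge> nat (\<bar>t\<bar> + \<bar>c\<bar>)" by (rule eventually_ge_at_top)
  then show ?thesis
  proof eventually_elim
    case (elim k)
    then have "int k \<ge> \<bar>t\<bar> + \<bar>c\<bar>" by simp
    moreover have "s * int k \<ge> 1 * int k" using s by (intro mult_right_mono) auto
    ultimately show ?case by linarith
  qed
qed

lemma ev_affine_sign: "ev_affine f \<Longrightarrow> (\<forall>\<^sub>F k in sequentially. f k \<ge> 0) \<or> (\<forall>\<^sub>F k in sequentially. f k \<le> 0)"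
proof -
  assume "ev_affine f"
  then obtain s t where f: "\<forall>\<^sub>F k in sequentially. f k = s * int k + t" unfolding ev_affine_def by blast
  consider "s > 0" | "s = 0" | "s < 0" by linarith
  then show ?thesis
  proof cases
    case 1
    from f affine_pos_eventually[OF 1, of 0 t] have "\<forall>\<^sub>F k in sequentially. f k \<ge> 0"
      by eventually_elim simp
    then show ?thesis ..
  next
    case 2
    then have f: "\<forall>\<^sub>F k in sequentially. f k = t" using f by simp
    show ?thesis
    proof (cases "t \<ge> 0")
      case True
      from f have "\<forall>\<^sub>F k in sequentially. f k \<ge> 0" by eventually_elim (simp add: True)
      then show ?thesis ..
    next
      case False
      from f have "\<forall>\<^sub>F k in sequentially. f k \<le> 0" by eventually_elim (use False in simp)
      then show ?thesis ..
    qed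
  next
    case 3
    then have "- s > 0" by simp
    from f affine_pos_eventually[OF this, of 0 "- t"] have "\<forall>\<^sub>F k in sequentially. f k \<le> 0"
      by eventually_elim simp
    then show ?thesis ..
  qed
qed

lemma ev_affine_max [intro]:
  assumes f: "ev_affine f" and g: "ev_affine g"
  shows "ev_affine (\<lambda>k. max (f k) (g k))"
  using ev_affine_sign[OF ev_affine_diff[OF f g]]
proof
  assume "\<forall>\<^sub>F k in sequentially. f k - g k \<ge> 0"
  then have "\<forall>\<^sub>F k in sequentially. f k = max (f k) (g k)" by eventually_elim simp
  from ev_affine_cong[OF this f] show ?thesis .
next
  assume "\<forall>\<^sub>F k in sequentially. f k - g k \<le> 0"
  then have "\<forall>\<^sub>F k in sequentially. g k = max (f k) (g k)" by eventually_elim simp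
  from ev_affine_cong[OF this g] show ?thesis .
qed

lemma ev_affine_min [intro]:
  assumes f: "ev_affine f" and g: "ev_affine g"
  shows "ev_affine (\<lambda>k. min (f k) (g k))"
proof -
  have "(\<lambda>k. min (f k) (g k)) = (\<lambda>k. f k + g k - max (f k) (g k))" by (auto simp: fun_eq_iff)
  then show ?thesis using ev_affine_diff[OF ev_affine_add[OF f g] ev_affine_max[OF f g]] by simp
qed

lemma ev_affine_sum [intro]: "(\<And>j. j \<in> S \<Longrightarrow> ev_affine (f j)) \<Longrightarrow> ev_affine (\<lambda>k. \<Sum>j\<in>S. f j k)"
  by (induction S rule: infinite_finite_induct) auto

lemma ev_affine_Max:
  assumes "finite S" "S \<noteq> {}" "\<And>j. j \<in> S \<Longrightarrow> ev_affine (f j)"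
  shows "ev_affine (\<lambda>k. Max ((\<lambda>j. f j k) ` S))"
  using assms by (induction S rule: finite_ne_induct) auto

lemma ev_affine_bounded:
  assumes "ev_affine f" "\<forall>\<^sub>F k in sequentially. \<bar>f k\<bar> \<le> K"
  obtains t where "\<forall>\<^sub>F k in sequentially. f k = t"
proof -
  obtain s t where f: "\<forall>\<^sub>F k in sequentially. f k = s * int k + t" using assms(1) unfolding ev_affine_def by blast
  have "s = 0"
  proof (rule ccontr)
    assume "s \<noteq> 0"
    then consider "s > 0" | "- s > 0" by linarith
    then have "\<forall>\<^sub>F k in sequentially. \<bar>f k\<bar> \<ge> K + 1"
    proof cases
      case 1
      from f affine_pos_eventually[OF 1, of "K + 1" t] show ?thesis by eventually_elim simp
    next
      case 2
      from f affine_pos_eventually[OF 2, of "K + 1" "- t"] show ?thesis by eventually_elim simp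
    qed
    with assms(2) have "\<forall>\<^sub>F k in sequentially. False" by eventually_elim simp
    then show False by simp
  qed
  then show ?thesis using f that by simp
qed

definition ev_affine_coords :: "(nat \<Rightarrow> coords) \<Rightarrow> bool" where
  "ev_affine_coords F \<longleftrightarrow> (\<forall>i. ev_affine (\<lambda>k. fst (F k) i) \<and> ev_affine (\<lambda>k. snd (F k) i))"

lemma ev_affine_coords_nth: "ev_affine_coords F \<Longrightarrow> ev_affine (\<lambda>k. fst (F k) i)" "ev_affine_coords F \<Longrightarrow> ev_affine (\<lambda>k. snd (F k) i)"
  by (auto simp: ev_affine_coords_def)

lemma ev_affine_if: "(b \<Longrightarrow> ev_affine f) \<Longrightarrow> (\<not> b \<Longrightarrow> ev_affine g) \<Longrightarrow> ev_affine (\<lambda>k. if b then f k else g k)"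
  by (cases b) simp_all

lemma ev_affine_coords_sigma1: "ev_affine_coords F \<Longrightarrow> ev_affine_coords (\<lambda>k. sigma1 (F k))"
  and ev_affine_coords_star: "ev_affine_coords F \<Longrightarrow> ev_affine_coords (\<lambda>k. star n (F k))"
  unfolding ev_affine_coords_def sigma1_def star_def fst_conv snd_conv by (intro allI conjI ev_affine_if; simp)+

context
  fixes F G
  assumes F: "ev_affine_coords F" and G: "ev_affine_coords G"
begin

lemma ev_affine_ell: "ev_affine (\<lambda>k. ell n (F k))" "ev_affine (\<lambda>k. ell n (G k))"
  unfolding ell_def by (intro ev_affine_add ev_affine_sum ev_affine_coords_nth F G)+

lemma ev_affine_theta: "ev_affine (\<lambda>k. theta n i j (F k) (G k))"
  unfolding theta_def by (intro ev_affine_if ev_affine_add ev_affine_diff ev_affine_sum ev_affine_coords_nth ev_affine_ell F G)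

lemma EA_theta': "ev_affine (\<lambda>k. theta' n i j (F k) (G k))"
  unfolding theta'_def by (intro ev_affine_if ev_affine_add ev_affine_diff ev_affine_sum ev_affine_coords_nth ev_affine_ell F G)

lemma ev_affine_eta: "ev_affine (\<lambda>k. eta n i j (F k) (G k))"
  unfolding eta_def by (intro ev_affine_if ev_affine_add ev_affine_diff ev_affine_sum ev_affine_coords_nth ev_affine_ell F G)

lemma EA_eta': "ev_affine (\<lambda>k. eta' n i j (F k) (G k))"
  unfolding eta'_def by (intro ev_affine_if ev_affine_const ev_affine_add ev_affine_diff ev_affine_sum ev_affine_coords_nth ev_affine_ell F G)

lemma ev_affine_V:
  assumes "n \<ge> 3"
  shows "ev_affine (\<lambda>k. V n i (F k) (G k))"
proof -
  let ?I = "{1..n-2}" and ?J = "{1..n}"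
  have S: "?I \<noteq> {}" "?J \<noteq> {}" using assms by auto
  have V: "V n i u v = max (max (Max ((\<lambda>j. theta n i j u v) ` ?I)) (Max ((\<lambda>j. theta' n i j u v) ` ?I)))
      (max (Max ((\<lambda>j. eta n i j u v) ` ?J)) (Max ((\<lambda>j. eta' n i j u v) ` ?J)))" for u v
    unfolding V_def by (rule Max_Un4) (simp_all only: S image_is_empty finite_imageI finite_atLeastAtMost not_False_eq_True)
  show ?thesis unfolding V
    by (intro ev_affine_max ev_affine_Max[OF finite_atLeastAtMost S(1)] ev_affine_Max[OF finite_atLeastAtMost S(2)] ev_affine_theta EA_theta' ev_affine_eta EA_eta')
qed

end

context
  fixes F G and n :: nat
  assumes F: "ev_affine_coords F" and G: "ev_affine_coords G" and n: "n \<ge> 3"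
begin

lemma ev_affine_Vstar: "ev_affine (\<lambda>k. Vstar n i (F k) (G k))"
  unfolding Vstar_def by (rule ev_affine_V[OF ev_affine_coords_star[OF G] ev_affine_coords_star[OF F] n])

lemma ev_affine_W: "ev_affine (\<lambda>k. W n i (F k) (G k))"
proof -
  have e: "2 * V n 0 u v = V n 0 u v + V n 0 u v" for u v by simp
  show ?thesis
    unfolding W_def Vsigma1_def e
    by (intro ev_affine_if ev_affine_add ev_affine_diff ev_affine_max ev_affine_min ev_affine_Vstar ev_affine_V[OF F G n] ev_affine_V[OF ev_affine_coords_sigma1[OF F] ev_affine_coords_sigma1[OF G] n]
       ev_affine_coords_nth(1)[OF F] ev_affine_coords_nth(2)[OF F] ev_affine_coords_nth(1)[OF G] ev_affine_coords_nth(2)[OF G])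
qed

lemma ev_affine_coords_R: "ev_affine_coords (\<lambda>k. Rx' n (F k) (G k))" "ev_affine_coords (\<lambda>k. Ry' n (F k) (G k))"
  unfolding ev_affine_coords_def Rx'_def Ry'_def fst_conv snd_conv
  by (intro allI conjI ev_affine_if ev_affine_const ev_affine_add ev_affine_diff ev_affine_W ev_affine_Vstar ev_affine_V[OF F G n]
      ev_affine_coords_nth(1)[OF F] ev_affine_coords_nth(2)[OF F] ev_affine_coords_nth(1)[OF G] ev_affine_coords_nth(2)[OF G])+

end

section \<open>A growing carrier passing one factor\<close>

lemma Bx_bounds:
  assumes n: "n \<ge> 3" and x: "x \<in> Bx n l"
  shows "\<bar>fst x i\<bar> \<le> l" "\<bar>snd x i\<bar> \<le> l"
proof -
  have nn: "n - 1 \<in> {1..n-1}" "n - 1 \<noteq> n" using n by auto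
  have z: "j \<in> {1..n-1} \<Longrightarrow> fst x j \<ge> 0 \<and> snd x j \<ge> 0" "fst x n \<ge> - fst x (n-1)" "fst x n \<ge> - snd x (n-1)"
    "j \<notin> {1..n} \<Longrightarrow> fst x j = 0" "j \<notin> {1..n-1} \<Longrightarrow> snd x j = 0" for j using x unfolding Bx_def by auto
  have l: "l = (\<Sum>j=1..n-2. fst x j + snd x j) + (fst x (n-1) + snd x (n-1)) + fst x n"
    using ell_split[of n x] n x unfolding Bx_def by simp
  have p: "fst x j + snd x j \<ge> 0" if "j \<in> {1..n-2}" for j
  proof -
    have "j \<in> {1..n-1}" using that by auto
    then show ?thesis using z(1)[of j] by simp
  qed
  have s: "(\<Sum>j=1..n-2. fst x j + snd x j) \<ge> 0" by (rule sum_nonneg) (rule p)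
  have m: "fst x j + snd x j \<le> (\<Sum>j=1..n-2. fst x j + snd x j)" if "j \<in> {1..n-2}" for j
    using member_le_sum[OF that, of "\<lambda>j. fst x j + snd x j"] p by simp
  have b: "\<bar>fst x i\<bar> \<le> l \<and> \<bar>snd x i\<bar> \<le> l"
  proof -
    consider "i \<in> {1..n-2}" | "i = n - 1" | "i = n" | "i \<notin> {1..n}" by fastforce
    then show ?thesis
    proof cases
      case 1
      then have "i \<in> {1..n-1}" by auto
      then show ?thesis using m[OF 1] z(1)[of i] z(1)[OF nn(1)] z(2,3) l by linarith
    next
      case 2
      show ?thesis using z(1)[OF nn(1)] z(2,3) l s unfolding 2 by linarith
    next
      case 3
      have "n \<notin> {1..n-1}" using n by auto
      then have "snd x n = 0" by (rule z(5))
      then show ?thesis using z(1)[OF nn(1)] z(2,3) l s unfolding 3 by linarith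
    next
      case 4
      then have "fst x i = 0" "snd x i = 0" using z(4,5)[of i] by auto
      then show ?thesis using Bx_nonneg[OF n x] by simp
    qed
  qed
  then show "\<bar>fst x i\<bar> \<le> l" "\<bar>snd x i\<bar> \<le> l" by auto
qed

lemma ev_affine_int: "ev_affine (\<lambda>k. int k)"
  unfolding ev_affine_def by (rule exI[of _ 1], rule exI[of _ 0]) simp

definition addk :: "int \<Rightarrow> coords \<Rightarrow> coords" where
  "addk k c = (fst c, (snd c)(1 := snd c 1 + k))"

lemma addk_nth: "fst (addk k c) = fst c" "snd (addk k c) 1 = snd c 1 + k" "i \<noteq> 1 \<Longrightarrow> snd (addk k c) i = snd c i"
  by (auto simp: addk_def)

text \<open>A family of elements of lengths tending to infinity, all of whose growth is in the
  coordinate of the vacuum letter.\<close>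

definition carrier_fam :: "nat \<Rightarrow> (nat \<Rightarrow> coords) \<Rightarrow> bool" where
  "carrier_fam n C \<longleftrightarrow> (\<exists>c0 m0. \<forall>\<^sub>F k in sequentially. C k = addk (int k) c0 \<and> C k \<in> Bx n (int k + m0))"

lemma carrier_ux: "n \<ge> 3 \<Longrightarrow> carrier_fam n (\<lambda>k. ux (int k))"
  unfolding carrier_fam_def
proof (rule exI[of _ "ux 0"], rule exI[of _ 0])
  assume "n \<ge> 3"
  then have "ux (int k) = addk (int k) (ux 0) \<and> ux (int k) \<in> Bx n (int k + 0)" for k
    using ux_Bx[of n "int k"] by (auto simp: addk_def ux_def fun_eq_iff)
  then show "\<forall>\<^sub>F k in sequentially. ux (int k) = addk (int k) (ux 0) \<and> ux (int k) \<in> Bx n (int k + 0)"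
    by (intro always_eventually allI)
qed

lemma ev_affine_coords_cong: "\<forall>\<^sub>F k in sequentially. F k = G k \<Longrightarrow> ev_affine_coords F \<Longrightarrow> ev_affine_coords G"
proof -
  assume e: "\<forall>\<^sub>F k in sequentially. F k = G k" and F: "ev_affine_coords F"
  have "ev_affine (\<lambda>k. fst (G k) i)" for i
    by (rule ev_affine_cong[OF _ ev_affine_coords_nth(1)[OF F, of i]]) (use e in eventually_elim, simp)
  moreover have "ev_affine (\<lambda>k. snd (G k) i)" for i
    by (rule ev_affine_cong[OF _ ev_affine_coords_nth(2)[OF F, of i]]) (use e in eventually_elim, simp)
  ultimately show "ev_affine_coords G" by (simp add: ev_affine_coords_def)
qed

lemma carrier_ev_affine: "carrier_fam n C \<Longrightarrow> ev_affine_coords C"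
proof -
  assume "carrier_fam n C"
  then obtain c0 m0 where "\<forall>\<^sub>F k in sequentially. C k = addk (int k) c0 \<and> C k \<in> Bx n (int k + m0)"
    unfolding carrier_fam_def by blast
  then have "\<forall>\<^sub>F k in sequentially. addk (int k) c0 = C k" by eventually_elim simp
  moreover have "ev_affine (\<lambda>k. snd (addk (int k) c0) i)" for i
    by (cases "i = 1") (auto simp: addk_nth[simplified] intro!: ev_affine_int)
  then have "ev_affine_coords (\<lambda>k. addk (int k) c0)" unfolding ev_affine_coords_def by (auto simp: addk_nth)
  ultimately show ?thesis by (rule ev_affine_coords_cong)
qed

lemma ev_affine_coords_const: "ev_affine_coords (\<lambda>_. x)" by (auto simp: ev_affine_coords_def)

lemma ev_affine_coords_bounded:
  assumes F: "ev_affine_coords F" and n: "n \<ge> 3" and B: "\<forall>\<^sub>F k in sequentially. F k \<in> Bx n l"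
  obtains u where "\<forall>\<^sub>F k in sequentially. F k = u"
proof -
  have "\<exists>t. \<forall>\<^sub>F k in sequentially. fst (F k) i = t" for i
  proof -
    have "\<forall>\<^sub>F k in sequentially. \<bar>fst (F k) i\<bar> \<le> l" using B by eventually_elim (rule Bx_bounds(1)[OF n])
    from ev_affine_bounded[OF ev_affine_coords_nth(1)[OF F, of i] this] show ?thesis by blast
  qed
  then obtain f where f: "\<forall>\<^sub>F k in sequentially. fst (F k) i = f i" for i by metis
  have "\<exists>t. \<forall>\<^sub>F k in sequentially. snd (F k) i = t" for i
  proof -
    have "\<forall>\<^sub>F k in sequentially. \<bar>snd (F k) i\<bar> \<le> l" using B by eventually_elim (rule Bx_bounds(2)[OF n])
    from ev_affine_bounded[OF ev_affine_coords_nth(2)[OF F, of i] this] show ?thesis by blast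
  qed
  then obtain g where g: "\<forall>\<^sub>F k in sequentially. snd (F k) i = g i" for i by metis
  \<comment> \<open>Statements that hold eventually combine over finitely many indices only; outside
    \<open>{1..n}\<close> membership in \<open>Bx\<close> fixes the coordinates.\<close>
  define u where "u = (\<lambda>i. if i \<in> {1..n} then f i else 0, \<lambda>i. if i \<in> {1..n} then g i else 0)"
  have "\<forall>\<^sub>F k in sequentially. \<forall>i\<in>{1..n}. fst (F k) i = f i \<and> snd (F k) i = g i"
    by (intro eventually_ball_finite ballI eventually_conj f g) auto
  with B have "\<forall>\<^sub>F k in sequentially. F k = u"
  proof eventually_elim
    case (elim k)
    then have "\<forall>i. i \<notin> {1..n} \<longrightarrow> fst (F k) i = 0 \<and> snd (F k) i = 0" by (auto simp: Bx_def)
    with elim show ?case unfolding u_def by (auto simp: prod_eq_iff fun_eq_iff)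
  qed
  then show ?thesis by (rule that)
qed

text \<open>The image of x stays in one crystal, so its coordinates are bounded and become constant.
  Conservation of weight then fixes the differences of unbarred and barred entries of the new
  carrier up to the growth k at index 1, and its length bounds the unbarred entries, so these become
  constant as well.\<close>

lemma R_carrier:
  assumes n: "n \<ge> 3" and x: "x \<in> Bx n l" and C: "carrier_fam n C"
  obtains x0 where "x0 \<in> Bx n l" "\<forall>\<^sub>F k in sequentially. Rx' n x (C k) = x0" "carrier_fam n (\<lambda>k. Ry' n x (C k))"
proof -
  obtain c0 m0 where C0: "\<forall>\<^sub>F k in sequentially. C k = addk (int k) c0 \<and> C k \<in> Bx n (int k + m0)"
    using C unfolding carrier_fam_def by blast
  have EX: "ev_affine_coords (\<lambda>k. Rx' n x (C k))" and EY: "ev_affine_coords (\<lambda>k. Ry' n x (C k))"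
    by (rule ev_affine_coords_R[OF ev_affine_coords_const carrier_ev_affine[OF C] n])+
  have BX: "\<forall>\<^sub>F k in sequentially. Rx' n x (C k) \<in> Bx n l"
    using C0 by eventually_elim (blast intro: R_Bx(2)[OF n x])
  have BY: "\<forall>\<^sub>F k in sequentially. Ry' n x (C k) \<in> Bx n (int k + m0)"
    using C0 by eventually_elim (blast intro: R_Bx(1)[OF n x])
  obtain x0 where x0: "\<forall>\<^sub>F k in sequentially. Rx' n x (C k) = x0" by (rule ev_affine_coords_bounded[OF EX n BX])
  have "\<forall>\<^sub>F k in sequentially. x0 \<in> Bx n l" using x0 BX by eventually_elim simp
  then have "x0 \<in> Bx n l" by simp
  have nn: "1 \<in> {1..n-1}" "n - 1 \<in> {1..n-1}" "1 \<noteq> n" "1 \<le> n - 1" using n by auto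
  \<comment> \<open>The weight that remains for the new carrier, apart from the growing
    part.\<close>
  define e where "e i = fst x i - snd x i + fst c0 i - snd c0 i - (fst x0 i - snd x0 i)" for i
  define en where "en = fst x n + fst c0 n - fst x0 n"
  have W: "\<forall>\<^sub>F k in sequentially. (\<forall>i\<in>{1..n-1}. snd (Ry' n x (C k)) i = fst (Ry' n x (C k)) i - e i + (if i = 1 then int k else 0))
     \<and> fst (Ry' n x (C k)) n = en"
    using C0 x0
  proof eventually_elim
    case (elim k)
    have c: "fst (C k) i - snd (C k) i = fst c0 i - snd c0 i - (if i = 1 then int k else 0)" for i
      using elim by (auto simp: addk_def)
    have "snd (Ry' n x (C k)) i = fst (Ry' n x (C k)) i - e i + (if i = 1 then int k else 0)" if "i \<in> {1..n-1}" for i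
      using R_weight(1)[OF n, of i x "C k"] that c[of i] elim unfolding e_def by auto
    moreover have "fst (Ry' n x (C k)) n = en"
      using R_weight(2)[OF n order_refl nn(4), of x "C k"] elim unfolding en_def by (simp add: addk_nth)
    ultimately show ?case by blast
  qed
  \<comment> \<open>Bounds twice the sum of the unbarred entries below n of the new carrier,
    computed from its length and \<open>W\<close>.\<close>
  define K where "K = m0 + (\<Sum>i=1..n-1. \<bar>e i\<bar>) + \<bar>en\<bar>"
  have bound: "\<forall>\<^sub>F k in sequentially. \<forall>i. \<bar>fst (Ry' n x (C k)) i\<bar> \<le> \<bar>K\<bar> + \<bar>en\<bar>"
    using W BY
  proof eventually_elim
    case (elim k)
    let ?y = "Ry' n x (C k)"
    have nonneg: "fst ?y i \<ge> 0" if "i \<in> {1..n-1}" for i using elim(2) that by (auto simp: Bx_def)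
    have "(\<Sum>i=1..n-1. fst ?y i + snd ?y i) + fst ?y n = int k + m0" using elim(2) by (auto simp: Bx_def ell_def)
    moreover have "(\<Sum>i=1..n-1. fst ?y i + snd ?y i) = (\<Sum>i=1..n-1. 2 * fst ?y i - e i + (if i = 1 then int k else 0))"
      using elim(1) by (intro sum.cong) auto
    moreover have "\<dots> = 2 * (\<Sum>i=1..n-1. fst ?y i) - (\<Sum>i=1..n-1. e i) + int k"
    proof -
      have "(\<Sum>i=1..n-1. if i = 1 then int k else 0) = int k"
        using nn(4) by (simp add: sum.delta')
      then show ?thesis unfolding sum.distrib sum_subtractf by (simp add: sum_distrib_left)
    qed
    ultimately have "2 * (\<Sum>i=1..n-1. fst ?y i) = m0 + (\<Sum>i=1..n-1. e i) - en" using elim(1) by simp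
    moreover have "(\<Sum>i=1..n-1. e i) \<le> (\<Sum>i=1..n-1. \<bar>e i\<bar>)" by (rule sum_mono) simp
    ultimately have t: "2 * (\<Sum>i=1..n-1. fst ?y i) \<le> K" unfolding K_def by linarith
    have "\<bar>fst ?y i\<bar> \<le> \<bar>K\<bar> + \<bar>en\<bar>" for i
    proof -
      consider "i \<in> {1..n-1}" | "i = n" | "i \<notin> {1..n}" by fastforce
      then show ?thesis
      proof cases
        case 1
        have "fst ?y i \<le> (\<Sum>i=1..n-1. fst ?y i)" using member_le_sum[OF 1, of "fst ?y"] nonneg by simp
        then show ?thesis using nonneg[OF 1] t by linarith
      next
        case 2
        then show ?thesis using elim(1) by simp
      next
        case 3
        then have "fst ?y i = 0" using elim(2) by (auto simp: Bx_def)
        then show ?thesis by simp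
      qed
    qed
    then show ?case by blast
  qed
  have "\<exists>t. \<forall>\<^sub>F k in sequentially. fst (Ry' n x (C k)) i = t" for i
  proof -
    have "\<forall>\<^sub>F k in sequentially. \<bar>fst (Ry' n x (C k)) i\<bar> \<le> \<bar>K\<bar> + \<bar>en\<bar>" using bound by eventually_elim blast
    from ev_affine_bounded[OF ev_affine_coords_nth(1)[OF EY, of i] this] show ?thesis by blast
  qed
  then obtain f where f: "\<forall>\<^sub>F k in sequentially. fst (Ry' n x (C k)) i = f i" for i by metis
  define d0 where "d0 = (\<lambda>i. if i \<in> {1..n} then f i else 0, \<lambda>i. if i \<in> {1..n-1} then f i - e i else (0::int))"
  have "\<forall>\<^sub>F k in sequentially. \<forall>i\<in>{1..n}. fst (Ry' n x (C k)) i = f i"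
    by (intro eventually_ball_finite ballI f) auto
  with W BY have "\<forall>\<^sub>F k in sequentially. Ry' n x (C k) = addk (int k) d0 \<and> Ry' n x (C k) \<in> Bx n (int k + m0)"
  proof eventually_elim
    case (elim k)
    let ?y = "Ry' n x (C k)"
    have o: "i \<notin> {1..n} \<Longrightarrow> fst ?y i = 0" "i \<notin> {1..n-1} \<Longrightarrow> snd ?y i = 0" for i using elim(2) by (auto simp: Bx_def)
    have a: "fst ?y i = fst (addk (int k) d0) i" for i
      using elim(3) o(1)[of i] unfolding addk_nth d0_def fst_conv by (cases "i \<in> {1..n}") auto
    have b: "snd ?y i = snd (addk (int k) d0) i" for i
    proof (cases "i \<in> {1..n-1}")
      case True
      then have "i \<in> {1..n}" by auto
      then show ?thesis using elim(1,3) True unfolding addk_def d0_def by auto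
    next
      case False
      then have "i \<noteq> 1" using nn by auto
      then show ?thesis using o(2)[OF False] unfolding addk_nth(3)[OF \<open>i \<noteq> 1\<close>] d0_def snd_conv if_not_P[OF False] by simp
    qed
    show ?case using a b elim(2) by (auto simp: prod_eq_iff fun_eq_iff)
  qed
  then have "carrier_fam n (\<lambda>k. Ry' n x (C k))" unfolding carrier_fam_def by blast
  with \<open>x0 \<in> Bx n l\<close> x0 show ?thesis by (rule that)
qed

text \<open>Among the terms of V_0 only the unprimed eta term with j = 1 grows with k. Elsewhere the
  growth of the length is cancelled by that of the barred first entry, or k does not enter, or it
  enters negatively.\<close>

lemma V_carrier:
  assumes n: "n \<ge> 3" and x: "x \<in> Bx n l" and C: "carrier_fam n C"
  shows "\<forall>\<^sub>F k in sequentially. ell n x + ell n (C k) - V n 0 x (C k) = l - snd x 1 + fst x 1"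
proof -
  obtain c0 m0 where C0: "\<forall>\<^sub>F k in sequentially. C k = addk (int k) c0 \<and> C k \<in> Bx n (int k + m0)"
    using C unfolding carrier_fam_def by blast
  have n1: "1 \<noteq> n" "0 \<noteq> n - 1" using n by auto
  have Bk: "bsum j x (addk k c0) = k + bsum j x c0" if "1 \<le> j" for j k
  proof -
    have "bsum j x (addk k c0) = (\<Sum>i=1..j. (if i = 1 then k else 0) + (snd c0 i - snd x i))"
      unfolding bsum_def by (intro sum.cong) (auto simp: addk_def)
    also have "\<dots> = (\<Sum>i=1..j. if i = 1 then k else 0) + (\<Sum>i=1..j. snd c0 i - snd x i)"
      by (rule sum.distrib)
    also have "(\<Sum>i=1..j. if i = 1 then k else 0) = k" using that by (simp add: sum.delta')
    finally have "bsum j x (addk k c0) = k + bsum j x c0" unfolding bsum_def .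
    then show ?thesis .
  qed
  have U: "usum j x (addk k c0) = usum j x c0" for j k unfolding usum_def addk_nth ..
  have B0: "bsum 0 x u = 0" for u by (simp add: bsum_def)
  define Q where "Q = (\<Sum>j=1..n. \<bar>bsum j x c0\<bar> + \<bar>usum j x c0\<bar> + \<bar>fst x j\<bar> + \<bar>snd x j\<bar> + \<bar>snd c0 j\<bar>)"
  have q: "- Q \<le> bsum j x c0" "usum j x c0 \<le> Q" "- Q \<le> fst x j" "fst x j \<le> Q" "- Q \<le> snd x j" "snd x j \<le> Q"
    "- Q \<le> snd c0 j" "snd c0 j \<le> Q" if "j \<in> {1..n}" for j
  proof -
    have "\<bar>bsum j x c0\<bar> + \<bar>usum j x c0\<bar> + \<bar>fst x j\<bar> + \<bar>snd x j\<bar> + \<bar>snd c0 j\<bar> \<le> Q"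
      unfolding Q_def by (rule member_le_sum[OF that]) auto
    then show "- Q \<le> bsum j x c0" "usum j x c0 \<le> Q" "- Q \<le> fst x j" "fst x j \<le> Q" "- Q \<le> snd x j" "snd x j \<le> Q"
      "- Q \<le> snd c0 j" "snd c0 j \<le> Q" by linarith+
  qed
  \<comment> \<open>From here on k outweighs every competing term, each made of a few quantities
    bounded by \<open>Q\<close> and of the lengths l and m0.\<close>
  have "\<forall>\<^sub>F k in sequentially. 1 * int k + 0 \<ge> 8 * Q + \<bar>l\<bar> + \<bar>m0\<bar>" by (rule affine_pos_eventually) simp
  with C0 show ?thesis
  proof eventually_elim
    case (elim k)
    have eC: "ell n (C k) = int k + m0" and Ck: "C k = addk (int k) c0" using elim by (auto simp: Bx_def)
    have ex: "ell n x = l" using x by (simp add: Bx_def)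
    have i1: "1 \<in> {1..n}" "n \<in> {1..n}" "n - 1 \<in> {1..n}" "1 \<le> n - 1" using n by auto
    have big: "int k \<ge> 8 * Q + \<bar>l\<bar> + \<bar>m0\<bar>" using elim by simp
    note S = big q[OF i1(1)] q[OF i1(2)] q[OF i1(3)]
    have sn: "snd (C k) j = snd c0 j + (if j = 1 then int k else 0)" for j unfolding Ck by (simp add: addk_def)
    have B: "bsum j x (C k) = int k + bsum j x c0" if "1 \<le> j" for j unfolding Ck by (rule Bk[OF that])
    have U': "usum j x (C k) = usum j x c0" for j unfolding Ck by (rule U)
    have b1: "bsum 1 x c0 = snd c0 1 - snd x 1" by (simp add: bsum_def)
    have "V n 0 x (C k) = int k + m0 + snd x 1 - fst x 1"
    proof (rule V_eqI[OF n le0])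
      fix j assume j: "1 \<le> j" "j \<le> n - 1"
      then have jn: "j \<in> {1..n}" by auto
      show "theta n 0 j x (C k) + snd (C k) j - fst x j \<le> int k + m0 + snd x 1 - fst x 1"
      proof (cases "j = 1")
        case True
        then show ?thesis unfolding theta_eq B0 B[OF j(1)] sn eC ex using b1 by simp
      next
        case False
        then show ?thesis using S q[OF jn] j unfolding theta_eq B0 B[OF j(1)] sn eC ex by (simp; linarith)
      qed
      show "theta' n 0 j x (C k) + fst x j - snd (C k) j \<le> int k + m0 + snd x 1 - fst x 1"
        using S q[OF jn] unfolding theta'_eq B0 U' sn eC ex by (cases "j = 1"; simp; linarith)
    next
      fix j assume j: "1 \<le> j" "j \<le> n - 2"
      then have jn: "j \<in> {1..n}" by auto
      show "theta n 0 j x (C k) \<le> int k + m0 + snd x 1 - fst x 1"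
        using S q[OF jn] j unfolding theta_eq B0 B[OF j(1)] sn eC ex by (simp; linarith)
      show "theta' n 0 j x (C k) \<le> int k + m0 + snd x 1 - fst x 1"
        using S q[OF jn] unfolding theta'_eq B0 U' sn eC ex by (cases "j = 1"; simp; linarith)
    next
      show "ell n (C k) + bsum 0 x (C k) - bsum (n - 1) x (C k) + fst x n \<le> int k + m0 + snd x 1 - fst x 1"
        using S unfolding B0 B[OF i1(4)] eC ex by linarith
      show "theta' n 0 (n-1) x (C k) + (if 0 = n - 1 then ell n x - ell n (C k) else 0) - fst x n \<le> int k + m0 + snd x 1 - fst x 1"
        using S n1 unfolding theta'_eq B0 U' eC ex if_not_P[OF n1(2)] by linarith
      show "theta n 0 1 x (C k) + snd (C k) 1 - fst x 1 = int k + m0 + snd x 1 - fst x 1 \<or>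
        theta' n 0 1 x (C k) + fst x 1 - snd (C k) 1 = int k + m0 + snd x 1 - fst x 1"
        unfolding theta_eq B0 B[OF order_refl] sn eC ex using b1 by simp
    qed
    then show ?case using eC ex by simp
  qed
qed

section \<open>Return to the tuples in \<open>B n l\<close>\<close>

lemma idx_cases: "i = n \<or> i = n - 1 \<or> (1 \<le> i \<and> i \<le> n - 2) \<or> i \<notin> {1..n}" if "n \<ge> 3" for i n :: nat
  using that by auto

context
  fixes n :: nat
  assumes n: "n \<ge> 3"
begin

lemma nn: "n - 1 \<noteq> n" "n - 1 \<in> {1..n}" "n \<in> {1..n}" "1 \<le> n - 2" "n - 1 \<in> {1..n-1}" "n \<notin> {1..n-1}"
  using n by auto

lemma to_x_nth: "fst (to_x n z) n = fst z n - snd z n" "fst (to_x n z) (n-1) = fst z (n-1) + snd z n"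
  "snd (to_x n z) (n-1) = snd z (n-1) + snd z n" "snd (to_x n z) n = 0"
  "i \<noteq> n \<Longrightarrow> i \<noteq> n - 1 \<Longrightarrow> fst (to_x n z) i = fst z i" "i \<noteq> n \<Longrightarrow> i \<noteq> n - 1 \<Longrightarrow> snd (to_x n z) i = snd z i"
  using nn(1) by (auto simp: to_x_def)

lemma from_x_nth: "fst (from_x n x) n = max 0 (fst x n)" "snd (from_x n x) n = max 0 (- fst x n)"
  "fst (from_x n x) (n-1) = fst x (n-1) + min 0 (fst x n)" "snd (from_x n x) (n-1) = snd x (n-1) + min 0 (fst x n)"
  "1 \<le> i \<Longrightarrow> i \<le> n - 2 \<Longrightarrow> fst (from_x n x) i = fst x i" "1 \<le> i \<Longrightarrow> i \<le> n - 2 \<Longrightarrow> snd (from_x n x) i = snd x i"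
  "i \<notin> {1..n} \<Longrightarrow> fst (from_x n x) i = 0" "i \<notin> {1..n} \<Longrightarrow> snd (from_x n x) i = 0"
  using n by (auto simp: from_x_def)

lemma sum_split3: "(\<Sum>i=1..n. f i) = (\<Sum>i=1..n-2. f i) + f (n-1) + (f n :: int)"
proof -
  obtain m where "n = Suc (Suc m)" using n by (metis add_2_eq_Suc le_Suc_ex numeral_3_eq_3 Suc_le_D numeral_2_eq_2 Suc_le_mono)
  then show ?thesis by simp
qed

lemma to_x_Bx:
  assumes b: "b \<in> B n l"
  shows "to_x n b \<in> Bx n (int l)"
proof -
  have nonneg: "fst b i \<ge> 0" "snd b i \<ge> 0" for i
    using b by (cases "i \<in> {1..n}"; auto simp: B_def)+
  have z: "i \<notin> {1..n} \<Longrightarrow> fst b i = 0 \<and> snd b i = 0" for i using b by (auto simp: B_def)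
  have p: "fst b n * snd b n = 0" using b by (auto simp: B_def)
  have "(\<Sum>i=1..n-2. fst (to_x n b) i + snd (to_x n b) i) = (\<Sum>i=1..n-2. fst b i + snd b i)"
    using n by (intro sum.cong refl) (auto simp: to_x_def)
  moreover have "(\<Sum>i=1..n. fst b i + snd b i) = int l" using b by (auto simp: B_def)
  ultimately have e: "ell n (to_x n b) = int l"
    using ell_split[of n "to_x n b"] n unfolding sum_split3 to_x_nth by linarith
  have a: "fst (to_x n b) i \<ge> 0 \<and> snd (to_x n b) i \<ge> 0" if "i \<in> {1..n-1}" for i
    using nonneg that nn by (cases "i = n - 1") (auto simp: to_x_nth simp del: One_nat_def)
  have c: "i \<notin> {1..n} \<Longrightarrow> fst (to_x n b) i = 0" "i \<notin> {1..n-1} \<Longrightarrow> snd (to_x n b) i = 0" for i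
  proof -
    assume "i \<notin> {1..n}"
    then have "i \<noteq> n" "i \<noteq> n - 1" using nn by auto
    then show "fst (to_x n b) i = 0" using z[OF \<open>i \<notin> {1..n}\<close>] to_x_nth(5)[of i b] by simp
  next
    assume "i \<notin> {1..n-1}"
    show "snd (to_x n b) i = 0"
    proof (cases "i = n")
      case False
      then have "i \<noteq> n - 1" "i \<notin> {1..n}" using \<open>i \<notin> {1..n-1}\<close> nn by auto
      then show ?thesis using z[of i] False to_x_nth(6)[of i b] by simp
    qed (simp add: to_x_nth)
  qed
  have d: "fst (to_x n b) n \<ge> - fst (to_x n b) (n-1)" "fst (to_x n b) n \<ge> - snd (to_x n b) (n-1)"
    unfolding to_x_nth using nonneg[of n] nonneg[of "n-1"] by linarith+
  show ?thesis unfolding Bx_def using a c d e by blast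
qed

lemma from_x_B:
  assumes x: "x \<in> Bx n (int l)"
  shows "from_x n x \<in> B n l"
proof -
  have z: "j \<in> {1..n-1} \<Longrightarrow> fst x j \<ge> 0 \<and> snd x j \<ge> 0" "fst x n \<ge> - fst x (n-1)" "fst x n \<ge> - snd x (n-1)" for j
    using x unfolding Bx_def by auto
  have nonneg: "fst (from_x n x) i \<ge> 0 \<and> snd (from_x n x) i \<ge> 0" if "i \<in> {1..n}" for i
  proof -
    have "i = n \<or> i = n - 1 \<or> (1 \<le> i \<and> i \<le> n - 2)" using that by auto
    then consider "i = n" | "i = n - 1" | "1 \<le> i" "i \<le> n - 2" by blast
    then show ?thesis
    proof cases
      case 3
      then have "i \<in> {1..n-1}" by auto
      then show ?thesis using z(1)[of i] 3 by (simp add: from_x_nth)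
    qed (use z(1)[OF nn(5)] z(2,3) in \<open>auto simp: from_x_nth min_def simp del: One_nat_def\<close>)
  qed
  have "(\<Sum>i=1..n-2. fst (from_x n x) i + snd (from_x n x) i) = (\<Sum>i=1..n-2. fst x i + snd x i)"
    by (intro sum.cong refl) (auto simp: from_x_nth)
  moreover have "ell n x = int l" using x by (auto simp: Bx_def)
  ultimately have "(\<Sum>i=1..n. fst (from_x n x) i + snd (from_x n x) i) = int l"
    using ell_split[of n x] n unfolding sum_split3 from_x_nth by (auto simp: min_def max_def)
  moreover have "fst (from_x n x) n * snd (from_x n x) n = 0" unfolding from_x_nth by (auto simp: max_def)
  moreover have "i \<notin> {1..n} \<Longrightarrow> fst (from_x n x) i = 0 \<and> snd (from_x n x) i = 0" for i
    using from_x_nth(7,8) by blast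
  ultimately show ?thesis using nonneg unfolding B_def by blast
qed

lemma to_from:
  assumes x: "x \<in> Bx n l"
  shows "to_x n (from_x n x) = x"
proof -
  have z: "j \<notin> {1..n} \<Longrightarrow> fst x j = 0" "j \<notin> {1..n-1} \<Longrightarrow> snd x j = 0" for j
    using x unfolding Bx_def by auto
  have "fst (to_x n (from_x n x)) i = fst x i \<and> snd (to_x n (from_x n x)) i = snd x i" for i
  proof -
    consider "i = n" | "i = n - 1" | "1 \<le> i" "i \<le> n - 2" | "i \<notin> {1..n}" using idx_cases[OF n, of i] by blast
    then show ?thesis
    proof cases
      case 1
      show ?thesis unfolding 1 to_x_nth from_x_nth using z(2)[OF nn(6)] by (auto simp: max_def)
    next
      case 2
      show ?thesis unfolding 2 to_x_nth from_x_nth by (auto simp: max_def min_def)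
    next
      case 3
      then have "i \<noteq> n" "i \<noteq> n - 1" using n by auto
      then show ?thesis unfolding to_x_nth(5,6)[OF \<open>i \<noteq> n\<close> \<open>i \<noteq> n - 1\<close>] from_x_nth(5,6)[OF 3] by simp
    next
      case 4
      then have i: "i \<noteq> n" "i \<noteq> n - 1" "i \<notin> {1..n-1}" using nn by auto
      show ?thesis unfolding to_x_nth(5,6)[OF i(1,2)] from_x_nth(7,8)[OF 4] using z(1)[OF 4] z(2)[OF i(3)] by simp
    qed
  qed
  then show ?thesis by (auto simp: prod_eq_iff fun_eq_iff)
qed

lemma from_to:
  assumes b: "b \<in> B n l"
  shows "from_x n (to_x n b) = b"
proof -
  have nonneg: "fst b n \<ge> 0" "snd b n \<ge> 0" using b nn by (auto simp: B_def)
  have z: "i \<notin> {1..n} \<Longrightarrow> fst b i = 0 \<and> snd b i = 0" for i using b by (auto simp: B_def)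
  have p: "fst b n = 0 \<or> snd b n = 0" using b by (auto simp: B_def)
  have "fst (from_x n (to_x n b)) i = fst b i \<and> snd (from_x n (to_x n b)) i = snd b i" for i
  proof -
    consider "i = n" | "i = n - 1" | "1 \<le> i" "i \<le> n - 2" | "i \<notin> {1..n}" using idx_cases[OF n, of i] by blast
    then show ?thesis
    proof cases
      case 1
      show ?thesis unfolding 1 from_x_nth to_x_nth using nonneg p by auto
    next
      case 2
      show ?thesis unfolding 2 to_x_nth from_x_nth using nonneg p by auto
    next
      case 3
      then have "i \<noteq> n" "i \<noteq> n - 1" using n by auto
      then show ?thesis unfolding from_x_nth(5,6)[OF 3] to_x_nth(5,6)[OF \<open>i \<noteq> n\<close> \<open>i \<noteq> n - 1\<close>] by simp
    next
      case 4
      show ?thesis unfolding from_x_nth(7,8)[OF 4] using z[OF 4] by simp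
    qed
  qed
  then show ?thesis by (auto simp: prod_eq_iff fun_eq_iff)
qed

lemma to_x_ustar: "to_x n (ustar l) = ux (int l)"
  using n by (auto simp: to_x_def ustar_def ux_def fun_eq_iff)

lemma ustar_B: "ustar l \<in> B n l"
proof -
  have "(\<Sum>i=1..n. fst (ustar l) i + snd (ustar l) i) = int l"
    using n by (simp add: ustar_def)
  then show ?thesis using n by (auto simp: B_def ustar_def)
qed

lemma from_x_ux: "from_x n (ux (int l)) = ustar l"
  using from_to[OF ustar_B, of l] by (simp add: to_x_ustar)

lemma R_eq: "R n b c = (from_x n (Ry' n (to_x n b) (to_x n c)), from_x n (Rx' n (to_x n b) (to_x n c)))"
  by (simp add: R_def Let_def)

lemma R_B:
  assumes b: "b \<in> B n l" and c: "c \<in> B n m"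
  shows "fst (R n b c) \<in> B n m" "snd (R n b c) \<in> B n l"
    "to_x n (fst (R n b c)) = Ry' n (to_x n b) (to_x n c)" "to_x n (snd (R n b c)) = Rx' n (to_x n b) (to_x n c)"
  using R_Bx[OF n to_x_Bx[OF b] to_x_Bx[OF c]] by (auto simp: R_eq intro: from_x_B to_from)

lemma vstar_0: "vstar n 0 b c = ell n (to_x n b) + ell n (to_x n c) - V n 0 (to_x n b) (to_x n c)"
  by (simp add: vstar_def Let_def PL_V0_star[OF n])

text \<open>Only the travelling factor \<open>b\<close> and its energies are recorded, which is what
  the invariance of \<open>moved\<close> and \<open>move_energy\<close> under rearrangement calls
  for.\<close>

lemma yang_baxter_B:
  assumes b: "b \<in> B n l" and c: "c \<in> B n m" and d: "d \<in> B n k"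
    and 1: "R n b c = (c1, b1)" and 2: "R n b1 d = (d1, b2)"
    and 3: "R n c d = (d2, c2)" and 4: "R n b d2 = (d3, b3)" and 5: "R n b3 c2 = (c3, b4)"
  shows "b2 = b4" "vstar n 0 b c + vstar n 0 b1 d = vstar n 0 b d2 + vstar n 0 b3 c2"
proof -
  let ?t = "to_x n"
  have "yang_baxter n (?t b, ?t c, ?t d)"
    by (rule yang_baxter_Bx[OF n]) (use to_x_Bx[OF b] to_x_Bx[OF c] to_x_Bx[OF d] in auto)
  note Y = this[unfolded yang_baxter_def, simplified]
  have B1: "c1 \<in> B n m" "b1 \<in> B n l" "?t c1 = Ry' n (?t b) (?t c)" "?t b1 = Rx' n (?t b) (?t c)" using R_B[OF b c] 1 by auto
  have B2: "b2 \<in> B n l" "?t b2 = Rx' n (?t b1) (?t d)" using R_B[OF B1(2) d] 2 by auto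
  have B3: "d2 \<in> B n k" "c2 \<in> B n m" "?t d2 = Ry' n (?t c) (?t d)" "?t c2 = Rx' n (?t c) (?t d)" using R_B[OF c d] 3 by auto
  have B4: "b3 \<in> B n l" "?t b3 = Rx' n (?t b) (?t d2)" using R_B[OF b B3(1)] 4 by auto
  have B5: "b4 \<in> B n l" "?t b4 = Rx' n (?t b3) (?t c2)" using R_B[OF B4(1) B3(2)] 5 by auto
  have "?t b2 = ?t b4" using Y unfolding B2 B5 B4 B3 B1 by simp
  then show "b2 = b4" using from_to[OF B2(1)] from_to[OF B5(1)] by metis
  have el: "ell n (?t u) = int l" if "u \<in> B n l" for u l using to_x_Bx[OF that] by (simp add: Bx_def)
  show "vstar n 0 b c + vstar n 0 b1 d = vstar n 0 b d2 + vstar n 0 b3 c2"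
    unfolding vstar_0 el[OF b] el[OF c] el[OF d] el[OF B1(2)] el[OF B3(1)] el[OF B3(2)] el[OF B4(1)]
    using Y unfolding B4 B3 B1 by simp
qed

text \<open>The increments of the unbarred entries are V^*_{i-1} - V^*_i and telescope; up to n - 2
  these entries coincide in both coordinate systems.\<close>

lemma vstar_a:
  assumes b: "b \<in> B n l" and c: "c \<in> B n m" and a: "a \<le> n - 2"
  shows "vstar n a b c = vstar n 0 b c + (\<Sum>i=1..a. fst (snd (R n b c)) i) - (\<Sum>i=1..a. fst b i)"
proof -
  let ?x = "to_x n b" and ?y = "to_x n c"
  have "(\<Sum>i=1..a. fst (snd (R n b c)) i) - (\<Sum>i=1..a. fst b i) = Vstar n 0 ?x ?y - Vstar n a ?x ?y"
    using a
  proof (induction a)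
    case (Suc a)
    have i: "Suc a \<noteq> n" "Suc a \<noteq> n - 1" "1 \<le> Suc a \<and> Suc a \<le> n - 1" using Suc.prems n by auto
    have "fst (snd (R n b c)) (Suc a) = fst (Rx' n ?x ?y) (Suc a)"
      using R_B(4)[OF b c] to_x_nth(5)[OF i(1,2), of "snd (R n b c)"] by simp
    also have "\<dots> = fst b (Suc a) + Vstar n a ?x ?y - Vstar n (Suc a) ?x ?y"
      unfolding Rx'_def fst_conv if_not_P[OF i(1)] if_P[OF i(3)] to_x_nth(5)[OF i(1,2)] by simp
    finally show ?case using Suc by simp
  qed simp
  then show ?thesis by (simp add: vstar_def Let_def)
qed

lemma astar_eq:
  assumes b: "b \<in> B n l"
  shows "astar n b = int l - snd (to_x n b) 1 + fst (to_x n b) 1"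
proof -
  have i: "1 \<noteq> n" "1 \<noteq> n - 1" "1 \<le> n" using n by auto
  have "int l = (\<Sum>i=1..n. fst b i + snd b i)" using b by (auto simp: B_def)
  also have "\<dots> = fst b 1 + snd b 1 + (\<Sum>i=2..n. fst b i + snd b i)"
    by (subst sum.atLeast_Suc_atMost[OF i(3)]) (simp add: numeral_2_eq_2)
  finally show ?thesis unfolding to_x_nth(5,6)[OF i(1,2)] astar_def by (simp add: sum.distrib)
qed

lemma gammastar_eq:
  assumes b: "b \<in> B n l" and a: "a \<le> n - 2"
  shows "gammastar n a b = astar n b - (\<Sum>i=1..a. fst b i)"
proof -
  have "(\<Sum>i=1..n. fst b i) = (\<Sum>i=1..a. fst b i) + (\<Sum>i=a+1..n. fst b i)"
    using sum.ub_add_nat[of 1 a "fst b" "n - a"] a by simp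
  moreover have "(\<Sum>i=1..n. fst b i) = fst b 1 + (\<Sum>i=2..n. fst b i)"
    using n by (subst sum.atLeast_Suc_atMost) (auto simp: numeral_2_eq_2)
  ultimately show ?thesis by (simp add: gammastar_def astar_def)
qed

lemma R_ustar:
  assumes b: "b \<in> B n l" and lm: "m \<ge> l"
  shows "snd (R n b (ustar m)) = ustar l"
proof -
  interpret at_ux n "to_x n b" "int l" "int m"
    by unfold_locales (use n to_x_Bx[OF b] in auto)
  have "snd (to_x n b) 1 \<ge> 0" using nonneg(2)[of 1] n1 by simp
  then have "Rx' n (to_x n b) (ux (int m)) = ux (int l)" using lm by (intro Rx_ux) linarith
  then show ?thesis by (simp add: R_eq to_x_ustar from_x_ux)
qed

lemma R_ustar_ustar:
  "R n (ustar l) (ustar m) = (ustar m, ustar l)" "vstar n 0 (ustar l) (ustar m) = 0"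
proof -
  show "R n (ustar l) (ustar m) = (ustar m, ustar l)"
    using n by (simp add: R_eq to_x_ustar from_x_ux R_ux_ux)
  interpret at_ux n "ux (int l)" "int l" "int m"
    by unfold_locales (use n ux_Bx[OF n] in auto)
  have big: "int m + snd (ux (int l)) 1 \<ge> int l" by (simp add: ux_def)
  show "vstar n 0 (ustar l) (ustar m) = 0"
    unfolding vstar_0 to_x_ustar ell_ux[OF n] using Vstar_x_ux[OF big, of 0] PL_V0_star[OF n] s_1 by (simp add: ux_def)
qed

definition carrierB :: "(nat \<Rightarrow> coords) \<Rightarrow> bool" where
  "carrierB C \<longleftrightarrow> carrier_fam n (\<lambda>k. to_x n (C k)) \<and> (\<forall>\<^sub>F k in sequentially. \<exists>m. C k \<in> B n m)"

lemma carrierB_ustar: "carrierB ustar"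
  unfolding carrierB_def to_x_ustar
  by (rule conjI[OF carrier_ux[OF n] always_eventually]) (blast intro: ustar_B)

lemma R_carrierB:
  assumes b: "b \<in> B n l" and C: "carrierB C"
  obtains b0 where "b0 \<in> B n l" "\<forall>\<^sub>F k in sequentially. snd (R n b (C k)) = b0"
    "carrierB (\<lambda>k. fst (R n b (C k)))" "\<forall>\<^sub>F k in sequentially. vstar n 0 b (C k) = astar n b"
proof -
  have c: "carrier_fam n (\<lambda>k. to_x n (C k))" and m: "\<forall>\<^sub>F k in sequentially. \<exists>m. C k \<in> B n m"
    using C by (auto simp: carrierB_def)
  obtain x0 where x0: "x0 \<in> Bx n (int l)" "\<forall>\<^sub>F k in sequentially. Rx' n (to_x n b) (to_x n (C k)) = x0"
     "carrier_fam n (\<lambda>k. Ry' n (to_x n b) (to_x n (C k)))"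
    by (rule R_carrier[OF n to_x_Bx[OF b] c])
  show ?thesis
  proof (rule that)
    show "from_x n x0 \<in> B n l" by (rule from_x_B[OF x0(1)])
    show "\<forall>\<^sub>F k in sequentially. snd (R n b (C k)) = from_x n x0"
      using x0(2) by eventually_elim (simp add: R_eq)
    have e: "\<forall>\<^sub>F k in sequentially. to_x n (fst (R n b (C k))) = Ry' n (to_x n b) (to_x n (C k)) \<and> (\<exists>m. fst (R n b (C k)) \<in> B n m)"
      using m by eventually_elim (use R_B[OF b] in blast)
    obtain d0 m0 where "\<forall>\<^sub>F k in sequentially. Ry' n (to_x n b) (to_x n (C k)) = addk (int k) d0 \<and>
        Ry' n (to_x n b) (to_x n (C k)) \<in> Bx n (int k + m0)"
      using x0(3) unfolding carrier_fam_def by blast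
    with e have "\<forall>\<^sub>F k in sequentially. to_x n (fst (R n b (C k))) = addk (int k) d0 \<and>
        to_x n (fst (R n b (C k))) \<in> Bx n (int k + m0)"
    proof eventually_elim
      case (elim k)
      have E: "to_x n (fst (R n b (C k))) = Ry' n (to_x n b) (to_x n (C k))" using elim(1) by blast
      show ?case unfolding E by (rule elim(2))
    qed
    moreover from e have "\<forall>\<^sub>F k in sequentially. \<exists>m. fst (R n b (C k)) \<in> B n m" by eventually_elim simp
    ultimately show "carrierB (\<lambda>k. fst (R n b (C k)))" unfolding carrierB_def carrier_fam_def by blast
    show "\<forall>\<^sub>F k in sequentially. vstar n 0 b (C k) = astar n b"
      using V_carrier[OF n to_x_Bx[OF b] c] unfolding vstar_0 astar_eq[OF b] .
  qed
qed

end

subsection \<open>Energies of states\<close>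

text \<open>The form in which b arrives, that is, the last entry of
  \<open>move_right\<close>.\<close>

fun moved :: "nat \<Rightarrow> coords \<Rightarrow> coords list \<Rightarrow> coords" where
  "moved n b [] = b"
| "moved n b (c # cs) = moved n (snd (R n b c)) cs"

definition valid :: "nat \<Rightarrow> coords list \<Rightarrow> bool" where
  "valid n cs \<longleftrightarrow> (\<forall>c\<in>set cs. \<exists>m. c \<in> B n m)"

lemma valid_simps [simp]: "valid n []" "valid n (c # cs) \<longleftrightarrow> (\<exists>m. c \<in> B n m) \<and> valid n cs"
  "valid n (xs @ ys) \<longleftrightarrow> valid n xs \<and> valid n ys"
  by (auto simp: valid_def)

lemma move_right_Cons: "move_right n b (c # cs) = fst (R n b c) # move_right n (snd (R n b c)) cs"
  and move_energy_Cons: "move_energy n a b (c # cs) = vstar n a b c + move_energy n a (snd (R n b c)) cs"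
  and carry_Cons: "carry n c (b # p) = snd (R n b c) # carry n (fst (R n b c)) p"
  by (auto simp: case_prod_beta)

lemma moved_append: "moved n b (xs @ ys) = moved n (moved n b xs) ys"
  by (induction xs arbitrary: b) auto

lemma move_energy_append: "move_energy n a b (xs @ ys) = move_energy n a b xs + move_energy n a (moved n b xs) ys"
  by (induction xs arbitrary: b) (simp_all add: move_energy_Cons del: move_energy.simps(2))

inductive Rstep :: "nat \<Rightarrow> coords list \<Rightarrow> coords list \<Rightarrow> bool" for n where
  "Rstep n (pre @ c # d # post) (pre @ fst (R n c d) # snd (R n c d) # post)"

abbreviation Req :: "nat \<Rightarrow> coords list \<Rightarrow> coords list \<Rightarrow> bool" where
  "Req n \<equiv> (Rstep n)\<^sup>*\<^sup>*"

lemma Rstep_Cons: "Rstep n cs cs' \<Longrightarrow> Rstep n (b # cs) (b # cs')"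
proof (induction rule: Rstep.induct)
  case (1 pre c d post)
  show ?case using Rstep.intros[of n "b # pre" c d post] by simp
qed

lemma Req_Cons: "Req n cs cs' \<Longrightarrow> Req n (b # cs) (b # cs')"
  by (induction rule: rtranclp_induct) (auto intro: Rstep_Cons rtranclp.rtrancl_into_rtrancl)

lemma Req_swap: "Req n (b # c # cs) (fst (R n b c) # snd (R n b c) # cs)"
  using Rstep.intros[of n "[]" b c cs] by auto

lemma Req_move_right: "Req n (b # cs) (move_right n b cs)"
proof (induction cs arbitrary: b)
  case (Cons c cs)
  show ?case unfolding move_right_Cons
    by (rule rtranclp_trans[OF Req_swap Req_Cons[OF Cons]])
qed simp

text \<open>Here each factor passes the original factors on its right instead of those rearranged by
  \<open>R\<close> as in \<open>total_energy\<close>; by the Yang-Baxter equation this collects the same energy.\<close>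

fun static_energy :: "nat \<Rightarrow> coords list \<Rightarrow> coords list \<Rightarrow> int" where
  "static_energy n [] cs = 0"
| "static_energy n (b # p) cs = move_energy n 0 b cs + static_energy n p (b # cs)"

text \<open>The condition under which a vacuum appended at the right end adds no energy; the list
  \<open>cs\<close> grows by the original factors, as in \<open>static_energy\<close>.\<close>

fun all_vacuum :: "nat \<Rightarrow> coords list \<Rightarrow> coords list \<Rightarrow> bool" where
  "all_vacuum n [] cs = True"
| "all_vacuum n (b # q) cs = ((\<exists>l. moved n b cs = ustar l) \<and> all_vacuum n q (b # cs))"

fun carry_energy :: "nat \<Rightarrow> nat \<Rightarrow> coords \<Rightarrow> coords list \<Rightarrow> int" where
  "carry_energy n a c [] = 0"
| "carry_energy n a c (b # p) = vstar n a b c + carry_energy n a (fst (R n b c)) p"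

text \<open>Each factor of p meets the current form of c before anything else, so these crossings
  can be performed beforehand, as one passage of c to the left.\<close>

lemma total_energy_carry:
  "total_energy n a p (c # cs) = carry_energy n a c p + total_energy n a (carry n c p) cs"
proof (induction p arbitrary: c cs)
  case (Cons b p)
  show ?case unfolding total_energy.simps(2) carry_Cons move_energy_Cons move_right_Cons Cons carry_energy.simps by simp
qed simp

lemma stable_valueI:
  assumes "\<forall>\<^sub>F l in sequentially. f l = v"
  shows "stable_value f = v"
  unfolding stable_value_def
proof (rule the_equality)
  show "\<forall>\<^sub>F l in sequentially. f l = v" by (rule assms)
  fix w assume "\<forall>\<^sub>F l in sequentially. f l = w"
  with assms have "\<forall>\<^sub>F l in sequentially. w = v" by eventually_elim simp
  then show "w = v" by simp
qed

lemma states_memD: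
  assumes "p \<in> states n ls" "b \<in> set p"
  obtains l where "l \<in> set ls" "b \<in> B n l"
proof -
  from assms(2) obtain i where i: "i < length p" "b = p ! i" by (auto simp: in_set_conv_nth)
  with assms(1) have "ls ! i \<in> set ls" "b \<in> B n (ls ! i)"
    by (auto simp: states_def list_all2_conv_all_nth)
  then show ?thesis by (rule that)
qed

lemma states_valid: "p \<in> states n ls \<Longrightarrow> valid n p"
  unfolding valid_def using states_memD by metis

section \<open>Invariance of energies under rearrangement\<close>

context
  fixes n :: nat
  assumes n: "n \<ge> 3"
begin

lemma moved_B: "b \<in> B n l \<Longrightarrow> valid n cs \<Longrightarrow> moved n b cs \<in> B n l"
proof (induction cs arbitrary: b)
  case (Cons c cs)
  then obtain m where "c \<in> B n m" by auto
  then show ?case using Cons R_B(2)[OF n Cons.prems(1)] by simp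
qed simp

text \<open>Before the two rearranged factors nothing differs; across them the Yang-Baxter equation
  gives the same energy and the same form of b, which then continues identically.\<close>

lemma Rstep_inv:
  assumes "Rstep n cs cs'" "valid n cs"
  shows "valid n cs' \<and> (\<forall>l. \<forall>b\<in>B n l. moved n b cs = moved n b cs' \<and> move_energy n 0 b cs = move_energy n 0 b cs')"
  using assms
proof (induction rule: Rstep.induct)
  case (1 pre c d post)
  obtain m k where c: "c \<in> B n m" and d: "d \<in> B n k" using 1 by auto
  note cd = R_B(1,2)[OF n c d]
  have "valid n (pre @ fst (R n c d) # snd (R n c d) # post)" using 1 cd by auto
  moreover have "moved n b (pre @ c # d # post) = moved n b (pre @ fst (R n c d) # snd (R n c d) # post) \<and>
      move_energy n 0 b (pre @ c # d # post) = move_energy n 0 b (pre @ fst (R n c d) # snd (R n c d) # post)"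
    if b: "b \<in> B n l" for b l
  proof -
    have b': "moved n b pre \<in> B n l" using moved_B[OF b] 1 by simp
    note Y = yang_baxter_B[OF n b' c d prod.collapse[symmetric] prod.collapse[symmetric] prod.collapse[symmetric]
        prod.collapse[symmetric] prod.collapse[symmetric]]
    show ?thesis unfolding moved_append move_energy_append move_energy_Cons moved.simps using Y by simp
  qed
  ultimately show ?case by blast
qed

lemma Req_inv:
  assumes "Req n cs cs'" "valid n cs"
  shows "valid n cs' \<and> (\<forall>l. \<forall>b\<in>B n l. moved n b cs = moved n b cs' \<and> move_energy n 0 b cs = move_energy n 0 b cs')"
  using assms
proof (induction rule: rtranclp_induct)
  case (step cs' cs'')
  then have IH: "valid n cs'" "\<forall>l. \<forall>b\<in>B n l. moved n b cs = moved n b cs' \<and> move_energy n 0 b cs = move_energy n 0 b cs'"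
    by auto
  from Rstep_inv[OF step(2) IH(1)] IH(2) show ?case by simp
qed simp

lemma Req_valid: "Req n cs cs' \<Longrightarrow> valid n cs \<Longrightarrow> valid n cs'"
  and Req_fin: "Req n cs cs' \<Longrightarrow> valid n cs \<Longrightarrow> b \<in> B n l \<Longrightarrow> moved n b cs' = moved n b cs"
  and Req_energy: "Req n cs cs' \<Longrightarrow> valid n cs \<Longrightarrow> b \<in> B n l \<Longrightarrow> move_energy n 0 b cs' = move_energy n 0 b cs"
  using Req_inv by (blast, metis, metis)

lemma total_energy_static:
  assumes "Req n cs' cs" "valid n cs'" "valid n p"
  shows "total_energy n 0 p cs = static_energy n p cs'"
  using assms
proof (induction p arbitrary: cs cs')
  case (Cons b p)
  then obtain l where b: "b \<in> B n l" by auto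
  have "Req n (b # cs') (move_right n b cs)"
    by (rule rtranclp_trans[OF Req_Cons[OF Cons.prems(1)] Req_move_right])
  then have "total_energy n 0 p (move_right n b cs) = static_energy n p (b # cs')"
    by (rule Cons.IH) (use Cons.prems b in auto)
  then show ?case using Req_energy[OF Cons.prems(1,2) b] by simp
qed simp

text \<open>Each factor reaches the appended vacuum as a vacuum, and two vacua cross with energy
  0.\<close>

lemma static_energy_all_vacuum: "all_vacuum n q cs \<Longrightarrow> static_energy n q (cs @ [ustar m]) = static_energy n q cs"
proof (induction q arbitrary: cs)
  case (Cons b q)
  then obtain l where "moved n b cs = ustar l" by auto
  then have "move_energy n 0 b (cs @ [ustar m]) = move_energy n 0 b cs"
    unfolding move_energy_append move_energy_Cons by (simp add: R_ustar_ustar[OF n])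
  moreover have "static_energy n q ((b # cs) @ [ustar m]) = static_energy n q (b # cs)" by (rule Cons.IH) (use Cons.prems in simp)
  ultimately show ?case by simp
qed simp

text \<open>The carrier is at least as long as each factor, as \<open>R_ustar\<close>
  demands.\<close>

definition small :: "nat \<Rightarrow> coords list \<Rightarrow> bool" where
  "small m p \<longleftrightarrow> (\<forall>b\<in>set p. \<exists>l\<le>m. b \<in> B n l)"

lemma moved_ustar:
  assumes "b \<in> B n l" "l \<le> m" "valid n cs"
  shows "moved n b (cs @ [ustar m]) = ustar l"
  unfolding moved_append using R_ustar[OF n moved_B[OF assms(1,3)] assms(2)] by simp

text \<open>Crossing the carrier and then \<open>qs\<close> is a rearranged form of the passage
  through \<open>cs @ [ustar m]\<close>, and the long vacuum at its end turns the factor into a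
  vacuum.\<close>

lemma all_vacuum_carry:
  assumes "Req n (cs @ [ustar m]) (c # qs)" "valid n cs" "small m p"
  shows "all_vacuum n (carry n c p) qs"
  using assms
proof (induction p arbitrary: c cs qs)
  case (Cons b p)
  then obtain l where b: "b \<in> B n l" "l \<le> m" by (auto simp: small_def)
  have v: "valid n (cs @ [ustar m])" using Cons.prems(2) ustar_B[OF n, of m] by auto
  have "moved n (snd (R n b c)) qs = moved n b (c # qs)" by simp
  also have "\<dots> = moved n b (cs @ [ustar m])" by (rule Req_fin[OF Cons.prems(1) v b(1)])
  also have "\<dots> = ustar l" by (rule moved_ustar[OF b Cons.prems(2)])
  finally have 1: "moved n (snd (R n b c)) qs = ustar l" .
  have "Req n ((b # cs) @ [ustar m]) (fst (R n b c) # snd (R n b c) # qs)"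
    unfolding append_Cons by (rule rtranclp_trans[OF Req_Cons[OF Cons.prems(1)] Req_swap])
  then have "all_vacuum n (carry n (fst (R n b c)) p) (snd (R n b c) # qs)"
    by (rule Cons.IH) (use Cons.prems b in \<open>auto simp: small_def\<close>)
  then show ?case unfolding carry_Cons using 1 by auto
qed simp

lemma move_energy_a:
  assumes "b \<in> B n l" "valid n cs" "a \<le> n - 2"
  shows "move_energy n a b cs = move_energy n 0 b cs + (\<Sum>i=1..a. fst (moved n b cs) i) - (\<Sum>i=1..a. fst b i)"
  using assms(1,2)
proof (induction cs arbitrary: b)
  case (Cons c cs)
  then obtain m where c: "c \<in> B n m" by auto
  have "snd (R n b c) \<in> B n l" by (rule R_B(2)[OF n Cons.prems(1) c])
  from Cons.IH[OF this] show ?case using Cons.prems(2) vstar_a[OF n Cons.prems(1) c assms(3)]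
    unfolding move_energy_Cons by simp
qed simp

text \<open>By \<open>move_energy_a\<close> the difference for each factor is governed by its
  initial and final unbarred entries, and the final ones vanish on a vacuum.\<close>

lemma total_energy_a:
  assumes "Req n (cs0 @ [ustar m]) cs" "valid n cs0" "small m p" "a \<le> n - 2"
  shows "total_energy n a p cs = total_energy n 0 p cs - (\<Sum>b\<leftarrow>p. \<Sum>i=1..a. fst b i)"
  using assms(1-3)
proof (induction p arbitrary: cs cs0)
  case (Cons b p)
  then obtain l where b: "b \<in> B n l" "l \<le> m" by (auto simp: small_def)
  have v: "valid n (cs0 @ [ustar m])" using Cons.prems(2) ustar_B[OF n, of m] by auto
  have "moved n b cs = ustar l"
    unfolding Req_fin[OF Cons.prems(1) v b(1)] by (rule moved_ustar[OF b Cons.prems(2)])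
  then have "move_energy n a b cs = move_energy n 0 b cs - (\<Sum>i=1..a. fst b i)"
    using move_energy_a[OF b(1) Req_valid[OF Cons.prems(1) v] assms(4)] by (simp add: ustar_def)
  moreover have "Req n ((b # cs0) @ [ustar m]) (move_right n b cs)"
    unfolding append_Cons by (rule rtranclp_trans[OF Req_Cons[OF Cons.prems(1)] Req_move_right])
  then have "total_energy n a p (move_right n b cs) = total_energy n 0 p (move_right n b cs) - (\<Sum>b\<leftarrow>p. \<Sum>i=1..a. fst b i)"
    by (rule Cons.IH) (use Cons.prems b in \<open>auto simp: small_def\<close>)
  ultimately show ?case by simp
qed simp

section \<open>Time evolution and the recursion for the energy\<close>

lemma carry_limit:
  assumes "p \<in> states n ls" "carrierB n C"
  shows "\<exists>q \<in> states n ls. \<forall>\<^sub>F k in sequentially. carry n (C k) p = q \<and> carry_energy n 0 (C k) p = (\<Sum>b\<leftarrow>p. astar n b)"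
  using assms unfolding states_def mem_Collect_eq
proof (induction p ls arbitrary: C rule: list_all2_induct)
  case (Cons b p l ls)
  obtain b0 where b0: "b0 \<in> B n l" "\<forall>\<^sub>F k in sequentially. snd (R n b (C k)) = b0"
    "carrierB n (\<lambda>k. fst (R n b (C k)))" "\<forall>\<^sub>F k in sequentially. vstar n 0 b (C k) = astar n b"
    by (rule R_carrierB[OF n Cons(1) Cons.prems])
  from Cons.IH[OF b0(3)] obtain q where q: "list_all2 (\<lambda>b l. b \<in> B n l) q ls"
    "\<forall>\<^sub>F k in sequentially. carry n (fst (R n b (C k))) p = q \<and> carry_energy n 0 (fst (R n b (C k))) p = (\<Sum>b\<leftarrow>p. astar n b)"
    by auto
  have "\<forall>\<^sub>F k in sequentially. carry n (C k) (b # p) = b0 # q \<and> carry_energy n 0 (C k) (b # p) = (\<Sum>b\<leftarrow>b # p. astar n b)"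
    using b0(2,4) q(2) by eventually_elim (simp add: carry_Cons del: carry.simps)
  then show ?case using b0(1) q(1) by (intro bexI[of _ "b0 # q"]) auto
qed auto

lemma states_small: "p \<in> states n ls \<Longrightarrow> \<forall>\<^sub>F m in sequentially. small m p"
proof -
  assume p: "p \<in> states n ls"
  have "small m p" if "m \<ge> sum_list ls" for m
    unfolding small_def
  proof
    fix b assume "b \<in> set p"
    then obtain l where "l \<in> set ls" "b \<in> B n l" using states_memD[OF p] by metis
    then show "\<exists>l\<le>m. b \<in> B n l" using member_le_sum_list[of l ls] that by (intro exI[of _ l]) auto
  qed
  then show ?thesis by (auto simp: eventually_sequentially)
qed

lemma Tstar_inf_props:
  assumes "p \<in> states n ls"
  shows "Tstar_inf n p \<in> states n ls" "\<forall>\<^sub>F m in sequentially. Tstar n m p = Tstar_inf n p"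
    "Estar n 0 p = (\<Sum>b\<leftarrow>p. astar n b) + Estar n 0 (Tstar_inf n p)"
proof -
  obtain q where q: "q \<in> states n ls"
    "\<forall>\<^sub>F m in sequentially. carry n (ustar m) p = q \<and> carry_energy n 0 (ustar m) p = (\<Sum>b\<leftarrow>p. astar n b)"
    using carry_limit[OF assms carrierB_ustar[OF n]] by blast
  then have T: "\<forall>\<^sub>F m in sequentially. Tstar n m p = q" unfolding Tstar_def by (auto elim: eventually_mono)
  have Tq: "Tstar_inf n p = q" unfolding Tstar_inf_def by (rule stable_valueI[OF T])
  show "Tstar_inf n p \<in> states n ls" "\<forall>\<^sub>F m in sequentially. Tstar n m p = Tstar_inf n p"
    unfolding Tq using q(1) T by auto
  \<comment> \<open>\<open>q\<close> does not depend on m, so it inherits the property from any m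
    that is both large enough for \<open>small\<close> and past the point of stabilization.\<close>
  have "\<forall>\<^sub>F m in sequentially. all_vacuum n q []"
    using states_small[OF assms] q(2)
  proof eventually_elim
    case (elim m)
    have "all_vacuum n (carry n (ustar m) p) []" by (rule all_vacuum_carry[of "[]" m]) (use elim in auto)
    then show ?case using elim by simp
  qed
  then have vq: "all_vacuum n q []" by simp
  have "valid n q" using q(1) by (rule states_valid)
  \<comment> \<open>The energy left over after the carrier has passed is thus again an energy of the
    same kind, now for \<open>q\<close>.\<close>
  then have "total_energy n 0 q [ustar m] = total_energy n 0 q []" for m
    using total_energy_static[of "[ustar m]" "[ustar m]" q] total_energy_static[of "[]" "[]" q] static_energy_all_vacuum[OF vq, of m] ustar_B[OF n, of m] by auto
  then have Eq: "Estar n 0 q = total_energy n 0 q []" unfolding Estar_def by (intro stable_valueI) simp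
  have "\<forall>\<^sub>F m in sequentially. total_energy n 0 p [ustar m] = (\<Sum>b\<leftarrow>p. astar n b) + total_energy n 0 q []"
    using q(2) by eventually_elim (simp add: total_energy_carry)
  then show "Estar n 0 p = (\<Sum>b\<leftarrow>p. astar n b) + Estar n 0 (Tstar_inf n p)"
    unfolding Tq Eq unfolding Estar_def by (rule stable_valueI)
qed

lemma Estar_a:
  assumes "p \<in> states n ls" "a \<le> n - 2"
  shows "Estar n a p = Estar n 0 p - (\<Sum>b\<leftarrow>p. \<Sum>i=1..a. fst b i)"
proof -
  obtain q where q: "\<forall>\<^sub>F m in sequentially. carry n (ustar m) p = q \<and> carry_energy n 0 (ustar m) p = (\<Sum>b\<leftarrow>p. astar n b)"
    using carry_limit[OF assms(1) carrierB_ustar[OF n]] by blast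
  then have 1: "\<forall>\<^sub>F m in sequentially. total_energy n 0 p [ustar m] = (\<Sum>b\<leftarrow>p. astar n b) + total_energy n 0 q []"
    by eventually_elim (simp add: total_energy_carry)
  then have E0: "Estar n 0 p = (\<Sum>b\<leftarrow>p. astar n b) + total_energy n 0 q []"
    unfolding Estar_def by (rule stable_valueI)
  have "\<forall>\<^sub>F m in sequentially. total_energy n a p [ustar m] = Estar n 0 p - (\<Sum>b\<leftarrow>p. \<Sum>i=1..a. fst b i)"
    using 1 states_small[OF assms(1)]
  proof eventually_elim
    case (elim m)
    have "total_energy n a p [ustar m] = total_energy n 0 p [ustar m] - (\<Sum>b\<leftarrow>p. \<Sum>i=1..a. fst b i)"
      by (rule total_energy_a[of "[]" m]) (use elim assms in auto)
    then show ?case using elim E0 by simp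
  qed
  then show ?thesis unfolding Estar_def[of n a] by (rule stable_valueI)
qed

text \<open>The carrier passes vacua unchanged, so the factor after them meets the initial carrier
  and leaves it as a vacuum.\<close>

lemma vacuum_grows:
  assumes "p \<in> states n ls" "take k p = take k (map ustar ls)"
  shows "take (Suc k) (Tstar_inf n p) = take (Suc k) (map ustar ls)"
proof -
  have *: "small m p \<Longrightarrow> list_all2 (\<lambda>b l. b \<in> B n l) p ls \<Longrightarrow> take k p = take k (map ustar ls) \<Longrightarrow>
    take (Suc k) (carry n (ustar m) p) = take (Suc k) (map ustar ls)" for m
  proof (induction k arbitrary: p ls)
    case 0
    show ?case
    proof (cases p)
      case (Cons b p')
      then obtain l ls' where l: "ls = l # ls'" "b \<in> B n l" using 0 by (cases ls) auto
      obtain l' where l': "l' \<le> m" "b \<in> B n l'" using 0(1) Cons by (auto simp: small_def)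
      \<comment> \<open>\<open>small\<close> supplies some length of b, not a priori the one in
        \<open>ls\<close>; the length of an element is unique.\<close>
      have "int l = int l'" using l(2) l'(2) by (simp add: B_def)
      then show ?thesis using l l' R_ustar[OF n l(2), of m] unfolding Cons carry_Cons by simp
    qed (use 0 in auto)
  next
    case (Suc k)
    show ?case
    proof (cases p)
      case (Cons b p')
      then obtain l ls' where l: "ls = l # ls'" "b \<in> B n l" "list_all2 (\<lambda>b l. b \<in> B n l) p' ls'" using Suc.prems by (cases ls) auto
      then have b: "b = ustar l" "take k p' = take k (map ustar ls')" using Suc.prems Cons by auto
      have "small m p'" using Suc.prems Cons by (auto simp: small_def)
      from Suc.IH[OF this l(3) b(2)] show ?thesis
        unfolding Cons l(1) carry_Cons b(1) R_ustar_ustar(1)[OF n] by simp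
    qed (use Suc.prems in auto)
  qed
  have "\<forall>\<^sub>F m in sequentially. take (Suc k) (Tstar_inf n p) = take (Suc k) (map ustar ls)"
    using states_small[OF assms(1)] Tstar_inf_props(2)[OF assms(1)]
  proof eventually_elim
    case (elim m)
    have "list_all2 (\<lambda>b l. b \<in> B n l) p ls" using assms(1) by (simp add: states_def)
    from *[OF elim(1) this assms(2)] show ?case using elim(2) by (simp add: Tstar_def)
  qed
  then show ?thesis by simp
qed

lemma Tstar_inf_power:
  assumes "p \<in> states n ls"
  shows "(Tstar_inf n ^^ t) p \<in> states n ls" "take t ((Tstar_inf n ^^ t) p) = take t (map ustar ls)"
    "Estar n 0 p = (\<Sum>s<t. \<Sum>b\<leftarrow>(Tstar_inf n ^^ s) p. astar n b) + Estar n 0 ((Tstar_inf n ^^ t) p)"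
proof -
  have "(Tstar_inf n ^^ t) p \<in> states n ls \<and> take t ((Tstar_inf n ^^ t) p) = take t (map ustar ls) \<and>
    Estar n 0 p = (\<Sum>s<t. \<Sum>b\<leftarrow>(Tstar_inf n ^^ s) p. astar n b) + Estar n 0 ((Tstar_inf n ^^ t) p)"
  proof (induction t)
    case (Suc t)
    then have IH: "(Tstar_inf n ^^ t) p \<in> states n ls" "take t ((Tstar_inf n ^^ t) p) = take t (map ustar ls)"
      "Estar n 0 p = (\<Sum>s<t. \<Sum>b\<leftarrow>(Tstar_inf n ^^ s) p. astar n b) + Estar n 0 ((Tstar_inf n ^^ t) p)" by auto
    show ?case using Tstar_inf_props(1)[OF IH(1)] vacuum_grows[OF IH(1,2)] Tstar_inf_props(3)[OF IH(1)] IH(3)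
      by simp
  qed (use assms in auto)
  then show "(Tstar_inf n ^^ t) p \<in> states n ls" "take t ((Tstar_inf n ^^ t) p) = take t (map ustar ls)"
    "Estar n 0 p = (\<Sum>s<t. \<Sum>b\<leftarrow>(Tstar_inf n ^^ s) p. astar n b) + Estar n 0 ((Tstar_inf n ^^ t) p)" by auto
qed

lemma vacuum_energy: "Estar n 0 (map ustar ls) = 0" "(\<Sum>b\<leftarrow>map ustar ls. astar n b) = 0"
proof -
  have 1: "move_energy n 0 (ustar l) (map ustar ms) = 0" for l ms
    by (induction ms) (simp_all add: move_energy_Cons R_ustar_ustar[OF n] del: move_energy.simps(2))
  have "static_energy n (map ustar ls) (map ustar ms) = 0" for ms
  proof (induction ls arbitrary: ms)
    case (Cons l ls)
    have "static_energy n (map ustar ls) (map ustar (l # ms)) = 0" by (rule Cons)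
    then show ?case using 1 by simp
  qed simp
  from this[of "[m]" for m] have "static_energy n (map ustar ls) [ustar m] = 0" for m by simp
  moreover have "valid n (map ustar ms)" for ms using ustar_B[OF n] by (auto simp: valid_def)
  ultimately have "total_energy n 0 (map ustar ls) [ustar m] = 0" for m
    using total_energy_static[of "[ustar m]" "[ustar m]" "map ustar ls"] ustar_B[OF n, of m] by auto
  then show "Estar n 0 (map ustar ls) = 0" unfolding Estar_def by (intro stable_valueI) simp
  have "astar n (ustar l) = 0" for l by (auto simp: astar_def ustar_def intro!: sum.neutral)
  then show "(\<Sum>b\<leftarrow>map ustar ls. astar n b) = 0" by (induction ls) auto
qed

end

lemma sum_nth: "(\<Sum>j<length p. f (p ! j)) = (\<Sum>b\<leftarrow>p. f b :: int)"
  by (simp add: sum_list_sum_nth atLeast0LessThan)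

theorem proposition4p3:
  fixes n a :: nat and ls :: "nat list" and p :: "coords list"
  assumes "n \<ge> 3"
    and "\<forall>l\<in>set ls. l \<ge> 1"
    and "p \<in> states n ls"
    and "1 \<le> a" and "a \<le> n - 2"
  shows "Estar n a p = rhostar n a p"
proof -
  note n = assms(1) and p = assms(3)
  let ?T = "\<lambda>t. (Tstar_inf n ^^ t) p"
  let ?A = "\<lambda>q. \<Sum>b\<leftarrow>q. astar n b"
  have len: "length (?T t) = length ls" for t
    using Tstar_inf_power(1)[OF n p, of t] by (auto simp: states_def dest: list_all2_lengthD)
  have vac: "?T t = map ustar ls" if "t \<ge> length ls" for t
    using Tstar_inf_power(2)[OF n p, of t] len[of t] that by simp
  have e: "(\<Sum>j<length p. astar n (?T (Suc t) ! j)) = ?A (?T (Suc t))" for t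
    using sum_nth[of "astar n" "?T (Suc t)"] len[of "Suc t"] len[of 0] by simp
  have "(\<Sum>t. \<Sum>j<length p. astar n (?T (Suc t) ! j)) = (\<Sum>t<length ls. ?A (?T (Suc t)))"
    unfolding e
  proof (rule suminf_finite)
    fix t assume "t \<notin> {..<length ls}"
    then have "?T (Suc t) = map ustar ls" by (intro vac) simp
    then show "?A (?T (Suc t)) = 0" by (simp only: vacuum_energy(2)[OF n])
  qed simp
  \<comment> \<open>One step beyond \<open>length ls\<close>, so that splitting off t = 0 leaves
    exactly the range of the series above.\<close>
  moreover have "Estar n 0 p = (\<Sum>t<Suc (length ls). ?A (?T t))"
    using Tstar_inf_power(3)[OF n p, of "Suc (length ls)"] vac[of "Suc (length ls)"] vacuum_energy(1)[OF n] by simp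
  then have "Estar n 0 p = ?A p + (\<Sum>t<length ls. ?A (?T (Suc t)))"
    unfolding sum.lessThan_Suc_shift by simp
  \<comment> \<open>At t = 0 the counting function has \<open>gammastar\<close> in place of
    \<open>astar\<close>; the difference is the correction in \<open>Estar_a\<close>.\<close>
  moreover have "(\<Sum>j<length p. gammastar n a (p ! j)) = ?A p - (\<Sum>b\<leftarrow>p. \<Sum>i=1..a. fst b i)"
  proof -
    have "gammastar n a b = astar n b - (\<Sum>i=1..a. fst b i)" if "b \<in> set p" for b
      using states_memD[OF p that] gammastar_eq[OF n _ assms(5)] by metis
    then have "(\<Sum>b\<leftarrow>p. gammastar n a b) = (\<Sum>b\<leftarrow>p. astar n b - (\<Sum>i=1..a. fst b i))"
      by (intro arg_cong[where f = sum_list] map_cong) auto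
    then show ?thesis unfolding sum_nth by (simp add: sum_list_subtractf)
  qed
  ultimately show ?thesis unfolding rhostar_def Estar_a[OF n p assms(5)] by simp
qed

end
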